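(* Let $M$ be a smooth manifold, let $F,\bar F$ be closed 2-forms on $M$ and let $H$ be a 3-form on $M$ with $dH + F\wedge\bar F = 0$. Let $(\mathcal{E},\mathcal{P})$ and $(\bar{\mathcal{E}},\bar{\mathcal{P}})$ be the corresponding T-dual dg-manifolds over $(T[1]M,d)$, with $$Q_{\mathcal P}=d+F\partial_q+(H+q\bar F)\partial_t,\qquad Q_{\bar{\mathcal P}}=d+\bar F\partial_{\bar q}+(H+\bar qF)\partial_t .$$ Then the map $$\Phi: \mathfrak{sym}^*(\mathcal{P},Q_{\mathcal P}) \to \mathfrak{sym}^*(\bar{\mathcal P},Q_{\bar{\mathcal P}})$$ defined by $$\mathcal{L}_X + A\partial_q + (B+q\bar A)\partial_t \mapsto \mathcal{L}_X - \bar A\,\partial_{\bar q} + (B - \bar q A)\partial_t,$$ $$\iota_Y + f\partial_q + (C+q\bar f)\partial_t \mapsto \iota_Y + \bar f\,\partial_{\bar q} + (C+\bar q f)\partial_t,$$ $$h\,\partial_t\mapsto h\,\partial_t$$ in degrees $0$, $-1$, $-2$ respectively, is an isomorphism of differential graded Lie algebras. In particular, the induced map $$\mathrm{D}\Phi: \mathrm{D}\mathfrak{sym}^*(\mathcal{P},Q_{\mathcal P}) \to \mathrm{D}\mathfrak{sym}^*(\bar{\mathcal P},Q_{\bar{\mathcal P}})$$ on the derived dg-Leibniz algebras is also an isomorphism.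
   Context: Let $q,\bar q$ be variables of degree $1$ and $t$ a variable of degree $2$. The dg-manifold $\mathcal P$ has graded commutative algebra of functions $C^*(\mathcal P)=\Omega^\bullet M\otimes\Lambda[q]\otimes\mathbb{R}[t]$, and $Q_{\mathcal P}$ is the degree 1 derivation that is the De Rham differential on $\Omega^\bullet M$ and sends $q\mapsto F$, $t\mapsto H+q\bar F$; it is an $\mathbb R[2]$-bundle over the dg-manifold $\mathcal E$ with functions $\Omega^\bullet M\otimes\Lambda[q]$ and differential $d+F\partial_q$. Likewise $C^*(\bar{\mathcal P})=\Omega^\bullet M\otimes\Lambda[\bar q]\otimes\mathbb{R}[t]$ with $Q_{\bar{\mathcal P}}$ sending $\bar q\mapsto\bar F$, $t\mapsto H+\bar qF$, over $\bar{\mathcal E}$ with functions $\Omega^\bullet M\otimes\Lambda[\bar q]$ and differential $d+\bar F\partial_{\bar q}$. The pairs $(\mathcal E,\mathcal P)$ and $(\bar{\mathcal E},\bar{\mathcal P})$ are called T-dual. Vector fields of degree $k$ are graded derivations of degree $k$ of the algebra of functions, with the graded commutator bracket. The Lie derivative $\mathcal L_X$ and contraction $\iota_Y$ by vector fields on $M$ act on $\Omega^\bullet M$ as usual and are extended by zero on $q$ and $t$. The (infinitesimal) symmetries $\mathfrak{sym}^*(\mathcal P,Q_{\mathcal P})$ form the differential graded Lie algebra with differential $[Q_{\mathcal P},\_]$ (zero on degree $0$), bracket the graded commutator of derivations, and nonzero only in degrees $-2,-1,0$, where: - $\mathfrak{sym}^{-2}=\{h\,\partial_t : h\in C^\infty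 M\}$; - $\mathfrak{sym}^{-1}=\{\iota_Y+f\partial_q+(C+q\bar f)\partial_t : Y\in\mathfrak XM,\ f,\bar f\in C^\infty M,\ C\in\Omega^1M\}$; - $\mathfrak{sym}^0=\{\mathcal L_X+A\partial_q+(B+q\bar A)\partial_t : X\in\mathfrak XM,\ A,\bar A\in\Omega^1M,\ B\in\Omega^2M\}$ subject to commuting with $Q_{\mathcal P}$, i.e. to $dA-\mathcal L_XF=0$, $dB-\mathcal L_XH+F\wedge\bar A-A\wedge\bar F=0$, $d\bar A+\mathcal L_X\bar F=0$. $\mathfrak{sym}^*(\bar{\mathcal P},Q_{\bar{\mathcal P}})$ is described in the same way with $q$ replaced by $\bar q$ and the roles of $F$ and $\bar F$ exchanged. The derived dg-Leibniz algebra is the complex $\mathrm D\mathfrak{sym}^*=\mathfrak{sym}^{*<0}[1]$, i.e. $\mathrm D\mathfrak{sym}^k=\mathfrak{sym}^{k-1}$ for $k\le 0$, with differential $\delta=[Q,\_]$ (zero on $\mathrm D\mathfrak{sym}^0$) and derived bracket $\lfloor a,b\rfloor=(-1)^{\|a\|}[[Q,a],b]$, where $\|a\|=|a|+1$ is the degree of $a$ in $\mathrm D\mathfrak{sym}^*$ and $|a|$ its degree in $\mathfrak{sym}^*$. It satisfies $\delta\lfloor a,b\rfloor=\lfloor\delta a,b\rfloor+(-1)^{\|a\|}\lfloor a,\delta b\rfloor$ and $\lfloor a,\lfloor b,c\rfloor\rfloor=\lfloor\lfloor a,b\rfloor,c\rfloor+(-1)^{\|a\|\|b\|}\lfloor b,\lfloor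 a,c\rfloor\rfloor$. $\mathrm D\Phi$ is the restriction of $\Phi$ to negative degrees, shifted.
   Formalization: The derivation rule of δ for the derived bracket is not asserted for ‖a‖<0, ‖b‖=0, where it fails because δ is cut off to zero in degree 0 (e.g. a=h∂_t, b=ι_Y); all other dg-Leibniz axioms and the full isomorphism DΦ are stated. *)

theory Defs
  imports "HOL-Analysis.Analysis" "HOL-Library.Function_Algebras"
begin

text \<open>
  All spaces below (smooth functions, vector fields, forms, superfunctions and derivations) are
  subsets of function types with the pointwise operations; an element of such a space is
  required to vanish outside its domain of definition, so that equality in HOL is equality of
  the mathematical objects.
\<close>

instantiation "fun" :: (type, real_vector) real_vector
begin

definition scaleR_fun :: "real \<Rightarrow> ('a \<Rightarrow> 'b) \<Rightarrow> 'a \<Rightarrow> 'b"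
  where "scaleR_fun c f = (\<lambda>x. c *\<^sub>R f x)"

instance
  by standard (simp_all add: scaleR_fun_def fun_eq_iff scaleR_add_right scaleR_add_left)

end


section \<open>Smooth manifolds\<close>

text \<open>
  \<open>Euclidean_space n\<close> is the library's \<open>n\<close>-dimensional space of sequences vanishing from index
  \<open>n\<close> on.  This covers all dimensions \<open>n \<ge> 0\<close>, including \<open>0\<close>, which the class
  \<open>euclidean_space\<close> excludes.  In the second clause, \<open>W\<close> is open, so the derivative at \<open>x i\<close>
  depends on the values of \<open>f\<close> on \<open>W\<close> only.
\<close>

primrec Ck_on :: "nat \<Rightarrow> nat \<Rightarrow> (nat \<Rightarrow> real) set \<Rightarrow> ((nat \<Rightarrow> real) \<Rightarrow> real) \<Rightarrow> bool" where
  "Ck_on n 0 W f \<longleftrightarrow> continuous_map (subtopology (Euclidean_space n) W) euclideanreal f"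
| "Ck_on n (Suc k) W f \<longleftrightarrow>
     continuous_map (subtopology (Euclidean_space n) W) euclideanreal f \<and>
     (\<forall>i<n. \<exists>g. Ck_on n k W g \<and>
        (\<forall>x\<in>W. ((\<lambda>s. f (x(i := s))) has_real_derivative g x) (at (x i))))"

definition smooth_on :: "nat \<Rightarrow> (nat \<Rightarrow> real) set \<Rightarrow> ((nat \<Rightarrow> real) \<Rightarrow> real) \<Rightarrow> bool"
  where "smooth_on n W f \<longleftrightarrow> (\<forall>k. Ck_on n k W f)"

record 'a manifold =
  mdim :: nat
  mtop :: "'a topology"
  atlas :: "('a set \<times> ('a \<Rightarrow> nat \<Rightarrow> real)) set"

abbreviation points :: "'a manifold \<Rightarrow> 'a set"
  where "points M \<equiv> topspace (mtop M)"

definition is_chart :: "nat \<Rightarrow> 'a topology \<Rightarrow> 'a set \<Rightarrow> ('a \<Rightarrow> nat \<Rightarrow> real) \<Rightarrow> bool"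
  where "is_chart n T U \<phi> \<longleftrightarrow>
    openin T U \<and> openin (Euclidean_space n) (\<phi> ` U) \<and>
    homeomorphic_map (subtopology T U) (subtopology (Euclidean_space n) (\<phi> ` U)) \<phi>"

definition smooth_manifold :: "'a manifold \<Rightarrow> bool"
  where "smooth_manifold M \<longleftrightarrow>
    Hausdorff_space (mtop M) \<and> second_countable (mtop M) \<and>
    (\<forall>(U, \<phi>) \<in> atlas M. is_chart (mdim M) (mtop M) U \<phi>) \<and>
    (\<Union>(U, \<phi>) \<in> atlas M. U) = points M \<and>
    (\<forall>(U, \<phi>) \<in> atlas M. \<forall>(V, \<psi>) \<in> atlas M. \<forall>i < mdim M.
       smooth_on (mdim M) (\<phi> ` (U \<inter> V)) (\<lambda>x. \<psi> (inv_into U \<phi> x) i))"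

definition smooth_functions :: "'a manifold \<Rightarrow> ('a \<Rightarrow> real) set"
  where "smooth_functions M =
    {f. (\<forall>p. p \<notin> points M \<longrightarrow> f p = 0) \<and>
        (\<forall>(U, \<phi>) \<in> atlas M. smooth_on (mdim M) (\<phi> ` U) (\<lambda>x. f (inv_into U \<phi> x)))}"


section \<open>Vector fields and differential forms\<close>

text \<open>
  Vector fields are the derivations of the algebra of smooth functions, and \<open>k\<close>-forms are the
  alternating \<open>C\<^sup>\<infinity>(M)\<close>-multilinear maps from \<open>k\<close>-tuples of vector fields to smooth functions
  (the definitions used e.g. in Helgason's "Differential Geometry, Lie Groups, and Symmetric
  Spaces").
\<close>

type_synonym 'a vfield = "('a \<Rightarrow> real) \<Rightarrow> ('a \<Rightarrow> real)"

definition vfields :: "'a manifold \<Rightarrow> 'a vfield set"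
  where "vfields M =
    {X. (\<forall>f \<in> smooth_functions M. X f \<in> smooth_functions M) \<and>
        (\<forall>f. f \<notin> smooth_functions M \<longrightarrow> X f = 0) \<and>
        (\<forall>f \<in> smooth_functions M. \<forall>g \<in> smooth_functions M. \<forall>c.
           X (c *\<^sub>R f + g) = c *\<^sub>R X f + X g) \<and>
        (\<forall>f \<in> smooth_functions M. \<forall>g \<in> smooth_functions M. X (f * g) = X f * g + f * X g)}"

definition vf_scale :: "('a \<Rightarrow> real) \<Rightarrow> 'a vfield \<Rightarrow> 'a vfield"
  where "vf_scale f X = (\<lambda>g. f * X g)"

definition vf_bracket :: "'a vfield \<Rightarrow> 'a vfield \<Rightarrow> 'a vfield"
  where "vf_bracket X Y = (\<lambda>f. X (Y f) - Y (X f))"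

text \<open>
  A value of type \<open>'a form\<close> takes lists of arguments of every length, so that it represents an
  inhomogeneous form: its restriction to lists of length \<open>k\<close> is the component of degree \<open>k\<close>.
\<close>

type_synonym 'a form = "'a vfield list \<Rightarrow> 'a \<Rightarrow> real"

definition kforms :: "'a manifold \<Rightarrow> nat \<Rightarrow> 'a form set"
  where "kforms M k =
    {\<omega>. (\<forall>xs. length xs = k \<and> set xs \<subseteq> vfields M \<longrightarrow> \<omega> xs \<in> smooth_functions M) \<and>
        (\<forall>xs. \<not> (length xs = k \<and> set xs \<subseteq> vfields M) \<longrightarrow> \<omega> xs = 0) \<and>
        (\<forall>xs i. length xs = k \<and> set xs \<subseteq> vfields M \<and> i < k \<longrightarrow>
           (\<forall>X \<in> vfields M. \<forall>Y \<in> vfields M.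
              \<omega> (xs[i := X + Y]) = \<omega> (xs[i := X]) + \<omega> (xs[i := Y])) \<and>
           (\<forall>f \<in> smooth_functions M. \<forall>X \<in> vfields M.
              \<omega> (xs[i := vf_scale f X]) = f * \<omega> (xs[i := X]))) \<and>
        (\<forall>xs i j. length xs = k \<and> set xs \<subseteq> vfields M \<and> i < j \<and> j < k \<and> xs ! i = xs ! j \<longrightarrow>
           \<omega> xs = 0)}"

definition forms :: "'a manifold \<Rightarrow> 'a form set"
  where "forms M =
    {\<omega>. (\<forall>k. (\<lambda>xs. if length xs = k then \<omega> xs else 0) \<in> kforms M k) \<and>
        (\<exists>N. \<forall>xs. length xs > N \<longrightarrow> \<omega> xs = 0)}"

definition of_fun :: "('a \<Rightarrow> real) \<Rightarrow> 'a form"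
  where "of_fun f = (\<lambda>xs. if xs = [] then f else 0)"

text \<open>
  The wedge product is the sum over shuffles (without factorials), matching the normalisation of
  \<open>ext_d\<close>: the set \<open>I\<close> contains the positions of the arguments of the first factor, and the
  sign is that of the shuffle.
\<close>

definition wedge :: "'a form \<Rightarrow> 'a form \<Rightarrow> 'a form"  (infixl \<open>\<^bold>\<and>\<close> 70)
  where "\<alpha> \<^bold>\<and> \<beta> = (\<lambda>xs. \<Sum>I \<in> Pow {..<length xs}.
    (-1) ^ card {(i, j). i \<in> I \<and> j \<in> {..<length xs} - I \<and> j < i} *\<^sub>R
      (\<alpha> (nths xs I) * \<beta> (nths xs (- I))))"

definition contract :: "'a vfield \<Rightarrow> 'a form \<Rightarrow> 'a form"
  where "contract Y \<omega> = (\<lambda>xs. \<omega> (Y # xs))"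

definition lie_deriv :: "'a manifold \<Rightarrow> 'a vfield \<Rightarrow> 'a form \<Rightarrow> 'a form"
  where "lie_deriv M X \<omega> = (\<lambda>xs.
    if set xs \<subseteq> vfields M
    then X (\<omega> xs) - (\<Sum>i<length xs. \<omega> (xs[i := vf_bracket X (xs ! i)]))
    else 0)"

definition omit :: "nat \<Rightarrow> 'b list \<Rightarrow> 'b list"
  where "omit i xs = take i xs @ drop (Suc i) xs"

definition ext_d :: "'a manifold \<Rightarrow> 'a form \<Rightarrow> 'a form"
  where "ext_d M \<omega> = (\<lambda>xs.
    if set xs \<subseteq> vfields M
    then (\<Sum>i<length xs. (-1) ^ i *\<^sub>R (xs ! i) (\<omega> (omit i xs)))
       + (\<Sum>j<length xs. \<Sum>i<j. (-1) ^ (i + j) *\<^sub>R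
            \<omega> (vf_bracket (xs ! i) (xs ! j) # omit i (omit j xs)))
    else 0)"


section \<open>The algebra of superfunctions and its derivations\<close>

text \<open>
  An element of \<open>\<Omega>(M) \<otimes> \<Lambda>[q] \<otimes> \<real>[t]\<close> is represented by its coefficients, written to the
  left of the monomials: \<open>u\<close> stands for the sum over \<open>j\<close> of \<open>(u False j + u True j q) t^j\<close>.
  The variable is called \<open>q\<close> throughout; the T-dual side, with the variable written with a bar,
  is the same algebra.
\<close>

type_synonym 'a sfun = "bool \<Rightarrow> nat \<Rightarrow> 'a form"

definition superfunctions :: "'a manifold \<Rightarrow> 'a sfun set"
  where "superfunctions M =
    {u. (\<forall>b j. u b j \<in> forms M) \<and> (\<exists>N. \<forall>b j. j > N \<longrightarrow> u b j = 0)}"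

definition homogeneous :: "'a manifold \<Rightarrow> int \<Rightarrow> 'a sfun set"
  where "homogeneous M n =
    {u \<in> superfunctions M.
       \<forall>b j xs. int (length xs) + of_bool b + 2 * int j \<noteq> n \<longrightarrow> u b j xs = 0}"

definition parity :: "'a form \<Rightarrow> 'a form"
  where "parity \<omega> = (\<lambda>xs. (-1) ^ length xs *\<^sub>R \<omega> xs)"

text \<open>The involution \<open>parity\<close> accounts for moving \<open>q\<close> past a form: \<open>q \<omega> = parity \<omega> q\<close>.\<close>

definition smult :: "'a sfun \<Rightarrow> 'a sfun \<Rightarrow> 'a sfun"  (infixl \<open>\<odot>\<close> 70)
  where "u \<odot> v = (\<lambda>b j.
    if b then (\<Sum>i\<le>j. u False i \<^bold>\<and> v True (j - i) + u True i \<^bold>\<and> parity (v False (j - i)))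
         else (\<Sum>i\<le>j. u False i \<^bold>\<and> v False (j - i)))"

definition of_form :: "'a form \<Rightarrow> 'a sfun"
  where "of_form \<omega> = (\<lambda>b j. if \<not> b \<and> j = 0 then \<omega> else 0)"

definition q_var :: "'a manifold \<Rightarrow> 'a sfun"
  where "q_var M = (\<lambda>b j. if b \<and> j = 0 then of_fun (indicat_real (points M)) else 0)"

type_synonym 'a sop = "'a sfun \<Rightarrow> 'a sfun"

definition on_superfunctions :: "'a manifold \<Rightarrow> 'a sop \<Rightarrow> 'a sop"
  where "on_superfunctions M D = (\<lambda>u. if u \<in> superfunctions M then D u else 0)"

definition graded_derivations :: "'a manifold \<Rightarrow> int \<Rightarrow> 'a sop set"
  where "graded_derivations M k =
    {D. (\<forall>u. u \<notin> superfunctions M \<longrightarrow> D u = 0) \<and>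
        (\<forall>u \<in> superfunctions M. D u \<in> superfunctions M) \<and>
        (\<forall>u \<in> superfunctions M. \<forall>v \<in> superfunctions M. \<forall>c. D (c *\<^sub>R u + v) = c *\<^sub>R D u + D v) \<and>
        (\<forall>n. \<forall>u \<in> homogeneous M n. D u \<in> homogeneous M (n + k)) \<and>
        (\<forall>n. \<forall>u \<in> homogeneous M n. \<forall>v \<in> superfunctions M.
           D (u \<odot> v) = D u \<odot> v + ((-1) powi (k * n)) *\<^sub>R (u \<odot> D v))}"

definition lmult :: "'a sfun \<Rightarrow> 'a sop \<Rightarrow> 'a sop"  (infixr \<open>\<cdot>\<close> 75)
  where "g \<cdot> D = (\<lambda>u. g \<odot> D u)"

definition D_d :: "'a manifold \<Rightarrow> 'a sop"
  where "D_d M = on_superfunctions M (\<lambda>u b j. ext_d M (u b j))"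

definition D_lie :: "'a manifold \<Rightarrow> 'a vfield \<Rightarrow> 'a sop"
  where "D_lie M X = on_superfunctions M (\<lambda>u b j. lie_deriv M X (u b j))"

definition D_iota :: "'a manifold \<Rightarrow> 'a vfield \<Rightarrow> 'a sop"
  where "D_iota M Y = on_superfunctions M (\<lambda>u b j. contract Y (u b j))"

definition D_q :: "'a manifold \<Rightarrow> 'a sop"
  where "D_q M = on_superfunctions M (\<lambda>u b j. if b then 0 else parity (u True j))"

definition D_t :: "'a manifold \<Rightarrow> 'a sop"
  where "D_t M = on_superfunctions M (\<lambda>u b j. real (Suc j) *\<^sub>R u b (Suc j))"

definition graded_commutator :: "int \<Rightarrow> int \<Rightarrow> 'a sop \<Rightarrow> 'a sop \<Rightarrow> 'a sop"
  where "graded_commutator k l D E = (\<lambda>u. D (E u) - ((-1) powi (k * l)) *\<^sub>R E (D u))"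


section \<open>Differential graded Lie algebras and the derived construction\<close>

record 'v dg_algebra =
  gr :: "int \<Rightarrow> 'v set"
  diff :: "int \<Rightarrow> 'v \<Rightarrow> 'v"
  brk :: "int \<Rightarrow> int \<Rightarrow> 'v \<Rightarrow> 'v \<Rightarrow> 'v"

text \<open>
  \<open>diff L k\<close> is the differential on the component of degree \<open>k\<close>, and \<open>brk L k l\<close> the bracket of
  elements of degrees \<open>k\<close> and \<open>l\<close>.
\<close>

definition linear_between :: "'v::real_vector set \<Rightarrow> 'w::real_vector set \<Rightarrow> ('v \<Rightarrow> 'w) \<Rightarrow> bool"
  where "linear_between V W f \<longleftrightarrow>
    (\<forall>x \<in> V. f x \<in> W) \<and> (\<forall>x \<in> V. \<forall>y \<in> V. \<forall>c. f (c *\<^sub>R x + y) = c *\<^sub>R f x + f y)"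

definition graded_complex_with_bracket :: "'v::real_vector dg_algebra \<Rightarrow> bool"
  where "graded_complex_with_bracket L \<longleftrightarrow>
    (\<forall>k. subspace (gr L k)) \<and>
    (\<forall>k. linear_between (gr L k) (gr L (k + 1)) (diff L k)) \<and>
    (\<forall>k. \<forall>x \<in> gr L k. diff L (k + 1) (diff L k x) = 0) \<and>
    (\<forall>k l. \<forall>x \<in> gr L k. linear_between (gr L l) (gr L (k + l)) (brk L k l x)) \<and>
    (\<forall>k l. \<forall>y \<in> gr L l. linear_between (gr L k) (gr L (k + l)) (\<lambda>x. brk L k l x y))"

definition graded_leibniz :: "'v::real_vector dg_algebra \<Rightarrow> bool"
  where "graded_leibniz L \<longleftrightarrow>
    (\<forall>k l m. \<forall>x \<in> gr L k. \<forall>y \<in> gr L l. \<forall>z \<in> gr L m.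
       brk L k (l + m) x (brk L l m y z)
         = brk L (k + l) m (brk L k l x y) z
           + ((-1) powi (k * l)) *\<^sub>R brk L l (k + m) y (brk L k m x z))"

definition diff_is_derivation :: "'v::real_vector dg_algebra \<Rightarrow> int \<Rightarrow> int \<Rightarrow> bool"
  where "diff_is_derivation L k l \<longleftrightarrow>
    (\<forall>x \<in> gr L k. \<forall>y \<in> gr L l.
       diff L (k + l) (brk L k l x y)
         = brk L (k + 1) l (diff L k x) y + ((-1) powi k) *\<^sub>R brk L k (l + 1) x (diff L l y))"

definition dg_lie_algebra :: "'v::real_vector dg_algebra \<Rightarrow> bool"
  where "dg_lie_algebra L \<longleftrightarrow>
    graded_complex_with_bracket L \<and>
    (\<forall>k l. \<forall>x \<in> gr L k. \<forall>y \<in> gr L l. brk L k l x y = - ((-1) powi (k * l)) *\<^sub>R brk L l k y x) \<and>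
    graded_leibniz L \<and>
    (\<forall>k l. diff_is_derivation L k l)"

text \<open>
  Since \<open>\<delta>\<close> is cut off to \<open>0\<close> on the top degree \<open>0\<close>, the derivation rule of \<open>\<delta>\<close> cannot hold
  for arguments of degrees \<open>k < 0\<close> and \<open>0\<close>, where the term containing \<open>\<delta>\<close> of the second
  argument has been cut off: for \<open>h \<partial>\<^sub>t\<close> and \<open>\<iota>\<^sub>Y\<close> the left-hand side is \<open>d (Y h) \<partial>\<^sub>t\<close> up to
  sign, the right-hand side \<open>0\<close>.  It is required in all other degrees.
\<close>

definition dg_leibniz_algebra :: "'v::real_vector dg_algebra \<Rightarrow> bool"
  where "dg_leibniz_algebra L \<longleftrightarrow>
    graded_complex_with_bracket L \<and> graded_leibniz L \<and>
    (\<forall>k l. \<not> (k < 0 \<and> l = 0) \<longrightarrow> diff_is_derivation L k l)"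

definition dg_isomorphism ::
  "'v::real_vector dg_algebra \<Rightarrow> 'w::real_vector dg_algebra \<Rightarrow> (int \<Rightarrow> 'v \<Rightarrow> 'w) \<Rightarrow> bool"
  where "dg_isomorphism L L' \<Phi> \<longleftrightarrow>
    (\<forall>k. linear_between (gr L k) (gr L' k) (\<Phi> k) \<and> bij_betw (\<Phi> k) (gr L k) (gr L' k)) \<and>
    (\<forall>k. \<forall>x \<in> gr L k. \<Phi> (k + 1) (diff L k x) = diff L' k (\<Phi> k x)) \<and>
    (\<forall>k l. \<forall>x \<in> gr L k. \<forall>y \<in> gr L l.
       \<Phi> (k + l) (brk L k l x y) = brk L' k l (\<Phi> k x) (\<Phi> l y))"

definition derived :: "'v::real_vector dg_algebra \<Rightarrow> 'v dg_algebra"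
  where "derived L =
    \<lparr> gr = (\<lambda>k. if k \<le> 0 then gr L (k - 1) else {0}),
      diff = (\<lambda>k x. if k < 0 then diff L (k - 1) x else 0),
      brk = (\<lambda>k l x y. ((-1) powi k) *\<^sub>R brk L k (l - 1) (diff L (k - 1) x) y) \<rparr>"

definition derived_map :: "(int \<Rightarrow> 'v \<Rightarrow> 'w) \<Rightarrow> int \<Rightarrow> 'v \<Rightarrow> 'w"
  where "derived_map \<Phi> = (\<lambda>k. \<Phi> (k - 1))"


section \<open>Symmetries of the T-dual dg-manifolds\<close>

text \<open>
  In the following, \<open>Fb\<close>, \<open>Ab\<close>, \<open>fb\<close> are the barred counterparts of \<open>F\<close>, \<open>A\<close>, \<open>f\<close>.  The objects
  for the T-dual side are obtained by exchanging the arguments \<open>F\<close> and \<open>Fb\<close>.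
\<close>

definition Q_P :: "'a manifold \<Rightarrow> 'a form \<Rightarrow> 'a form \<Rightarrow> 'a form \<Rightarrow> 'a sop"
  where "Q_P M F Fb H =
    D_d M + of_form F \<cdot> D_q M + (of_form H + q_var M \<odot> of_form Fb) \<cdot> D_t M"

definition symmetry_space ::
  "'a manifold \<Rightarrow> 'a form \<Rightarrow> 'a form \<Rightarrow> 'a form \<Rightarrow> int \<Rightarrow> 'a sop set"
  where "symmetry_space M F Fb H k =
    (if k = -2 then
       {of_form (of_fun h) \<cdot> D_t M | h. h \<in> smooth_functions M}
     else if k = -1 then
       {D_iota M Y + of_form (of_fun f) \<cdot> D_q M
          + (of_form C + q_var M \<odot> of_form (of_fun fb)) \<cdot> D_t M | Y f fb C.
          Y \<in> vfields M \<and> f \<in> smooth_functions M \<and> fb \<in> smooth_functions M \<and> C \<in> kforms M 1}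
     else if k = 0 then
       {D. (\<exists>X A Ab B. X \<in> vfields M \<and> A \<in> kforms M 1 \<and> Ab \<in> kforms M 1 \<and> B \<in> kforms M 2 \<and>
              D = D_lie M X + of_form A \<cdot> D_q M
                    + (of_form B + q_var M \<odot> of_form Ab) \<cdot> D_t M) \<and>
           graded_commutator 1 0 (Q_P M F Fb H) D = 0}
     else {0})"

definition symmetries :: "'a manifold \<Rightarrow> 'a form \<Rightarrow> 'a form \<Rightarrow> 'a form \<Rightarrow> 'a sop dg_algebra"
  where "symmetries M F Fb H =
    \<lparr> gr = symmetry_space M F Fb H,
      diff = (\<lambda>k D. if k < 0 then graded_commutator 1 k (Q_P M F Fb H) D else 0),
      brk = graded_commutator \<rparr>"

definition tduality_map ::
  "'a manifold \<Rightarrow> 'a form \<Rightarrow> 'a form \<Rightarrow> 'a form \<Rightarrow> (int \<Rightarrow> 'a sop \<Rightarrow> 'a sop) \<Rightarrow> bool"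
  where "tduality_map M F Fb H \<Phi> \<longleftrightarrow>
    (\<forall>X \<in> vfields M. \<forall>A \<in> kforms M 1. \<forall>Ab \<in> kforms M 1. \<forall>B \<in> kforms M 2.
       let D = D_lie M X + of_form A \<cdot> D_q M + (of_form B + q_var M \<odot> of_form Ab) \<cdot> D_t M in
         D \<in> gr (symmetries M F Fb H) 0 \<longrightarrow>
         \<Phi> 0 D = D_lie M X - of_form Ab \<cdot> D_q M + (of_form B - q_var M \<odot> of_form A) \<cdot> D_t M) \<and>
    (\<forall>Y \<in> vfields M. \<forall>f \<in> smooth_functions M. \<forall>fb \<in> smooth_functions M. \<forall>C \<in> kforms M 1.
       \<Phi> (-1) (D_iota M Y + of_form (of_fun f) \<cdot> D_q M
                 + (of_form C + q_var M \<odot> of_form (of_fun fb)) \<cdot> D_t M)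
         = D_iota M Y + of_form (of_fun fb) \<cdot> D_q M
             + (of_form C + q_var M \<odot> of_form (of_fun f)) \<cdot> D_t M) \<and>
    (\<forall>h \<in> smooth_functions M.
       \<Phi> (-2) (of_form (of_fun h) \<cdot> D_t M) = of_form (of_fun h) \<cdot> D_t M) \<and>
    (\<forall>k. k \<notin> {-2, -1, 0} \<longrightarrow> \<Phi> k 0 = 0)"

end

theory Submission
  imports Defs
begin

text \<open>
  The vector fields in question have the form \<open>T + a \<partial>\<^sub>q + (b + q c) \<partial>\<^sub>t\<close>, where \<open>T\<close> is \<open>d\<close>, a Lie
  derivative, a contraction or \<open>0\<close>, and the coefficients are determined by the vector field.  In
  degree \<open>k\<close>, T-duality is \<open>(T, a, b, c) \<mapsto> (T, (-1)^(k+1) c, b, (-1)^(k+1) a)\<close>.  For \<open>k = 1\<close> this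
  rule also sends \<open>Q\<close> to the dual \<open>Q\<close>.  The coefficients of a commutator are given by a formula that is
  uniform in the two degrees and, by graded commutativity of the wedge product, equivariant under
  this rule; applied to brackets of symmetries and to brackets with \<open>Q\<close>, this yields the isomorphism
  of differential graded Lie algebras.  The Lie algebra structure itself only needs \<open>Q\<^sup>2 = 0\<close> and the
  Cartan calculus, which is derived here from the defining formulas by contracting identities with
  vector fields.
\<close>

text \<open>The sign (-1)^(k+1) is forced by the coefficient b. For degrees k and l, the commutator
  has the cross terms a c' - (-1)^(k l) a' c. Under the rule, a c' becomes (-1)^(k+l) c a', and c a'
  = (-1)^((k+1)(l+1)) a' c, so the result is -(-1)^(k l) a' c: the two cross terms trade places. The
  rule squares to the identity, so the inverse is the same rule on the dual side. The map is
  prescribed on expressions, whereas symmetries are operators. Duality is therefore treated as a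
  relation between operators. Single-valuedness gives well-definedness, symmetry gives bijectivity,
  and stability under commutators gives compatibility with bracket and differential. In the Cartan
  calculus the obstacle is that the formula for d contains Lie brackets, which are not linear over
  functions, so that it is not evident that d of a form is a form. Cartan's formula turns the
  definition into a recursion on the first argument; linearity over functions, the Leibniz rule and
  d d = 0 all follow from this recursion, without coordinates.\<close>

lemma scaleR_fun_apply: "(c *\<^sub>R f) x = c *\<^sub>R f x"
  by (simp add: scaleR_fun_def)

lemma sum_fun_apply: "(\<Sum>i\<in>A. f i) x = (\<Sum>i\<in>A. f i x)"
  by (induction A rule: infinite_finite_induct) auto

section \<open>Smooth functions\<close>

lemma Ck_on_Suc_imp: "Ck_on n (Suc k) W f \<Longrightarrow> Ck_on n k W f"
proof (induction k arbitrary: f)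
  case (Suc k)
  from Suc.prems show ?case
    by (subst Ck_on.simps, subst (asm) Ck_on.simps) (use Suc.IH in blast)
qed simp

lemma Ck_on_lincomb:
  "Ck_on n k W f \<Longrightarrow> Ck_on n k W g \<Longrightarrow> Ck_on n k W (\<lambda>x. c * f x + g x)"
proof (induction k arbitrary: f g)
  case 0
  then show ?case by (simp add: continuous_map_add continuous_map_real_mult_left)
next
  case (Suc k)
  have "\<exists>h. Ck_on n k W h \<and>
      (\<forall>x\<in>W. ((\<lambda>s. c * f (x(i := s)) + g (x(i := s))) has_real_derivative h x) (at (x i)))"
    if "i < n" for i
  proof -
    from Suc.prems(1) that obtain f' where
      "Ck_on n k W f'" "\<forall>x\<in>W. ((\<lambda>s. f (x(i := s))) has_real_derivative f' x) (at (x i))"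
      by auto
    moreover from Suc.prems(2) that obtain g' where
      "Ck_on n k W g'" "\<forall>x\<in>W. ((\<lambda>s. g (x(i := s))) has_real_derivative g' x) (at (x i))"
      by auto
    ultimately show ?thesis
      by (intro exI[of _ "\<lambda>x. c * f' x + g' x"] conjI Suc.IH)
         (auto intro!: derivative_eq_intros)
  qed
  with Suc.prems show ?case by (simp add: continuous_map_add continuous_map_real_mult_left)
qed

text \<open>The derivative f' g + g' f contains f and g themselves, which enter the induction
  hypothesis only after their order has been lowered by \<open>Ck_on_Suc_imp\<close>.\<close>

lemma Ck_on_mult:
  "Ck_on n k W f \<Longrightarrow> Ck_on n k W g \<Longrightarrow> Ck_on n k W (\<lambda>x. f x * g x)"
proof (induction k arbitrary: f g)
  case 0
  then show ?case by (simp add: continuous_map_real_mult)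
next
  case (Suc k)
  have "\<exists>h. Ck_on n k W h \<and>
      (\<forall>x\<in>W. ((\<lambda>s. f (x(i := s)) * g (x(i := s))) has_real_derivative h x) (at (x i)))"
    if "i < n" for i
  proof -
    from Suc.prems(1) that obtain f' where
      f': "Ck_on n k W f'" "\<forall>x\<in>W. ((\<lambda>s. f (x(i := s))) has_real_derivative f' x) (at (x i))"
      by auto
    from Suc.prems(2) that obtain g' where
      g': "Ck_on n k W g'" "\<forall>x\<in>W. ((\<lambda>s. g (x(i := s))) has_real_derivative g' x) (at (x i))"
      by auto
    have "Ck_on n k W (\<lambda>x. 1 * (f' x * g x) + g' x * f x)"
      by (intro Ck_on_lincomb Suc.IH f'(1) g'(1) Suc.prems[THEN Ck_on_Suc_imp])
    with f' g' show ?thesis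
      by (intro exI[of _ "\<lambda>x. f' x * g x + g' x * f x"] conjI)
         (auto intro!: derivative_eq_intros)
  qed
  with Suc.prems show ?case by (simp add: continuous_map_real_mult)
qed

text \<open>Coordinate lines stay in \<open>Euclidean_space n\<close> because i < n and the
  coordinates of x from n on vanish. So moving the i-th coordinate is a continuous map into that
  space, and the preimage of W is open.\<close>

lemma eventually_fun_upd_in_openin:
  assumes W: "openin (Euclidean_space n) W" and x: "x \<in> W" and i: "i < n"
  shows "eventually (\<lambda>s. x(i := s) \<in> W) (nhds (x i))"
proof -
  from x W have "x \<in> topspace (Euclidean_space n)"
    using openin_subset by blast
  then have x0: "\<forall>j\<ge>n. x j = 0"
    by (simp add: topspace_Euclidean_space)
  have "continuous_map euclideanreal (Euclidean_space n)
      (\<lambda>s j. if j < n then (x(i := s)) j else 0)"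
    by (subst continuous_map_componentwise_Euclidean_space) auto
  also have "(\<lambda>s j. if j < n then (x(i := s)) j else 0) = (\<lambda>s. x(i := s))"
    using x0 i by (auto simp: fun_eq_iff)
  finally have "openin euclideanreal {s \<in> topspace euclideanreal. x(i := s) \<in> W}"
    using W by (rule openin_continuous_map_preimage)
  then have "open {s. x(i := s) \<in> W}"
    by simp
  with x show ?thesis
    using eventually_nhds_in_open[of "{s. x(i := s) \<in> W}" "x i"] by simp
qed

text \<open>Functions are read in a chart through \<open>inv_into\<close>, whose values off the
  image of the chart are arbitrary. So constancy is only asked for on W, and openness of W makes the
  partial derivatives vanish.\<close>

lemma Ck_on_const:
  assumes W: "openin (Euclidean_space n) W"
  shows "(\<And>x. x \<in> W \<Longrightarrow> f x = c) \<Longrightarrow> Ck_on n k W f"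
proof (induction k arbitrary: f c)
  have cont: "continuous_map (subtopology (Euclidean_space n) W) euclideanreal f"
    if "\<And>x. x \<in> W \<Longrightarrow> f x = c" for f and c :: real
    by (rule continuous_map_eq[of _ _ "\<lambda>_. c"]) (use that in auto)
  case 0
  with cont show ?case by simp
  case (Suc k)
  have "((\<lambda>s. f (x(i := s))) has_real_derivative 0) (at (x i))" if "x \<in> W" "i < n" for x i
  proof -
    have "eventually (\<lambda>s. f (x(i := s)) = c) (nhds (x i))"
      using eventually_fun_upd_in_openin[OF W that] by eventually_elim (rule Suc.prems)
    then show ?thesis
      by (subst DERIV_cong_ev[of _ _ _ "\<lambda>_. c"]) auto
  qed
  moreover have "Ck_on n k W (\<lambda>_. 0)"
    by (rule Suc.IH[of _ 0]) simp
  ultimately show ?case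
    using cont[of f c] Suc.prems by auto
qed

text \<open>This is the unit of the algebra: smooth functions vanish off M by convention, so the
  indicator of M takes the place of the constant 1.\<close>

lemma indicat_points_smooth:
  assumes M: "smooth_manifold M"
  shows "indicat_real (points M) \<in> smooth_functions M"
proof -
  have "smooth_on (mdim M) (\<phi> ` U) (\<lambda>x. indicat_real (points M) (inv_into U \<phi> x))"
    if "(U, \<phi>) \<in> atlas M" for U \<phi>
  proof -
    from M that have chart: "openin (mtop M) U" "openin (Euclidean_space (mdim M)) (\<phi> ` U)"
      by (auto simp: smooth_manifold_def is_chart_def)
    have "inv_into U \<phi> x \<in> points M" if "x \<in> \<phi> ` U" for x
      using inv_into_into[OF that] openin_subset[OF chart(1)] by blast
    then show ?thesis
      unfolding smooth_on_def using chart(2)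
      by (auto intro!: Ck_on_const[where c = 1])
  qed
  then show ?thesis
    by (auto simp: smooth_functions_def)
qed

lemma smooth_functions_combine:
  assumes "f \<in> smooth_functions M" "g \<in> smooth_functions M"
    and "\<And>p. f p = 0 \<Longrightarrow> g p = 0 \<Longrightarrow> h p = 0"
    and "\<And>U \<phi>. smooth_on (mdim M) (\<phi> ` U) (\<lambda>x. f (inv_into U \<phi> x)) \<Longrightarrow>
      smooth_on (mdim M) (\<phi> ` U) (\<lambda>x. g (inv_into U \<phi> x)) \<Longrightarrow>
      smooth_on (mdim M) (\<phi> ` U) (\<lambda>x. h (inv_into U \<phi> x))"
  shows "h \<in> smooth_functions M"
  using assms unfolding smooth_functions_def by blast

lemma smooth_functions_lincomb:
  assumes "f \<in> smooth_functions M" "g \<in> smooth_functions M"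
  shows "c *\<^sub>R f + g \<in> smooth_functions M"
  by (rule smooth_functions_combine[OF assms])
     (simp_all add: scaleR_fun_apply smooth_on_def Ck_on_lincomb)

lemma smooth_functions_mult:
  assumes "f \<in> smooth_functions M" "g \<in> smooth_functions M"
  shows "f * g \<in> smooth_functions M"
  by (rule smooth_functions_combine[OF assms]) (simp_all add: smooth_on_def Ck_on_mult)

lemma mult_indicat_points:
  assumes "f \<in> smooth_functions M"
  shows "indicat_real (points M) * f = f"
  using assms by (auto simp: smooth_functions_def fun_eq_iff indicator_def)

lemmas fun_apply = plus_fun_apply zero_fun_apply minus_apply uminus_apply times_fun_apply
  one_fun_apply scaleR_fun_apply sum_fun_apply
text \<open>The simplifier applies these rules to unapplied functions as well, which destroys the terms of
  the algebra of forms.\<close>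

declare plus_fun_apply [simp del] zero_fun_apply [simp del] minus_apply [simp del]
  uminus_apply [simp del] times_fun_apply [simp del] one_fun_apply [simp del]

section \<open>The wedge product\<close>

lemma contract_apply: "contract Y \<omega> xs = \<omega> (Y # xs)"
  by (simp add: contract_def)

lemma parity_apply: "parity \<omega> xs = (-1) ^ length xs *\<^sub>R \<omega> xs"
  by (simp add: parity_def)

lemma contract_linear [simp]:
  "contract Y 0 = 0" "contract Y (\<alpha> + \<beta>) = contract Y \<alpha> + contract Y \<beta>"
  "contract Y (\<alpha> - \<beta>) = contract Y \<alpha> - contract Y \<beta>" "contract Y (- \<alpha>) = - contract Y \<alpha>"
  "contract Y (c *\<^sub>R \<alpha>) = c *\<^sub>R contract Y \<alpha>"
  by (simp_all add: fun_eq_iff fun_apply contract_apply parity_apply)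

lemma parity_linear [simp]:
  "parity 0 = 0" "parity (\<alpha> + \<beta>) = parity \<alpha> + parity \<beta>"
  "parity (\<alpha> - \<beta>) = parity \<alpha> - parity \<beta>" "parity (- \<alpha>) = - parity \<alpha>"
  "parity (c *\<^sub>R \<alpha>) = c *\<^sub>R parity \<alpha>"
  by (simp_all add: fun_eq_iff fun_apply contract_apply parity_apply algebra_simps)

lemma parity_sum: "parity (\<Sum>i\<in>I. f i) = (\<Sum>i\<in>I. parity (f i))"
  by (induction I rule: infinite_finite_induct) auto

lemma parity_parity [simp]: "parity (parity \<omega>) = \<omega>"
  by (simp add: fun_eq_iff fun_apply contract_apply parity_apply flip: power_add mult_2)

lemma contract_parity [simp]: "contract Y (parity \<omega>) = - parity (contract Y \<omega>)"
  by (simp add: fun_eq_iff fun_apply contract_apply parity_apply)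

lemma parity_Nil: "parity \<omega> [] = \<omega> []"
  by (simp add: parity_apply)

lemma parity_Cons: "parity \<omega> (Y # xs) = - parity (contract Y \<omega>) xs"
  by (simp add: parity_apply contract_apply)

lemma parity_of_fun [simp]: "parity (of_fun f) = of_fun f"
  by (auto simp: fun_eq_iff fun_apply contract_apply parity_apply of_fun_def)

lemma contract_of_fun [simp]: "contract Y (of_fun f) = 0"
  by (auto simp: fun_eq_iff fun_apply contract_apply parity_apply of_fun_def)

text \<open>An argument list is empty or begins with a vector field, which can be contracted away.
  This recursion is the source of all later inductions on forms.\<close>

lemma form_eqI:
  assumes "\<alpha> [] = \<beta> []" "\<And>Y. contract Y \<alpha> = contract Y \<beta>"
  shows "\<alpha> = (\<beta> :: 'a form)"
proof
  fix xs show "\<alpha> xs = \<beta> xs"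
    using assms by (cases xs) (auto simp: fun_eq_iff fun_apply contract_apply parity_apply)
qed

lemma wedge_Nil [simp]: "(\<alpha> \<^bold>\<and> \<beta>) [] = \<alpha> [] * \<beta> []"
  by (simp add: wedge_def)

text \<open>If the first argument goes to the right factor, every position in I has to jump over
  position 0. These card I extra inversions become the \<open>parity\<close> in the rule for
  contracting a product.\<close>

lemma card_inversions_Suc_image:
  fixes I :: "nat set"
  assumes "finite I"
  shows "card {(i, j). i \<in> Suc ` I \<and> j \<in> {..<Suc n} - Suc ` I \<and> j < i}
    = card I + card {(i, j). i \<in> I \<and> j \<in> {..<n} - I \<and> j < i}"
proof -
  let ?S = "{(i, j). i \<in> I \<and> j \<in> {..<n} - I \<and> j < i}"
  have fin: "finite ?S"
    by (rule finite_subset[of _ "I \<times> {..<n}"]) (use assms in auto)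
  have "{(i, j). i \<in> Suc ` I \<and> j \<in> {..<Suc n} - Suc ` I \<and> j < i}
      = (\<lambda>i. (Suc i, 0)) ` I \<union> map_prod Suc Suc ` ?S"
  proof (intro equalityI subsetI)
    fix p assume "p \<in> {(i, j). i \<in> Suc ` I \<and> j \<in> {..<Suc n} - Suc ` I \<and> j < i}"
    then obtain i j where p: "p = (Suc i, j)" "i \<in> I" "j < Suc n" "j \<notin> Suc ` I" "j < Suc i"
      by auto
    then show "p \<in> (\<lambda>i. (Suc i, 0)) ` I \<union> map_prod Suc Suc ` ?S"
      by (cases j) (auto intro!: image_eqI[where x = "(i, j - 1)"])
  qed auto
  moreover have "card ((\<lambda>i. (Suc i, 0::nat)) ` I) = card I" "card (map_prod Suc Suc ` ?S) = card ?S"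
    by (auto intro!: card_image inj_onI)
  moreover have "(\<lambda>i. (Suc i, 0)) ` I \<inter> map_prod Suc Suc ` ?S = {}"
    by auto
  ultimately show ?thesis
    using fin assms by (simp add: card_Un_disjoint)
qed

text \<open>Position 0 in the left factor precedes all positions of the right factor and takes part
  in no inversion.\<close>

lemma card_inversions_insert_0:
  "card {(i, j). i \<in> insert 0 (Suc ` I) \<and> j \<in> {..<Suc n} - insert 0 (Suc ` I) \<and> j < i}
    = card {(i, j). i \<in> I \<and> j \<in> {..<n} - I \<and> j < i}"
proof -
  have "{(i, j). i \<in> insert 0 (Suc ` I) \<and> j \<in> {..<Suc n} - insert 0 (Suc ` I) \<and> j < i}
      = map_prod Suc Suc ` {(i, j). i \<in> I \<and> j \<in> {..<n} - I \<and> j < i}"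
  proof (intro equalityI subsetI)
    fix p assume "p \<in> {(i, j). i \<in> insert 0 (Suc ` I) \<and> j \<in> {..<Suc n} - insert 0 (Suc ` I) \<and> j < i}"
    then obtain i j where "p = (Suc i, Suc j)" "i \<in> I" "j < n" "j \<notin> I" "j < i"
      by (cases p; cases "snd p") auto
    then show "p \<in> map_prod Suc Suc ` {(i, j). i \<in> I \<and> j \<in> {..<n} - I \<and> j < i}"
      by (auto intro!: image_eqI[where x = "(i, j)"])
  qed auto
  then show ?thesis
    by (auto intro!: card_image inj_onI)
qed

text \<open>Split the shuffles according to whether the first argument goes to the left or the right factor.\<close>

lemma contract_wedge:
  "contract Y (\<alpha> \<^bold>\<and> \<beta>) = contract Y \<alpha> \<^bold>\<and> \<beta> + parity \<alpha> \<^bold>\<and> contract Y \<beta>"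
proof
  fix xs :: "'a vfield list"
  let ?n = "length xs"
  let ?t = "\<lambda>\<alpha> \<beta> ys I. (-1) ^ card {(i, j). i \<in> I \<and> j \<in> {..<length ys} - I \<and> j < i} *\<^sub>R
      (\<alpha> (nths ys I) * \<beta> (nths ys (- I)))"
  have Pow: "Pow {..<Suc ?n} = (`) Suc ` Pow {..<?n} \<union> (\<lambda>I. insert 0 (Suc ` I)) ` Pow {..<?n}"
    
    by (simp only: lessThan_Suc_eq_insert_0 Pow_insert image_Pow_surj[OF refl, of Suc "{..<?n}", symmetric] image_image)
  have inj: "inj_on ((`) Suc) A" for A
    by (auto simp: inj_on_def inj_image_eq_iff)
  have inj': "inj_on (\<lambda>I. insert 0 (Suc ` I)) A" for A
  proof (rule inj_onI)
    fix I J assume "insert 0 (Suc ` I) = insert 0 (Suc ` J)"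
    then have "insert 0 (Suc ` I) - {0} = insert 0 (Suc ` J) - {0}" by simp
    then show "I = J" by (simp add: insert_Diff_if inj_image_eq_iff)
  qed
  have "contract Y (\<alpha> \<^bold>\<and> \<beta>) xs = (\<Sum>I\<in>Pow {..<Suc ?n}. ?t \<alpha> \<beta> (Y # xs) I)"
    by (simp add: wedge_def contract_apply)
  also have "\<dots> = (\<Sum>I\<in>Pow {..<?n}. ?t \<alpha> \<beta> (Y # xs) (insert 0 (Suc ` I)))
      + (\<Sum>I\<in>Pow {..<?n}. ?t \<alpha> \<beta> (Y # xs) (Suc ` I))"
    unfolding Pow
    by (subst sum.union_disjoint) (auto simp: sum.reindex[OF inj] sum.reindex[OF inj'] add.commute)
  also have "(\<Sum>I\<in>Pow {..<?n}. ?t \<alpha> \<beta> (Y # xs) (insert 0 (Suc ` I))) = (contract Y \<alpha> \<^bold>\<and> \<beta>) xs"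
    unfolding wedge_def
  proof (intro sum.cong refl)
    fix I assume "I \<in> Pow {..<?n}"
    have "{j. Suc j \<in> insert 0 (Suc ` I)} = I" "{j. Suc j \<in> - insert 0 (Suc ` I)} = - I"
      by auto
    then show "?t \<alpha> \<beta> (Y # xs) (insert 0 (Suc ` I)) = ?t (contract Y \<alpha>) \<beta> xs I"
      by (simp only: nths_Cons list.size card_inversions_insert_0 add_Suc_right add_0_right contract_apply) simp
  qed
  also have "(\<Sum>I\<in>Pow {..<?n}. ?t \<alpha> \<beta> (Y # xs) (Suc ` I)) = (parity \<alpha> \<^bold>\<and> contract Y \<beta>) xs"
    unfolding wedge_def
  proof (intro sum.cong refl)
    fix I assume I: "I \<in> Pow {..<?n}"
    then have "finite I" by (auto intro: finite_subset)
    \<comment> \<open>The number of extra inversions is the number of arguments handed to \<alpha>,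
      so their sign is absorbed by \<open>parity \<alpha>\<close>.\<close>
    have "{i. i < ?n \<and> i \<in> I} = I" using I by auto
    then have len: "length (nths xs I) = card I"
      by (simp add: length_nths)
    have "{j. Suc j \<in> Suc ` I} = I" "{j. Suc j \<in> - (Suc ` I)} = - I"
      by auto
    then show "?t \<alpha> \<beta> (Y # xs) (Suc ` I) = ?t (parity \<alpha>) (contract Y \<beta>) xs I"
      using card_inversions_Suc_image[OF \<open>finite I\<close>, of ?n]
      by (simp add: nths_Cons len power_add fun_eq_iff fun_apply contract_apply parity_apply)
  qed
  finally show "contract Y (\<alpha> \<^bold>\<and> \<beta>) xs = (contract Y \<alpha> \<^bold>\<and> \<beta> + parity \<alpha> \<^bold>\<and> contract Y \<beta>) xs"
    by (simp add: fun_eq_iff fun_apply)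
qed

lemma wedge_Cons: "(\<alpha> \<^bold>\<and> \<beta>) (Y # xs) = (contract Y \<alpha> \<^bold>\<and> \<beta>) xs + (parity \<alpha> \<^bold>\<and> contract Y \<beta>) xs"
  using contract_wedge[of Y \<alpha> \<beta>] by (simp add: fun_eq_iff fun_apply contract_apply parity_apply flip: contract_apply)

lemma wedge_add_left: "(\<alpha> + \<beta>) \<^bold>\<and> \<gamma> = \<alpha> \<^bold>\<and> \<gamma> + \<beta> \<^bold>\<and> \<gamma>"
  by (auto simp: wedge_def fun_eq_iff fun_apply algebra_simps sum.distrib)

lemma wedge_add_right: "\<gamma> \<^bold>\<and> (\<alpha> + \<beta>) = \<gamma> \<^bold>\<and> \<alpha> + \<gamma> \<^bold>\<and> \<beta>"
  by (auto simp: wedge_def fun_eq_iff fun_apply algebra_simps sum.distrib)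

lemma wedge_scaleR_left: "(c *\<^sub>R \<alpha>) \<^bold>\<and> \<beta> = c *\<^sub>R (\<alpha> \<^bold>\<and> \<beta>)"
  by (auto simp: wedge_def fun_eq_iff fun_apply algebra_simps sum_distrib_left)

lemma wedge_scaleR_right: "\<alpha> \<^bold>\<and> (c *\<^sub>R \<beta>) = c *\<^sub>R (\<alpha> \<^bold>\<and> \<beta>)"
  by (auto simp: wedge_def fun_eq_iff fun_apply algebra_simps sum_distrib_left)

lemma wedge_0_left [simp]: "0 \<^bold>\<and> \<beta> = 0"
  using wedge_scaleR_left[of 0 0 \<beta>] by simp

lemma wedge_0_right [simp]: "\<alpha> \<^bold>\<and> 0 = 0"
  using wedge_scaleR_right[of \<alpha> 0 0] by simp

lemma wedge_minus_left [simp]: "(- \<alpha>) \<^bold>\<and> \<beta> = - (\<alpha> \<^bold>\<and> \<beta>)"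
  using wedge_scaleR_left[of "-1" \<alpha> \<beta>] by simp

lemma wedge_minus_right [simp]: "\<alpha> \<^bold>\<and> (- \<beta>) = - (\<alpha> \<^bold>\<and> \<beta>)"
  using wedge_scaleR_right[of \<alpha> "-1" \<beta>] by simp

lemma wedge_diff_left: "(\<alpha> - \<beta>) \<^bold>\<and> \<gamma> = \<alpha> \<^bold>\<and> \<gamma> - \<beta> \<^bold>\<and> \<gamma>"
  using wedge_add_left[of \<alpha> "- \<beta>" \<gamma>] by simp

lemma wedge_diff_right: "\<gamma> \<^bold>\<and> (\<alpha> - \<beta>) = \<gamma> \<^bold>\<and> \<alpha> - \<gamma> \<^bold>\<and> \<beta>"
  using wedge_add_right[of \<gamma> \<alpha> "- \<beta>"] by simp

lemma wedge_sum_right: "\<beta> \<^bold>\<and> (\<Sum>i\<in>I. f i) = (\<Sum>i\<in>I. \<beta> \<^bold>\<and> f i)"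
  by (induction I rule: infinite_finite_induct) (auto simp: wedge_add_right)

lemmas wedge_linear = wedge_add_left wedge_add_right wedge_scaleR_left wedge_scaleR_right
  wedge_diff_left wedge_diff_right

lemma parity_wedge: "parity (\<alpha> \<^bold>\<and> \<beta>) = parity \<alpha> \<^bold>\<and> parity \<beta>"
proof
  fix xs show "parity (\<alpha> \<^bold>\<and> \<beta>) xs = (parity \<alpha> \<^bold>\<and> parity \<beta>) xs"
  proof (induction xs arbitrary: \<alpha> \<beta>)
    case (Cons Y xs)
    from Cons[of "contract Y \<alpha>" \<beta>] Cons[of "parity \<alpha>" "contract Y \<beta>"] show ?case
      by (simp add: wedge_Cons parity_Cons contract_wedge fun_apply)
  qed (simp add: parity_Nil)
qed

text \<open>No combinatorics of triple shuffles is involved: both sides obey the same graded Leibniz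
  rule for contraction and agree on the empty list.\<close>

lemma wedge_assoc: "(\<alpha> \<^bold>\<and> \<beta>) \<^bold>\<and> \<gamma> = \<alpha> \<^bold>\<and> (\<beta> \<^bold>\<and> \<gamma>)"
proof
  fix xs show "((\<alpha> \<^bold>\<and> \<beta>) \<^bold>\<and> \<gamma>) xs = (\<alpha> \<^bold>\<and> (\<beta> \<^bold>\<and> \<gamma>)) xs"
  proof (induction xs arbitrary: \<alpha> \<beta> \<gamma>)
    case (Cons Y xs)
    then show ?case
      by (simp add: wedge_Cons contract_wedge wedge_linear parity_wedge fun_apply add.assoc)
  qed (simp add: mult.assoc)
qed

text \<open>Contraction changes the parity of \<alpha>, so the even and the odd case feed each other
  and are proved in one induction. Only \<alpha> has to be of definite parity; \<beta> may be
  inhomogeneous.\<close>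

lemma wedge_commute_aux:
  "(parity \<alpha> = \<alpha> \<longrightarrow> (\<alpha> \<^bold>\<and> \<beta>) xs = (\<beta> \<^bold>\<and> \<alpha>) xs) \<and>
   (parity \<alpha> = - \<alpha> \<longrightarrow> (\<alpha> \<^bold>\<and> \<beta>) xs = (parity \<beta> \<^bold>\<and> \<alpha>) xs)"
proof (induction xs arbitrary: \<alpha> \<beta>)
  case (Cons Y xs)
  have *: "parity (contract Y \<alpha>) = - contract Y (parity \<alpha>)"
    by simp
  show ?case
  proof (intro conjI impI)
    assume p: "parity \<alpha> = \<alpha>"
    then have "parity (contract Y \<alpha>) = - contract Y \<alpha>"
      using * by simp
    then have 1: "(contract Y \<alpha> \<^bold>\<and> \<beta>) xs = (parity \<beta> \<^bold>\<and> contract Y \<alpha>) xs"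
      using Cons.IH by blast
    have 2: "(\<alpha> \<^bold>\<and> contract Y \<beta>) xs = (contract Y \<beta> \<^bold>\<and> \<alpha>) xs"
      using Cons.IH p by blast
    show "(\<alpha> \<^bold>\<and> \<beta>) (Y # xs) = (\<beta> \<^bold>\<and> \<alpha>) (Y # xs)"
      by (simp only: wedge_Cons p 1 2 add.commute)
  next
    assume p: "parity \<alpha> = - \<alpha>"
    then have "parity (contract Y \<alpha>) = contract Y \<alpha>"
      using * by simp
    then have 1: "(contract Y \<alpha> \<^bold>\<and> \<beta>) xs = (\<beta> \<^bold>\<and> contract Y \<alpha>) xs"
      using Cons.IH by blast
    have 2: "(\<alpha> \<^bold>\<and> contract Y \<beta>) xs = (parity (contract Y \<beta>) \<^bold>\<and> \<alpha>) xs"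
      using Cons.IH p by blast
    show "(\<alpha> \<^bold>\<and> \<beta>) (Y # xs) = (parity \<beta> \<^bold>\<and> \<alpha>) (Y # xs)"
      by (simp only: wedge_Cons p 1 2 contract_parity parity_parity wedge_minus_left uminus_apply add.commute)
  qed
qed (simp_all add: mult.commute parity_Nil)

lemma wedge_commute_even: "parity \<alpha> = \<alpha> \<Longrightarrow> \<alpha> \<^bold>\<and> \<beta> = \<beta> \<^bold>\<and> \<alpha>"
  and wedge_commute_odd: "parity \<alpha> = - \<alpha> \<Longrightarrow> \<alpha> \<^bold>\<and> \<beta> = parity \<beta> \<^bold>\<and> \<alpha>"
  using wedge_commute_aux by (blast intro: ext)+

lemma of_fun_wedge: "of_fun f \<^bold>\<and> \<alpha> = (\<lambda>xs. f * \<alpha> xs)"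
proof
  fix xs show "(of_fun f \<^bold>\<and> \<alpha>) xs = f * \<alpha> xs"
  proof (induction xs arbitrary: \<alpha>)
    case (Cons Y xs)
    then show ?case by (simp add: wedge_Cons contract_apply zero_fun_apply)
  qed (simp add: of_fun_def)
qed

section \<open>Vector fields and alternating forms\<close>

locale smooth_mfd =
  fixes M :: "'a manifold"
  assumes smooth_manifold: "smooth_manifold M"
begin

abbreviation C where "C \<equiv> smooth_functions M"
abbreviation V where "V \<equiv> vfields M"
abbreviation one_M where "one_M \<equiv> indicat_real (points M)"

lemma one_C [simp]: "one_M \<in> C"
  using smooth_manifold by (rule indicat_points_smooth)

lemma C_mult [simp]: "f \<in> C \<Longrightarrow> g \<in> C \<Longrightarrow> f * g \<in> C"
  by (rule smooth_functions_mult)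

lemma C_0 [simp]: "0 \<in> C"
  using smooth_functions_lincomb[of one_M M one_M "-1"] by simp

lemma C_scaleR [simp]: "f \<in> C \<Longrightarrow> c *\<^sub>R f \<in> C"
  using smooth_functions_lincomb[of f M 0 c] by simp

lemma C_add [simp]: "f \<in> C \<Longrightarrow> g \<in> C \<Longrightarrow> f + g \<in> C"
  using smooth_functions_lincomb[of f M g 1] by simp

lemma C_minus [simp]: "f \<in> C \<Longrightarrow> - f \<in> C"
  using C_scaleR[of f "-1"] by simp

lemma C_diff [simp]: "f \<in> C \<Longrightarrow> g \<in> C \<Longrightarrow> f - g \<in> C"
  using C_add[of f "- g"] by simp

lemma one_mult [simp]: "f \<in> C \<Longrightarrow> one_M * f = f"
  by (rule mult_indicat_points)

lemma VI:
  assumes "\<And>f. f \<in> C \<Longrightarrow> X f \<in> C" "\<And>f. f \<notin> C \<Longrightarrow> X f = 0"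
    "\<And>f g c. f \<in> C \<Longrightarrow> g \<in> C \<Longrightarrow> X (c *\<^sub>R f + g) = c *\<^sub>R X f + X g"
    "\<And>f g. f \<in> C \<Longrightarrow> g \<in> C \<Longrightarrow> X (f * g) = X f * g + f * X g"
  shows "X \<in> V"
  using assms by (auto simp: vfields_def)

lemma
  assumes "X \<in> V"
  shows V_C: "X f \<in> C"
    and V_outside: "f \<notin> C \<Longrightarrow> X f = 0"
    and V_lincomb: "f \<in> C \<Longrightarrow> g \<in> C \<Longrightarrow> X (c *\<^sub>R f + g) = c *\<^sub>R X f + X g"
    and V_mult: "f \<in> C \<Longrightarrow> g \<in> C \<Longrightarrow> X (f * g) = X f * g + f * X g"
proof -
  note X = assms[unfolded vfields_def mem_Collect_eq]
  show out: "f \<notin> C \<Longrightarrow> X f = 0" using X by blast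
  show "f \<in> C \<Longrightarrow> g \<in> C \<Longrightarrow> X (c *\<^sub>R f + g) = c *\<^sub>R X f + X g" using X by blast
  show "f \<in> C \<Longrightarrow> g \<in> C \<Longrightarrow> X (f * g) = X f * g + f * X g" using X by blast
  show "X f \<in> C" using X out by (cases "f \<in> C") (blast, simp)
qed

lemma
  assumes X: "X \<in> V"
  shows V_0: "X 0 = 0"
    and V_scaleR: "f \<in> C \<Longrightarrow> X (c *\<^sub>R f) = c *\<^sub>R X f"
    and V_add: "f \<in> C \<Longrightarrow> g \<in> C \<Longrightarrow> X (f + g) = X f + X g"
    and V_minus: "f \<in> C \<Longrightarrow> X (- f) = - X f"
    and V_diff: "f \<in> C \<Longrightarrow> g \<in> C \<Longrightarrow> X (f - g) = X f - X g"
proof -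
  show 0: "X 0 = 0"
    \<comment> \<open>With coefficient -1 the rule reads X 0 = - X 0 + X 0, which is 0. The same
      instance yields the value at 0 of the other linear operators below.\<close>
    using V_lincomb[OF X, of 0 0 "-1"] by simp
  show scale: "X (c *\<^sub>R f) = c *\<^sub>R X f" if "f \<in> C" for f c
    using V_lincomb[OF X, of f 0 c] that 0 by simp
  show add: "X (f + g) = X f + X g" if "f \<in> C" "g \<in> C" for f g
    using V_lincomb[OF X, of f g 1] that by simp
  show minus: "X (- f) = - X f" if "f \<in> C" for f
    using scale[of f "-1"] that by simp
  show "X (f - g) = X f - X g" if "f \<in> C" "g \<in> C" for f g
    using add[of f "- g"] that by (simp add: minus)
qed

lemma zero_V [simp]: "0 \<in> V"
  by (rule VI) (simp_all add: zero_fun_apply)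

lemma add_V [simp]:
  assumes X: "X \<in> V" and Y: "Y \<in> V"
  shows "X + Y \<in> V"
proof -
  have eq: "X + Y = (\<lambda>f. X f + Y f)"
    by (rule plus_fun_def)
  show ?thesis
    unfolding eq
  proof (rule VI)
    show "X f + Y f \<in> C" if "f \<in> C" for f
      by (intro C_add V_C X Y)
    show "X f + Y f = 0" if "f \<notin> C" for f
      by (simp only: V_outside[OF X that] V_outside[OF Y that] add_0)
    fix f g :: "'a \<Rightarrow> real" and c :: real
    assume fg: "f \<in> C" "g \<in> C"
    show "X (c *\<^sub>R f + g) + Y (c *\<^sub>R f + g) = c *\<^sub>R (X f + Y f) + (X g + Y g)"
      unfolding V_lincomb[OF X fg] V_lincomb[OF Y fg] by (simp add: algebra_simps)
    show "X (f * g) + Y (f * g) = (X f + Y f) * g + f * (X g + Y g)"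
      unfolding V_mult[OF X fg] V_mult[OF Y fg] by (simp add: algebra_simps)
  qed
qed

lemma vf_scale_V [simp]:
  assumes h: "h \<in> C" and X: "X \<in> V"
  shows "vf_scale h X \<in> V"
proof (rule VI)
  show "vf_scale h X f \<in> C" if "f \<in> C" for f
    unfolding vf_scale_def by (intro C_mult V_C X h)
  show "vf_scale h X f = 0" if "f \<notin> C" for f
    unfolding vf_scale_def V_outside[OF X that] by simp
  fix f g :: "'a \<Rightarrow> real" and c :: real
  assume fg: "f \<in> C" "g \<in> C"
  show "vf_scale h X (c *\<^sub>R f + g) = c *\<^sub>R vf_scale h X f + vf_scale h X g"
    unfolding vf_scale_def V_lincomb[OF X fg] by (simp add: fun_eq_iff fun_apply algebra_simps)
  show "vf_scale h X (f * g) = vf_scale h X f * g + f * vf_scale h X g"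
    unfolding vf_scale_def V_mult[OF X fg] by (simp add: algebra_simps)
qed

text \<open>Real multiples are multiples by constant functions on M, so linearity of forms over the
  reals is a case of linearity over functions.\<close>

lemma scaleR_eq_vf_scale:
  assumes "X \<in> V" shows "c *\<^sub>R X = vf_scale (c *\<^sub>R one_M) X"
proof (intro ext)
  fix f p
  show "(c *\<^sub>R X) f p = vf_scale (c *\<^sub>R one_M) X f p"
    using fun_cong[OF one_mult[OF V_C[OF assms, of f]], of p] by (auto simp: fun_apply vf_scale_def)
qed

lemma scaleR_V [simp]: "X \<in> V \<Longrightarrow> c *\<^sub>R X \<in> V"
  unfolding scaleR_eq_vf_scale by (intro vf_scale_V C_scaleR one_C)

lemma minus_V [simp]: "X \<in> V \<Longrightarrow> - X \<in> V"
  using scaleR_V[of X "-1"] by simp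

lemma vf_bracket_V [simp]:
  assumes X: "X \<in> V" and Y: "Y \<in> V"
  shows "vf_bracket X Y \<in> V"
proof (rule VI)
  show "vf_bracket X Y f \<in> C" if "f \<in> C" for f
    unfolding vf_bracket_def by (intro C_diff V_C X Y)
  show "vf_bracket X Y f = 0" if "f \<notin> C" for f
    unfolding vf_bracket_def V_outside[OF X that] V_outside[OF Y that] V_0[OF X] V_0[OF Y] by simp
  fix f g :: "'a \<Rightarrow> real" and c :: real
  assume fg: "f \<in> C" "g \<in> C"
  show "vf_bracket X Y (c *\<^sub>R f + g) = c *\<^sub>R vf_bracket X Y f + vf_bracket X Y g"
    unfolding vf_bracket_def V_lincomb[OF X fg] V_lincomb[OF Y fg]
      V_lincomb[OF X V_C[OF Y] V_C[OF Y]] V_lincomb[OF Y V_C[OF X] V_C[OF X]]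
    by (simp add: algebra_simps)
  have *: "X (Y f * g + f * Y g) = X (Y f) * g + Y f * X g + (X f * Y g + f * X (Y g))"
    if X: "X \<in> V" and Y: "Y \<in> V" for X Y
    using V_C[OF Y, of f] V_C[OF Y, of g] fg by (simp add: V_add[OF X] V_mult[OF X])
  show "vf_bracket X Y (f * g) = vf_bracket X Y f * g + f * vf_bracket X Y g"
    unfolding vf_bracket_def V_mult[OF X fg] V_mult[OF Y fg] *[OF X Y] *[OF Y X]
    by (simp add: algebra_simps)
qed

lemma vf_bracket_self [simp]: "vf_bracket X X = 0"
  by (simp add: fun_eq_iff vf_bracket_def fun_apply)

lemma vf_bracket_swap: "vf_bracket Y X = - vf_bracket X Y"
  by (simp add: fun_eq_iff vf_bracket_def fun_apply)

lemma vf_bracket_add_right: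
  assumes X: "X \<in> V" and Y: "Y \<in> V" and Z: "Z \<in> V"
  shows "vf_bracket X (Y + Z) = vf_bracket X Y + vf_bracket X Z"
proof -
  have "vf_bracket X (Y + Z) f = vf_bracket X Y f + vf_bracket X Z f" for f
    unfolding vf_bracket_def plus_fun_apply[of Y Z f] plus_fun_apply[of Y Z "X f"]
      V_add[OF X V_C[OF Y] V_C[OF Z]] by (simp add: algebra_simps)
  then show ?thesis by (simp add: fun_eq_iff fun_apply)
qed

lemma vf_bracket_scale_right:
  assumes X: "X \<in> V" and Y: "Y \<in> V" and f: "f \<in> C"
  shows "vf_bracket X (vf_scale f Y) = vf_scale (X f) Y + vf_scale f (vf_bracket X Y)"
proof -
  have "vf_bracket X (vf_scale f Y) g = X f * Y g + f * vf_bracket X Y g" for g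
    unfolding vf_bracket_def vf_scale_def V_mult[OF X f V_C[OF Y]]
    by (simp add: algebra_simps)
  then show ?thesis by (simp add: fun_eq_iff fun_apply vf_scale_def)
qed

lemma vf_bracket_scale_left:
  assumes "X \<in> V" "Y \<in> V" "f \<in> C"
  shows "vf_bracket (vf_scale f X) Y = vf_scale f (vf_bracket X Y) - vf_scale (Y f) X"
proof -
  have "vf_bracket (vf_scale f X) Y = - (vf_scale (Y f) X + vf_scale f (- vf_bracket X Y))"
    using vf_bracket_scale_right[OF assms(2,1,3)] vf_bracket_swap[of "vf_scale f X" Y] vf_bracket_swap[of Y X]
    by simp
  then show ?thesis by (simp add: fun_eq_iff fun_apply vf_scale_def)
qed

lemma vf_bracket_jacobi:
  assumes X: "X \<in> V" and Y: "Y \<in> V" and Z: "Z \<in> V"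
  shows "vf_bracket X (vf_bracket Y Z) = vf_bracket (vf_bracket X Y) Z + vf_bracket Y (vf_bracket X Z)"
proof -
  have "vf_bracket X (vf_bracket Y Z) f = vf_bracket (vf_bracket X Y) Z f + vf_bracket Y (vf_bracket X Z) f" for f
    unfolding vf_bracket_def
      V_diff[OF X V_C[OF Y] V_C[OF Z]] V_diff[OF Y V_C[OF X] V_C[OF Z]] V_diff[OF Z V_C[OF X] V_C[OF Y]]
    by simp
  then show ?thesis by (simp add: fun_eq_iff fun_apply)
qed

text \<open>Alternating forms without a bound on the degree; \<open>forms M\<close> adds the bound.\<close>

definition multiforms :: "'a form set"
  where "multiforms =
    {\<omega>. (\<forall>xs. set xs \<subseteq> V \<longrightarrow> \<omega> xs \<in> C) \<and>
        (\<forall>xs. \<not> set xs \<subseteq> V \<longrightarrow> \<omega> xs = 0) \<and>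
        (\<forall>xs i. set xs \<subseteq> V \<and> i < length xs \<longrightarrow>
           (\<forall>X \<in> V. \<forall>Y \<in> V. \<omega> (xs[i := X + Y]) = \<omega> (xs[i := X]) + \<omega> (xs[i := Y])) \<and>
           (\<forall>f \<in> C. \<forall>X \<in> V. \<omega> (xs[i := vf_scale f X]) = f * \<omega> (xs[i := X]))) \<and>
        (\<forall>xs i j. set xs \<subseteq> V \<and> i < j \<and> j < length xs \<and> xs ! i = xs ! j \<longrightarrow> \<omega> xs = 0)}"

lemma multiforms_outside: "\<omega> \<in> multiforms \<Longrightarrow> \<not> set xs \<subseteq> V \<Longrightarrow> \<omega> xs = 0"
  unfolding multiforms_def by blast

lemma multiforms_C: "\<omega> \<in> multiforms \<Longrightarrow> \<omega> xs \<in> C"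
proof (cases "set xs \<subseteq> V")
  case True
  then show "\<omega> \<in> multiforms \<Longrightarrow> \<omega> xs \<in> C" unfolding multiforms_def by blast
qed (simp add: multiforms_outside)

lemma multiforms_add:
  assumes "\<omega> \<in> multiforms" "set xs \<subseteq> V" "i < length xs" "X \<in> V" "Y \<in> V"
  shows "\<omega> (xs[i := X + Y]) = \<omega> (xs[i := X]) + \<omega> (xs[i := Y])"
  using assms(1) unfolding multiforms_def using assms(2-) by blast

lemma multiforms_scale:
  assumes "\<omega> \<in> multiforms" "set xs \<subseteq> V" "i < length xs" "X \<in> V" "f \<in> C"
  shows "\<omega> (xs[i := vf_scale f X]) = f * \<omega> (xs[i := X])"
  using assms(1) unfolding multiforms_def using assms(2-) by blast

lemma multiforms_alternating:
  assumes "\<omega> \<in> multiforms" "set xs \<subseteq> V" "i < j" "j < length xs" "xs ! i = xs ! j"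
  shows "\<omega> xs = 0"
  using assms(1) unfolding multiforms_def using assms(2-) by blast

lemma multiformsI:
  assumes "\<And>xs. set xs \<subseteq> V \<Longrightarrow> \<omega> xs \<in> C" "\<And>xs. \<not> set xs \<subseteq> V \<Longrightarrow> \<omega> xs = 0"
    "\<And>xs i X Y. set xs \<subseteq> V \<Longrightarrow> i < length xs \<Longrightarrow> X \<in> V \<Longrightarrow> Y \<in> V \<Longrightarrow>
      \<omega> (xs[i := X + Y]) = \<omega> (xs[i := X]) + \<omega> (xs[i := Y])"
    "\<And>xs i X f. set xs \<subseteq> V \<Longrightarrow> i < length xs \<Longrightarrow> X \<in> V \<Longrightarrow> f \<in> C \<Longrightarrow>
      \<omega> (xs[i := vf_scale f X]) = f * \<omega> (xs[i := X])"
    "\<And>xs i j. set xs \<subseteq> V \<Longrightarrow> i < j \<Longrightarrow> j < length xs \<Longrightarrow> xs ! i = xs ! j \<Longrightarrow> \<omega> xs = 0"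
  shows "\<omega> \<in> multiforms"
  unfolding multiforms_def mem_Collect_eq using assms by blast

lemma contract_multiforms [simp]:
  assumes "\<omega> \<in> multiforms" shows "contract Y \<omega> \<in> multiforms"
proof (cases "Y \<in> V")
  case True
  show ?thesis
  proof (rule multiformsI)
    fix xs show "set xs \<subseteq> V \<Longrightarrow> contract Y \<omega> xs \<in> C"
      using multiforms_C[OF assms] by (simp add: contract_apply)
    show "\<not> set xs \<subseteq> V \<Longrightarrow> contract Y \<omega> xs = 0"
      using assms by (simp add: contract_apply multiforms_outside)
    fix i X assume *: "set xs \<subseteq> V" "i < length xs" "X \<in> V"
    show "contract Y \<omega> (xs[i := X + Z]) = contract Y \<omega> (xs[i := X]) + contract Y \<omega> (xs[i := Z])"
      if "Z \<in> V" for Z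
      using multiforms_add[of \<omega> "Y # xs" "Suc i" X Z] * that True assms by (simp add: contract_apply)
    show "contract Y \<omega> (xs[i := vf_scale f X]) = f * contract Y \<omega> (xs[i := X])"
      if "f \<in> C" for f
      using multiforms_scale[of \<omega> "Y # xs" "Suc i" X f] * that True assms by (simp add: contract_apply)
  next
    fix xs i j assume *: "set xs \<subseteq> V" "i < j" "j < length xs" "xs ! i = xs ! j"
    show "contract Y \<omega> xs = 0"
      using multiforms_alternating[of \<omega> "Y # xs" "Suc i" "Suc j"] * True assms by (simp add: contract_apply)
  qed
next
  \<comment> \<open>Contraction with something that is not a vector field gives the zero form; hence
    closure under contraction holds for every Y.\<close>
  case False
  then have "contract Y \<omega> = 0"
    using assms by (auto simp: fun_eq_iff fun_apply contract_apply multiforms_outside)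
  then show ?thesis
    by (auto intro!: multiformsI simp: zero_fun_apply)
qed

lemma contract_outside: "\<omega> \<in> multiforms \<Longrightarrow> Y \<notin> V \<Longrightarrow> contract Y \<omega> = 0"
  by (auto simp: fun_eq_iff fun_apply contract_apply multiforms_outside)

lemma contract_add:
  assumes "\<omega> \<in> multiforms" "X \<in> V" "Y \<in> V"
  shows "contract (X + Y) \<omega> = contract X \<omega> + contract Y \<omega>"
proof
  fix xs
  show "contract (X + Y) \<omega> xs = (contract X \<omega> + contract Y \<omega>) xs"
  proof (cases "set xs \<subseteq> V")
    case True
    then have "set (X # xs) \<subseteq> V" "0 < length (X # xs)" using assms by auto
    with assms have "\<omega> ((X # xs)[0 := X + Y]) = \<omega> ((X # xs)[0 := X]) + \<omega> ((X # xs)[0 := Y])"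
      by (intro multiforms_add)
    then show ?thesis unfolding plus_fun_apply[of "contract X \<omega>" "contract Y \<omega>" xs] by (simp add: contract_apply)
  qed (use assms in \<open>simp add: multiforms_outside fun_eq_iff fun_apply contract_apply\<close>)
qed

lemma contract_scale:
  assumes "\<omega> \<in> multiforms" "X \<in> V" "f \<in> C"
  shows "contract (vf_scale f X) \<omega> = of_fun f \<^bold>\<and> contract X \<omega>"
proof
  fix xs
  show "contract (vf_scale f X) \<omega> xs = (of_fun f \<^bold>\<and> contract X \<omega>) xs"
  proof (cases "set xs \<subseteq> V")
    case True
    then have "set (X # xs) \<subseteq> V" "0 < length (X # xs)" using assms by auto
    with assms have "\<omega> ((X # xs)[0 := vf_scale f X]) = f * \<omega> ((X # xs)[0 := X])"
      by (intro multiforms_scale)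
    then show ?thesis by (simp add: of_fun_wedge contract_apply)
  qed (use assms in \<open>simp add: multiforms_outside of_fun_wedge contract_apply\<close>)
qed

lemma contract_self:
  assumes "\<omega> \<in> multiforms"
  shows "contract X (contract X \<omega>) = 0"
proof -
  have "\<omega> (X # X # xs) = 0" for xs
  proof (cases "set (X # X # xs) \<subseteq> V")
    case True
    moreover have "0 < (1::nat)" "1 < length (X # X # xs)" "(X # X # xs) ! 0 = (X # X # xs) ! 1" by auto
    ultimately show ?thesis
      using assms multiforms_alternating by blast
  next
    case False
    with assms show ?thesis by (rule multiforms_outside)
  qed
  then show ?thesis by (simp add: fun_eq_iff fun_apply contract_apply)
qed

lemma of_fun_one_wedge: "\<omega> \<in> multiforms \<Longrightarrow> of_fun one_M \<^bold>\<and> \<omega> = \<omega>"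
  by (simp add: of_fun_wedge multiforms_C)

text \<open>A set of alternating forms is recognised by its first arguments alone, if it is closed under contraction.\<close>

lemma multiforms_coinduct:
  assumes S: "\<omega> \<in> S"
    and base: "\<And>\<omega>. \<omega> \<in> S \<Longrightarrow> \<omega> [] \<in> C"
    and step: "\<And>\<omega> Y. \<omega> \<in> S \<Longrightarrow> Y \<in> V \<Longrightarrow> contract Y \<omega> \<in> S"
    and outside: "\<And>\<omega> Y. \<omega> \<in> S \<Longrightarrow> Y \<notin> V \<Longrightarrow> contract Y \<omega> = 0"
    and add: "\<And>\<omega> X Y. \<omega> \<in> S \<Longrightarrow> X \<in> V \<Longrightarrow> Y \<in> V \<Longrightarrow> contract (X + Y) \<omega> = contract X \<omega> + contract Y \<omega>"
    and scale: "\<And>\<omega> X f. \<omega> \<in> S \<Longrightarrow> X \<in> V \<Longrightarrow> f \<in> C \<Longrightarrow> contract (vf_scale f X) \<omega> = of_fun f \<^bold>\<and> contract X \<omega>"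
    and self: "\<And>\<omega> X. \<omega> \<in> S \<Longrightarrow> X \<in> V \<Longrightarrow> contract X (contract X \<omega>) = 0"
  shows "\<omega> \<in> multiforms"
proof -
  have smooth: "\<omega> xs \<in> C" if "\<omega> \<in> S" "set xs \<subseteq> V" for \<omega> xs
    using that
  proof (induction xs arbitrary: \<omega>)
    case (Cons Y xs)
    then have "contract Y \<omega> xs \<in> C" by (intro Cons.IH step) auto
    then show ?case by (simp add: contract_apply)
  qed (simp add: base)
  have out: "\<omega> xs = 0" if "\<omega> \<in> S" "\<not> set xs \<subseteq> V" for \<omega> xs
    using that
  proof (induction xs arbitrary: \<omega>)
    case (Cons Y xs)
    show ?case
    proof (cases "Y \<in> V")
      case True
      with Cons.prems have "contract Y \<omega> xs = 0" by (intro Cons.IH step) auto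
      then show ?thesis by (simp add: contract_apply)
    next
      case False
      then have "contract Y \<omega> xs = 0" using Cons.prems outside[of \<omega> Y] by (simp add: fun_eq_iff fun_apply)
      then show ?thesis by (simp add: contract_apply)
    qed
  qed simp
  have addi: "\<omega> (xs[i := X + Y]) = \<omega> (xs[i := X]) + \<omega> (xs[i := Y])"
    if "\<omega> \<in> S" "set xs \<subseteq> V" "i < length xs" "X \<in> V" "Y \<in> V" for \<omega> xs i X Y
    using that
  proof (induction xs arbitrary: \<omega> i)
    case (Cons Z xs)
    show ?case
    proof (cases i)
      case 0
      have "contract (X + Y) \<omega> xs = contract X \<omega> xs + contract Y \<omega> xs"
        using Cons.prems by (subst add) (simp_all only: plus_fun_apply[of "contract X \<omega>" "contract Y \<omega>" xs])
      with 0 show ?thesis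
        by (simp add: contract_apply)
    next
      case (Suc k)
      have "contract Z \<omega> (xs[k := X + Y]) = contract Z \<omega> (xs[k := X]) + contract Z \<omega> (xs[k := Y])"
        using Cons.prems Suc by (intro Cons.IH step) auto
      then show ?thesis
        by (simp add: contract_apply Suc)
    qed
  qed simp
  have scalei: "\<omega> (xs[i := vf_scale f X]) = f * \<omega> (xs[i := X])"
    if "\<omega> \<in> S" "set xs \<subseteq> V" "i < length xs" "X \<in> V" "f \<in> C" for \<omega> xs i X f
    using that
  proof (induction xs arbitrary: \<omega> i)
    case (Cons Z xs)
    show ?case
    proof (cases i)
      case 0
      then show ?thesis
        using Cons.prems scale[of \<omega> X f] by (simp add: fun_eq_iff fun_apply contract_apply of_fun_wedge)
    next
      case (Suc k)
      have "contract Z \<omega> (xs[k := vf_scale f X]) = f * contract Z \<omega> (xs[k := X])"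
        using Cons.prems Suc by (intro Cons.IH step) auto
      then show ?thesis
        by (simp add: contract_apply Suc)
    qed
  qed simp
  \<comment> \<open>Polarisation: expand the vanishing double contraction with X + Y.\<close>
  have swap: "contract X (contract Y \<omega>) = - contract Y (contract X \<omega>)" if "\<omega> \<in> S" "X \<in> V" "Y \<in> V" for \<omega> X Y
  proof -
    have "contract (X + Y) (contract (X + Y) \<omega>) = 0"
      using that by (intro self) auto
    then have "contract X (contract Y \<omega>) + contract Y (contract X \<omega>) = 0"
      using that step[of \<omega> X] step[of \<omega> Y] by (simp add: add self add.commute)
    then show ?thesis by (simp add: eq_neg_iff_add_eq_0)
  qed
  \<comment> \<open>The first argument is moved to the right by \<open>swap\<close> until it stands
    next to its copy, where \<open>self\<close> applies.\<close>
  have alt0: "\<omega> (X # xs) = 0" if "\<omega> \<in> S" "X \<in> V" "set xs \<subseteq> V" "X \<in> set xs" for \<omega> X xs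
    using that
  proof (induction xs arbitrary: \<omega>)
    case (Cons Z xs)
    show ?case
    proof (cases "X = Z")
      case True
      with self[of \<omega> X] Cons.prems show ?thesis by (simp add: fun_eq_iff fun_apply contract_apply)
    next
      case False
      have "\<omega> (X # Z # xs) = contract Z (contract X \<omega>) xs" by (simp add: contract_apply)
      also have "\<dots> = - contract Z \<omega> (X # xs)"
        using swap[of \<omega> Z X] Cons.prems by (simp add: fun_apply contract_apply)
      also have "contract Z \<omega> (X # xs) = 0"
        using Cons.prems False by (intro Cons.IH step) auto
      finally show ?thesis by simp
    qed
  qed simp
  have alt: "\<omega> xs = 0" if "\<omega> \<in> S" "set xs \<subseteq> V" "i < j" "j < length xs" "xs ! i = xs ! j" for \<omega> xs i j
    using that
  proof (induction xs arbitrary: \<omega> i j)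
    case (Cons Z xs)
    show ?case
    proof (cases i)
      case 0
      then obtain k where "j = Suc k" using Cons.prems by (cases j) auto
      with 0 Cons.prems have "Z \<in> set xs" by (auto simp: in_set_conv_nth)
      with alt0[of \<omega> Z xs] Cons.prems show ?thesis by auto
    next
      case (Suc l)
      then obtain k where "j = Suc k" using Cons.prems by (cases j) auto
      then have "contract Z \<omega> xs = 0"
        using Suc Cons.prems by (intro Cons.IH[of _ l k] step) auto
      then show ?thesis
        by (simp add: contract_apply)
    qed
  qed simp
  show ?thesis
    using S smooth out addi scalei alt by (intro multiformsI)
qed

end

section \<open>Proving identities of forms by contraction\<close>

lemma form_Nil [simp]:
  fixes \<alpha> \<beta> :: "'a form"
  shows "(\<alpha> + \<beta>) [] = \<alpha> [] + \<beta> []" "(\<alpha> - \<beta>) [] = \<alpha> [] - \<beta> []" "(- \<alpha>) [] = - \<alpha> []"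
    "(c *\<^sub>R \<alpha>) [] = c *\<^sub>R \<alpha> []" "(0 :: 'a form) [] = 0" "parity \<alpha> [] = \<alpha> []"
  by (simp_all add: plus_fun_def fun_diff_def fun_Compl_def zero_fun_def scaleR_fun_def parity_apply)

text \<open>Leibniz rules turn the contraction of one expression into a signed sum of expressions of
  the same shape. Passing to this closure lets such a shape count as stable under
  contraction.\<close>

inductive_set add_closure :: "'a form set \<Rightarrow> 'a form set" for S where
  zero: "0 \<in> add_closure S"
| base: "\<omega> \<in> S \<Longrightarrow> \<omega> \<in> add_closure S"
| add: "\<alpha> \<in> add_closure S \<Longrightarrow> \<beta> \<in> add_closure S \<Longrightarrow> \<alpha> + \<beta> \<in> add_closure S"
| minus: "\<alpha> \<in> add_closure S \<Longrightarrow> - \<alpha> \<in> add_closure S"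

lemma add_closure_diff: "\<alpha> \<in> add_closure S \<Longrightarrow> \<beta> \<in> add_closure S \<Longrightarrow> \<alpha> - \<beta> \<in> add_closure S"
  using add_closure.add[OF _ add_closure.minus, of \<alpha> S \<beta>] by simp

lemma add_closure_contract:
  assumes "\<And>\<omega>. \<omega> \<in> S \<Longrightarrow> contract Y \<omega> \<in> add_closure S" and "\<omega> \<in> add_closure S"
  shows "contract Y \<omega> \<in> add_closure S"
  using assms(2,1) by induction (auto intro: add_closure.intros)

text \<open>Identities between operations on forms are proved by showing that the defect of the identity
  is preserved by contraction, up to sums, and vanishes on functions.\<close>

lemma zero_coinduct:
  assumes S: "\<omega> \<in> S"
    and base: "\<And>\<omega>. \<omega> \<in> S \<Longrightarrow> \<omega> [] = 0"
    and step: "\<And>\<omega> Y. \<omega> \<in> S \<Longrightarrow> contract Y \<omega> \<in> add_closure S"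
  shows "\<omega> = 0"
proof -
  have nil: "\<omega> [] = 0" if "\<omega> \<in> add_closure S" for \<omega>
    using that by induction (auto simp: base)
  have "\<omega> xs = 0" if "\<omega> \<in> add_closure S" for \<omega> xs
    using that
  proof (induction xs arbitrary: \<omega>)
    case (Cons Y xs)
    have "contract Y \<omega> xs = 0"
      by (rule Cons.IH, rule add_closure_contract[OF step Cons.prems])
    then show ?case by (simp add: contract_apply)
  qed (rule nil)
  then show ?thesis
    using add_closure.base[OF S] by (simp add: fun_eq_iff fun_apply)
qed

lemma of_fun_0 [simp]: "of_fun 0 = 0"
  by (simp add: fun_eq_iff of_fun_def fun_apply)

lemma of_fun_Nil [simp]: "of_fun f [] = f"
  by (simp add: of_fun_def)

lemma wedge_of_fun_swap: "\<alpha> \<^bold>\<and> (of_fun f \<^bold>\<and> \<beta>) = of_fun f \<^bold>\<and> (\<alpha> \<^bold>\<and> \<beta>)"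
  by (metis wedge_assoc wedge_commute_even[OF parity_of_fun])

context smooth_mfd
begin

text \<open>All conditions are additive in the form, so they extend from S to its closure under sums
  and negatives.\<close>

lemma multiforms_coinduct_add:
  assumes S: "\<omega> \<in> S"
    and base: "\<And>\<omega>. \<omega> \<in> S \<Longrightarrow> \<omega> [] \<in> C"
    and step: "\<And>\<omega> Y. \<omega> \<in> S \<Longrightarrow> Y \<in> V \<Longrightarrow> contract Y \<omega> \<in> add_closure S"
    and outside: "\<And>\<omega> Y. \<omega> \<in> S \<Longrightarrow> Y \<notin> V \<Longrightarrow> contract Y \<omega> = 0"
    and add: "\<And>\<omega> X Y. \<omega> \<in> S \<Longrightarrow> X \<in> V \<Longrightarrow> Y \<in> V \<Longrightarrow> contract (X + Y) \<omega> = contract X \<omega> + contract Y \<omega>"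
    and scale: "\<And>\<omega> X f. \<omega> \<in> S \<Longrightarrow> X \<in> V \<Longrightarrow> f \<in> C \<Longrightarrow> contract (vf_scale f X) \<omega> = of_fun f \<^bold>\<and> contract X \<omega>"
    and self: "\<And>\<omega> X. \<omega> \<in> S \<Longrightarrow> X \<in> V \<Longrightarrow> contract X (contract X \<omega>) = 0"
  shows "\<omega> \<in> multiforms"
proof (rule multiforms_coinduct[of \<omega> "add_closure S"])
  show "\<omega> \<in> add_closure S" using S by (rule add_closure.base)
next
  fix \<omega> assume w: "\<omega> \<in> add_closure S"
  show "\<omega> [] \<in> C"
    using w by induction (auto simp: base)
  show "contract Y \<omega> = 0" if "Y \<notin> V" for Y
    using w that by induction (auto simp: outside)
  show "contract Y \<omega> \<in> add_closure S" if "Y \<in> V" for Y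
    using add_closure_contract[OF step w] that by blast
  fix X assume X: "X \<in> V"
  show "contract (X + Y) \<omega> = contract X \<omega> + contract Y \<omega>" if "Y \<in> V" for Y
    using w by induction (auto simp: add X that)
  show "contract (vf_scale f X) \<omega> = of_fun f \<^bold>\<and> contract X \<omega>" if "f \<in> C" for f
    using w by induction (auto simp: scale X that wedge_linear)
  show "contract X (contract X \<omega>) = 0"
    using w by induction (auto simp: self X)
qed

text \<open>Polarisation of \<open>contract_self\<close>; if X or Y is not a vector field, both
  sides are 0.\<close>

lemma contract_swap:
  assumes "\<omega> \<in> multiforms"
  shows "contract X (contract Y \<omega>) = - contract Y (contract X \<omega>)"
proof (cases "X \<in> V \<and> Y \<in> V")
  case True
  then have "contract (X + Y) (contract (X + Y) \<omega>) = 0"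
    using assms by (intro contract_self)
  then have "contract X (contract Y \<omega>) + contract Y (contract X \<omega>) = 0"
    using True assms by (simp add: contract_add contract_self add.commute)
  then show ?thesis by (simp add: eq_neg_iff_add_eq_0)
qed (use assms in \<open>auto simp: contract_outside\<close>)

lemma contract_scaleR:
  assumes "\<omega> \<in> multiforms" "X \<in> V"
  shows "contract (c *\<^sub>R X) \<omega> = c *\<^sub>R contract X \<omega>"
proof -
  have "of_fun (c *\<^sub>R one_M) \<^bold>\<and> contract X \<omega> = c *\<^sub>R (of_fun one_M \<^bold>\<and> contract X \<omega>)"
    by (simp add: fun_eq_iff fun_apply of_fun_wedge)
  with assms show ?thesis
    by (simp add: scaleR_eq_vf_scale contract_scale of_fun_one_wedge)
qed

lemma contract_minus: "\<omega> \<in> multiforms \<Longrightarrow> X \<in> V \<Longrightarrow> contract (- X) \<omega> = - contract X \<omega>"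
  using contract_scaleR[of \<omega> X "-1"] by simp

lemma contract_diff: "\<omega> \<in> multiforms \<Longrightarrow> X \<in> V \<Longrightarrow> Y \<in> V \<Longrightarrow> contract (X - Y) \<omega> = contract X \<omega> - contract Y \<omega>"
  using contract_add[of \<omega> X "- Y"] by (simp add: contract_minus)

lemma contract_0 [simp]: "\<omega> \<in> multiforms \<Longrightarrow> contract 0 \<omega> = 0"
  using contract_scaleR[of \<omega> 0 0] by simp

lemma multiforms_lincomb:
  assumes "\<alpha> \<in> multiforms" "\<beta> \<in> multiforms"
  shows "c *\<^sub>R \<alpha> + \<beta> \<in> multiforms"
proof (rule multiforms_coinduct[of _ "{c *\<^sub>R \<alpha> + \<beta> | \<alpha> \<beta>. \<alpha> \<in> multiforms \<and> \<beta> \<in> multiforms}"])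
  show "c *\<^sub>R \<alpha> + \<beta> \<in> {c *\<^sub>R \<alpha> + \<beta> | \<alpha> \<beta>. \<alpha> \<in> multiforms \<and> \<beta> \<in> multiforms}"
    using assms by blast
next
  fix \<omega> assume "\<omega> \<in> {c *\<^sub>R \<alpha> + \<beta> | \<alpha> \<beta>. \<alpha> \<in> multiforms \<and> \<beta> \<in> multiforms}"
  then obtain \<alpha> \<beta> where w: "\<omega> = c *\<^sub>R \<alpha> + \<beta>" and mf: "\<alpha> \<in> multiforms" "\<beta> \<in> multiforms" by blast
  show "\<omega> [] \<in> C"
    using mf[THEN multiforms_C] by (simp add: w)
  show "contract Y \<omega> \<in> {c *\<^sub>R \<alpha> + \<beta> | \<alpha> \<beta>. \<alpha> \<in> multiforms \<and> \<beta> \<in> multiforms}" for Y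
    using mf[THEN contract_multiforms] by (auto simp: w)
  show "Y \<notin> V \<Longrightarrow> contract Y \<omega> = 0" for Y
    using mf by (simp add: w contract_outside)
  fix X assume X: "X \<in> V"
  show "contract (X + Y) \<omega> = contract X \<omega> + contract Y \<omega>" if "Y \<in> V" for Y
    using mf X that by (simp add: w contract_add algebra_simps)
  show "contract (vf_scale f X) \<omega> = of_fun f \<^bold>\<and> contract X \<omega>" if "f \<in> C" for f
    using mf X that by (simp add: w contract_scale wedge_linear)
  show "contract X (contract X \<omega>) = 0"
    using mf by (simp add: w contract_self)
qed

lemma of_fun_multiforms [simp]: "f \<in> C \<Longrightarrow> of_fun f \<in> multiforms"
  by (rule multiforms_coinduct_add[of _ "{of_fun f | f. f \<in> C}"])
     (auto simp: intro: add_closure.zero)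

lemma zero_multiforms [simp]: "0 \<in> multiforms"
  using of_fun_multiforms[of 0] by simp

lemma add_multiforms [simp]: "\<alpha> \<in> multiforms \<Longrightarrow> \<beta> \<in> multiforms \<Longrightarrow> \<alpha> + \<beta> \<in> multiforms"
  using multiforms_lincomb[of \<alpha> \<beta> 1] by simp

lemma scaleR_multiforms [simp]: "\<alpha> \<in> multiforms \<Longrightarrow> c *\<^sub>R \<alpha> \<in> multiforms"
  using multiforms_lincomb[of \<alpha> 0 c] by simp

lemma minus_multiforms [simp]: "\<alpha> \<in> multiforms \<Longrightarrow> - \<alpha> \<in> multiforms"
  using scaleR_multiforms[of \<alpha> "-1"] by simp

lemma diff_multiforms [simp]: "\<alpha> \<in> multiforms \<Longrightarrow> \<beta> \<in> multiforms \<Longrightarrow> \<alpha> - \<beta> \<in> multiforms"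
  using add_multiforms[of \<alpha> "- \<beta>"] by simp

lemma parity_multiforms [simp]:
  assumes "\<alpha> \<in> multiforms" shows "parity \<alpha> \<in> multiforms"
proof (rule multiforms_coinduct_add[of _ "parity ` multiforms"])
  fix \<omega> assume "\<omega> \<in> parity ` multiforms"
  then obtain \<alpha> where w: "\<omega> = parity \<alpha>" and mf: "\<alpha> \<in> multiforms" by blast
  show "\<omega> [] \<in> C"
    using mf[THEN multiforms_C] by (simp add: w)
  show "contract Y \<omega> \<in> add_closure (parity ` multiforms)" for Y
    unfolding w contract_parity
    by (intro add_closure.minus add_closure.base imageI contract_multiforms mf)
  show "Y \<notin> V \<Longrightarrow> contract Y \<omega> = 0" for Y
    using mf by (simp add: w contract_outside)
  fix X assume X: "X \<in> V"
  show "contract (X + Y) \<omega> = contract X \<omega> + contract Y \<omega>" if "Y \<in> V" for Y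
    using mf X that by (simp add: w contract_add)
  show "contract (vf_scale f X) \<omega> = of_fun f \<^bold>\<and> contract X \<omega>" if "f \<in> C" for f
    using mf X that by (simp add: w contract_scale parity_wedge)
  show "contract X (contract X \<omega>) = 0"
    using mf by (simp add: w contract_self)
qed (use assms in blast)

lemma wedge_multiforms [simp]:
  assumes "\<alpha> \<in> multiforms" "\<beta> \<in> multiforms" shows "\<alpha> \<^bold>\<and> \<beta> \<in> multiforms"
proof (rule multiforms_coinduct_add[of _ "{\<alpha> \<^bold>\<and> \<beta> | \<alpha> \<beta>. \<alpha> \<in> multiforms \<and> \<beta> \<in> multiforms}"])
  fix \<omega> assume "\<omega> \<in> {\<alpha> \<^bold>\<and> \<beta> | \<alpha> \<beta>. \<alpha> \<in> multiforms \<and> \<beta> \<in> multiforms}"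
  then obtain \<alpha> \<beta> where w: "\<omega> = \<alpha> \<^bold>\<and> \<beta>" and mf: "\<alpha> \<in> multiforms" "\<beta> \<in> multiforms" by blast
  show "\<omega> [] \<in> C"
    using mf[THEN multiforms_C] by (simp add: w)
  show "contract Y \<omega> \<in> add_closure {\<alpha> \<^bold>\<and> \<beta> | \<alpha> \<beta>. \<alpha> \<in> multiforms \<and> \<beta> \<in> multiforms}" for Y
  proof -
    have "contract Y \<alpha> \<in> multiforms" "parity \<alpha> \<in> multiforms" "contract Y \<beta> \<in> multiforms"
      using mf by simp_all
    with mf show ?thesis
      unfolding w contract_wedge by (blast intro: add_closure.add add_closure.base)
  qed
  show "Y \<notin> V \<Longrightarrow> contract Y \<omega> = 0" for Y
    using mf by (simp add: w contract_outside contract_wedge)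
  fix X assume X: "X \<in> V"
  show "contract (X + Y) \<omega> = contract X \<omega> + contract Y \<omega>" if "Y \<in> V" for Y
    using mf X that by (simp add: w contract_add contract_wedge wedge_linear)
  show "contract (vf_scale f X) \<omega> = of_fun f \<^bold>\<and> contract X \<omega>" if "f \<in> C" for f
    using mf X that by (simp add: w contract_scale contract_wedge wedge_linear wedge_assoc wedge_of_fun_swap)
  show "contract X (contract X \<omega>) = 0"
    using mf by (simp add: w contract_self contract_wedge)
qed (use assms in blast)

text \<open>Moving Z from the front into the vacated slot k takes k transpositions. This matches the
  terms of \<open>ext_d\<close>, where a bracket stands in front, with those of
  \<open>lie_deriv\<close>, where it stands in its slot.\<close>

lemma multiforms_Cons_omit:
  assumes "\<omega> \<in> multiforms" "set xs \<subseteq> V" "k < length xs" "Z \<in> V"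
  shows "\<omega> (Z # omit k xs) = (-1) ^ k *\<^sub>R \<omega> (xs[k := Z])"
  using assms
proof (induction k arbitrary: \<omega> xs)
  case 0
  then show ?case by (cases xs) (auto simp: omit_def)
next
  case (Suc k)
  then obtain x ys where xs: "xs = x # ys" by (cases xs) auto
  have "\<omega> (Z # omit (Suc k) xs) = contract x (contract Z \<omega>) (omit k ys)"
    by (simp add: xs omit_def contract_apply)
  also have "\<dots> = - contract x \<omega> (Z # omit k ys)"
    using contract_swap[OF Suc.prems(1), of x Z] by (simp add: fun_apply contract_apply)
  also have "contract x \<omega> (Z # omit k ys) = (-1) ^ k *\<^sub>R contract x \<omega> (ys[k := Z])"
    using Suc.prems xs by (intro Suc.IH) auto
  finally show ?case
    by (simp add: xs contract_apply)
qed

section \<open>Cartan calculus\<close>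

abbreviation lie where "lie \<equiv> lie_deriv M"
abbreviation d where "d \<equiv> ext_d M"

lemma lie_Nil [simp]: "lie X \<omega> [] = X (\<omega> [])"
  by (simp add: lie_deriv_def)

lemma contract_lie_outside: "Y \<notin> V \<Longrightarrow> contract Y (lie X \<omega>) = 0"
  by (simp add: fun_eq_iff contract_def lie_deriv_def fun_apply)

text \<open>This Cartan relation is the defining sum with its first summand split off: the summand
  for position 0 is the contraction with the bracket.\<close>

lemma contract_lie:
  assumes "\<omega> \<in> multiforms" "X \<in> V" "Y \<in> V"
  shows "contract Y (lie X \<omega>) = lie X (contract Y \<omega>) - contract (vf_bracket X Y) \<omega>"
proof -
  have "lie X \<omega> (Y # xs) = lie X (contract Y \<omega>) xs - \<omega> (vf_bracket X Y # xs)" for xs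
  proof (cases "set xs \<subseteq> V")
    case True
    with assms show ?thesis
      by (simp add: lie_deriv_def contract_def sum.lessThan_Suc_shift del: sum.lessThan_Suc)
  next
    case False
    then show ?thesis
      using multiforms_outside[OF assms(1), of "vf_bracket X Y # xs"] by (simp add: lie_deriv_def)
  qed
  then show ?thesis
    by (simp add: fun_eq_iff fun_apply contract_apply[of Y "lie X \<omega>"] contract_apply[of "vf_bracket X Y" \<omega>])
qed

lemma lie_lincomb:
  assumes mf: "\<alpha> \<in> multiforms" "\<beta> \<in> multiforms" and X: "X \<in> V"
  shows "lie X (c *\<^sub>R \<alpha> + \<beta>) = c *\<^sub>R lie X \<alpha> + lie X \<beta>"
proof -
  have eq: "(c *\<^sub>R \<alpha> + \<beta>) = (\<lambda>ys. c *\<^sub>R \<alpha> ys + \<beta> ys)"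
    by (simp add: plus_fun_def scaleR_fun_def)
  have "lie X (c *\<^sub>R \<alpha> + \<beta>) xs = c *\<^sub>R lie X \<alpha> xs + lie X \<beta> xs" for xs
    unfolding lie_deriv_def eq V_lincomb[OF X multiforms_C[OF mf(1)] multiforms_C[OF mf(2)]]
    by (simp add: sum.distrib scaleR_sum_right scaleR_diff_right)
  then show ?thesis
    by (simp add: fun_eq_iff fun_apply)
qed

lemma
  assumes mf: "\<alpha> \<in> multiforms" and X: "X \<in> V"
  shows lie_add: "\<beta> \<in> multiforms \<Longrightarrow> lie X (\<alpha> + \<beta>) = lie X \<alpha> + lie X \<beta>"
    and lie_0: "lie X 0 = 0"
    and lie_scaleR: "lie X (c *\<^sub>R \<alpha>) = c *\<^sub>R lie X \<alpha>"
    and lie_minus: "lie X (- \<alpha>) = - lie X \<alpha>"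
    and lie_diff: "\<beta> \<in> multiforms \<Longrightarrow> lie X (\<alpha> - \<beta>) = lie X \<alpha> - lie X \<beta>"
proof -
  have add: "lie X (\<alpha> + \<beta>) = lie X \<alpha> + lie X \<beta>" if "\<alpha> \<in> multiforms" "\<beta> \<in> multiforms" for \<alpha> \<beta>
    using lie_lincomb[OF that X, of 1] by simp
  show zero: "lie X 0 = 0"
    using lie_lincomb[OF zero_multiforms zero_multiforms X, of "-1"] by simp
  have scale: "lie X (c *\<^sub>R \<alpha>) = c *\<^sub>R lie X \<alpha>" if "\<alpha> \<in> multiforms" for c \<alpha>
    using lie_lincomb[OF that zero_multiforms X, of c] zero by simp
  have minus: "lie X (- \<alpha>) = - lie X \<alpha>" if "\<alpha> \<in> multiforms" for \<alpha>
    using scale[OF that, of "-1"] by simp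
  show "lie X (\<alpha> + \<beta>) = lie X \<alpha> + lie X \<beta>" if "\<beta> \<in> multiforms"
    by (rule add[OF mf that])
  show "lie X (c *\<^sub>R \<alpha>) = c *\<^sub>R lie X \<alpha>" "lie X (- \<alpha>) = - lie X \<alpha>"
    by (rule scale[OF mf], rule minus[OF mf])
  show "lie X (\<alpha> - \<beta>) = lie X \<alpha> - lie X \<beta>" if "\<beta> \<in> multiforms"
    using add[OF mf, of "- \<beta>"] that by (simp add: minus)
qed

lemma lie_parity:
  assumes X: "X \<in> V"
  shows "\<omega> \<in> multiforms \<Longrightarrow> lie X (parity \<omega>) = parity (lie X \<omega>)"
proof -
  let ?E = "\<lambda>\<alpha>. lie X (parity \<alpha>) - parity (lie X \<alpha>)"
  let ?S = "?E ` multiforms"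
  assume mf: "\<omega> \<in> multiforms"
  have "?E \<omega> = 0"
  proof (rule zero_coinduct[of _ ?S])
    fix \<omega> assume "\<omega> \<in> ?S"
    then obtain \<alpha> where w: "\<omega> = ?E \<alpha>" and mf: "\<alpha> \<in> multiforms" by blast
    show "\<omega> [] = 0" by (simp add: w)
    fix Y
    show "contract Y \<omega> \<in> add_closure ?S"
    proof (cases "Y \<in> V")
      case True
      then have "contract Y \<omega> = - ?E (contract Y \<alpha>)"
        using mf X by (simp add: w contract_lie lie_minus)
      then show ?thesis
        using mf by (simp only:) (intro add_closure.minus add_closure.base imageI contract_multiforms)
    qed (use mf in \<open>simp add: w contract_lie_outside add_closure.zero\<close>)
  qed (use mf in blast)
  then show ?thesis by simp
qed

text \<open>Contracting the defect of the pair \<alpha>, \<beta> with Y gives the sum of the defects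
  of two pairs in which Y has been contracted into one factor. The bracket terms cancel by the
  Leibniz rule for contraction, and on functions the defect vanishes because X is a
  derivation.\<close>

lemma lie_wedge:
  assumes X: "X \<in> V"
  shows "\<alpha> \<in> multiforms \<Longrightarrow> \<beta> \<in> multiforms \<Longrightarrow> lie X (\<alpha> \<^bold>\<and> \<beta>) = lie X \<alpha> \<^bold>\<and> \<beta> + \<alpha> \<^bold>\<and> lie X \<beta>"
proof -
  let ?E = "\<lambda>\<alpha> \<beta>. lie X (\<alpha> \<^bold>\<and> \<beta>) - lie X \<alpha> \<^bold>\<and> \<beta> - \<alpha> \<^bold>\<and> lie X \<beta>"
  let ?S = "{?E \<alpha> \<beta> | \<alpha> \<beta>. \<alpha> \<in> multiforms \<and> \<beta> \<in> multiforms}"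
  assume mf: "\<alpha> \<in> multiforms" "\<beta> \<in> multiforms"
  have "?E \<alpha> \<beta> = 0"
  proof (rule zero_coinduct[of _ ?S])
    fix \<omega> assume "\<omega> \<in> ?S"
    then obtain \<alpha> \<beta> where w: "\<omega> = ?E \<alpha> \<beta>" and mf: "\<alpha> \<in> multiforms" "\<beta> \<in> multiforms" by blast
    show "\<omega> [] = 0" by (simp add: w V_mult[OF X multiforms_C multiforms_C] mf)
    fix Y
    show "contract Y \<omega> \<in> add_closure ?S"
    proof (cases "Y \<in> V")
      case True
      have "contract Y \<omega> = ?E (contract Y \<alpha>) \<beta> + ?E (parity \<alpha>) (contract Y \<beta>)"
        using mf X True by (simp add: w contract_lie contract_wedge lie_add lie_parity wedge_linear)
      moreover have "?E (contract Y \<alpha>) \<beta> \<in> ?S" "?E (parity \<alpha>) (contract Y \<beta>) \<in> ?S"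
        using mf contract_multiforms parity_multiforms by blast+
      ultimately show ?thesis
        by (simp only: add_closure.add add_closure.base)
    qed (use mf in \<open>simp add: w contract_lie_outside contract_wedge contract_outside add_closure.zero lie_0[OF mf(1) X]\<close>)
  qed (use mf in blast)
  then show ?thesis by (simp add: algebra_simps)
qed

lemma lie_of_fun:
  assumes X: "X \<in> V" and f: "f \<in> C"
  shows "lie X (of_fun f) = of_fun (X f)"
proof (rule form_eqI)
  fix Y
  show "contract Y (lie X (of_fun f)) = contract Y (of_fun (X f))"
    using X f lie_0[OF zero_multiforms X] by (cases "Y \<in> V") (simp_all add: contract_lie contract_lie_outside)
qed simp

text \<open>Contracting a Lie derivative produces a Lie derivative and a contraction, hence the
  union of two sets. Linearity over functions holds because the terms with X f, from the Leibniz
  rule and from the bracket of X with f Y, cancel.\<close>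

lemma lie_multiforms [simp]:
  assumes mf: "\<omega> \<in> multiforms" and X: "X \<in> V"
  shows "lie X \<omega> \<in> multiforms"
proof (rule multiforms_coinduct_add[of _ "lie X ` multiforms \<union> multiforms"])
  fix \<omega> assume "\<omega> \<in> lie X ` multiforms \<union> multiforms"
  then consider \<alpha> where "\<alpha> \<in> multiforms" "\<omega> = lie X \<alpha>" | "\<omega> \<in> multiforms" by blast
  note cases = this
  show "\<omega> [] \<in> C"
    by (rule cases) (simp_all add: V_C[OF X] multiforms_C)
  show "contract Y \<omega> \<in> add_closure (lie X ` multiforms \<union> multiforms)" if Y: "Y \<in> V" for Y
  proof (rule cases)
    fix \<alpha> assume a: "\<alpha> \<in> multiforms" "\<omega> = lie X \<alpha>"
    have "lie X (contract Y \<alpha>) \<in> lie X ` multiforms \<union> multiforms"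
      "contract (vf_bracket X Y) \<alpha> \<in> lie X ` multiforms \<union> multiforms"
      using a by simp_all
    then show ?thesis
      unfolding a(2) contract_lie[OF a(1) X Y] by (intro add_closure_diff add_closure.base)
  next
    assume "\<omega> \<in> multiforms"
    then show ?thesis by (intro add_closure.base) simp
  qed
  show "Y \<notin> V \<Longrightarrow> contract Y \<omega> = 0" for Y
    by (rule cases) (simp_all add: contract_outside contract_lie_outside)
  fix Y assume Y: "Y \<in> V"
  show "contract (Y + Z) \<omega> = contract Y \<omega> + contract Z \<omega>" if Z: "Z \<in> V" for Z
    by (rule cases) (use X Y Z in \<open>simp_all add: contract_add contract_lie lie_add vf_bracket_add_right\<close>)
  show "contract (vf_scale f Y) \<omega> = of_fun f \<^bold>\<and> contract Y \<omega>" if f: "f \<in> C" for f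
    by (rule cases) (use X Y f in \<open>simp_all add: contract_scale contract_lie lie_wedge lie_of_fun
      vf_bracket_scale_right contract_add V_C[OF X] wedge_linear\<close>)
  show "contract Y (contract Y \<omega>) = 0"
  proof (rule cases)
    fix \<alpha> assume a: "\<alpha> \<in> multiforms" "\<omega> = lie X \<alpha>"
    then show ?thesis
      using X Y contract_swap[of \<alpha> Y "vf_bracket X Y"]
      by (simp add: contract_lie contract_self lie_0[OF zero_multiforms X])
  qed (simp add: contract_self)
qed (use mf in blast)

lemma omit_simps [simp]: "omit 0 (x # xs) = xs" "omit (Suc i) (x # xs) = x # omit i xs"
  by (simp_all add: omit_def)

lemma length_omit: "i < length xs \<Longrightarrow> length (omit i xs) = length xs - 1"
  by (simp add: omit_def)

lemma d_Nil [simp]: "d \<omega> [] = 0"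
  by (simp add: ext_d_def)

lemma contract_d_outside: "Y \<notin> V \<Longrightarrow> contract Y (d \<omega>) = 0"
  by (simp add: fun_eq_iff contract_def ext_d_def fun_apply)

text \<open>Cartan's formula. The sums defining d are split by whether position 0, occupied by Y, is
  involved: the terms that differentiate along Y or bracket with Y form the Lie derivative, and the
  others have their indices shifted by one and form minus d of the contraction.\<close>

lemma contract_d:
  assumes mf: "\<omega> \<in> multiforms" and Y: "Y \<in> V"
  shows "contract Y (d \<omega>) = lie Y \<omega> - d (contract Y \<omega>)"
proof -
  have "d \<omega> (Y # xs) = lie Y \<omega> xs - d (contract Y \<omega>) xs" for xs
  proof (cases "set xs \<subseteq> V")
    case True
    let ?n = "length xs"
    have xs: "xs ! k \<in> V" if "k < ?n" for k
      using True that by auto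
    \<comment> \<open>The pair of positions 0 and k + 1 carries the sign (-1)^(k+1), and moving the
      bracket into slot k contributes (-1)^k; only the minus sign remains.\<close>
    have 1: "(-1) ^ Suc k *\<^sub>R \<omega> (vf_bracket Y (xs ! k) # omit k xs) = - \<omega> (xs[k := vf_bracket Y (xs ! k)])"
      if "k < ?n" for k
      using multiforms_Cons_omit[OF mf True that vf_bracket_V[OF Y xs[OF that]]]
      by (simp flip: power_mult_distrib)
    \<comment> \<open>In the remaining terms the bracket stands before Y; exchanging them makes Y
      the first argument and supplies the minus sign.\<close>
    have 2: "\<omega> (Z # Y # zs) = - \<omega> (Y # Z # zs)" for Z zs
      using contract_swap[OF mf, of Y Z] by (simp add: fun_eq_iff fun_apply contract_def)
    have "d \<omega> (Y # xs) =
        Y (\<omega> xs) + (\<Sum>k<?n. (-1) ^ Suc k *\<^sub>R (xs ! k) (\<omega> (Y # omit k xs))) +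
        (\<Sum>k<?n. (-1) ^ Suc k *\<^sub>R \<omega> (vf_bracket Y (xs ! k) # omit k xs) +
          (\<Sum>l<k. (-1) ^ (l + k) *\<^sub>R \<omega> (vf_bracket (xs ! l) (xs ! k) # Y # omit l (omit k xs))))"
      using True Y by (simp add: ext_d_def sum.lessThan_Suc_shift del: sum.lessThan_Suc)
    also have "(\<Sum>k<?n. (-1) ^ Suc k *\<^sub>R \<omega> (vf_bracket Y (xs ! k) # omit k xs) +
          (\<Sum>l<k. (-1) ^ (l + k) *\<^sub>R \<omega> (vf_bracket (xs ! l) (xs ! k) # Y # omit l (omit k xs))))
        = (\<Sum>k<?n. - \<omega> (xs[k := vf_bracket Y (xs ! k)]) -
          (\<Sum>l<k. (-1) ^ (l + k) *\<^sub>R \<omega> (Y # vf_bracket (xs ! l) (xs ! k) # omit l (omit k xs))))"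
      using 1 by (intro sum.cong refl) (simp add: 2 sum_negf)
    also have "(\<Sum>k<?n. (-1) ^ Suc k *\<^sub>R (xs ! k) (\<omega> (Y # omit k xs)))
        = - (\<Sum>k<?n. (-1) ^ k *\<^sub>R (xs ! k) (\<omega> (Y # omit k xs)))"
      by (simp add: sum_negf)
    finally show ?thesis
      using True by (simp add: lie_deriv_def ext_d_def contract_def sum_subtractf sum_negf)
  qed (simp add: ext_d_def lie_deriv_def)
  then show ?thesis
    by (simp add: fun_eq_iff fun_apply contract_apply[of Y "d \<omega>"])
qed

lemma d_lincomb:
  assumes "\<alpha> \<in> multiforms" "\<beta> \<in> multiforms"
  shows "d (c *\<^sub>R \<alpha> + \<beta>) = c *\<^sub>R d \<alpha> + d \<beta>"
proof -
  let ?E = "\<lambda>\<alpha> \<beta>. d (c *\<^sub>R \<alpha> + \<beta>) - c *\<^sub>R d \<alpha> - d \<beta>"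
  let ?S = "{?E \<alpha> \<beta> | \<alpha> \<beta>. \<alpha> \<in> multiforms \<and> \<beta> \<in> multiforms}"
  have "?E \<alpha> \<beta> = 0"
  proof (rule zero_coinduct[of _ ?S])
    fix \<omega> assume "\<omega> \<in> ?S"
    then obtain \<alpha> \<beta> where w: "\<omega> = ?E \<alpha> \<beta>" and mf: "\<alpha> \<in> multiforms" "\<beta> \<in> multiforms" by blast
    show "\<omega> [] = 0" by (simp add: w)
    fix Y
    show "contract Y \<omega> \<in> add_closure ?S"
    proof (cases "Y \<in> V")
      case True
      have "contract Y \<omega> = - ?E (contract Y \<alpha>) (contract Y \<beta>)"
        using mf True by (simp add: w contract_d lie_add lie_scaleR algebra_simps)
      moreover have "?E (contract Y \<alpha>) (contract Y \<beta>) \<in> ?S"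
        using mf contract_multiforms by blast
      ultimately show ?thesis
        by (simp only: add_closure.minus add_closure.base)
    qed (simp add: w contract_d_outside add_closure.zero)
  qed (use assms in blast)
  then show ?thesis by (simp add: algebra_simps)
qed

lemma d_0 [simp]: "d 0 = 0"
  using d_lincomb[OF zero_multiforms zero_multiforms, of "-1"] by simp

lemma d_add: "\<alpha> \<in> multiforms \<Longrightarrow> \<beta> \<in> multiforms \<Longrightarrow> d (\<alpha> + \<beta>) = d \<alpha> + d \<beta>"
  using d_lincomb[of \<alpha> \<beta> 1] by simp

lemma d_scaleR: "\<alpha> \<in> multiforms \<Longrightarrow> d (c *\<^sub>R \<alpha>) = c *\<^sub>R d \<alpha>"
  using d_lincomb[of \<alpha> 0 c] by simp

lemma d_minus: "\<alpha> \<in> multiforms \<Longrightarrow> d (- \<alpha>) = - d \<alpha>"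
  using d_scaleR[of \<alpha> "-1"] by simp

lemma d_diff: "\<alpha> \<in> multiforms \<Longrightarrow> \<beta> \<in> multiforms \<Longrightarrow> d (\<alpha> - \<beta>) = d \<alpha> - d \<beta>"
  using d_add[of \<alpha> "- \<beta>"] by (simp add: d_minus)

lemma d_parity:
  assumes "\<omega> \<in> multiforms" shows "d (parity \<omega>) = - parity (d \<omega>)"
proof -
  let ?E = "\<lambda>\<alpha>. d (parity \<alpha>) + parity (d \<alpha>)"
  let ?S = "?E ` multiforms"
  have "?E \<omega> = 0"
  proof (rule zero_coinduct[of _ ?S])
    fix \<omega> assume "\<omega> \<in> ?S"
    then obtain \<alpha> where w: "\<omega> = ?E \<alpha>" and mf: "\<alpha> \<in> multiforms" by blast
    show "\<omega> [] = 0" by (simp add: w)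
    fix Y
    show "contract Y \<omega> \<in> add_closure ?S"
    proof (cases "Y \<in> V")
      case True
      then have "contract Y \<omega> = ?E (contract Y \<alpha>)"
        using mf by (simp add: w contract_d d_minus lie_parity)
      then show ?thesis
        using mf by (simp only:) (intro add_closure.base imageI contract_multiforms)
    qed (simp add: w contract_d_outside add_closure.zero)
  qed (use assms in blast)
  then show ?thesis by (simp add: eq_neg_iff_add_eq_0)
qed

lemma d_wedge:
  assumes "\<alpha> \<in> multiforms" "\<beta> \<in> multiforms"
  shows "d (\<alpha> \<^bold>\<and> \<beta>) = d \<alpha> \<^bold>\<and> \<beta> + parity \<alpha> \<^bold>\<and> d \<beta>"
proof -
  let ?E = "\<lambda>\<alpha> \<beta>. d (\<alpha> \<^bold>\<and> \<beta>) - d \<alpha> \<^bold>\<and> \<beta> - parity \<alpha> \<^bold>\<and> d \<beta>"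
  let ?S = "{?E \<alpha> \<beta> | \<alpha> \<beta>. \<alpha> \<in> multiforms \<and> \<beta> \<in> multiforms}"
  have "?E \<alpha> \<beta> = 0"
  proof (rule zero_coinduct[of _ ?S])
    fix \<omega> assume "\<omega> \<in> ?S"
    then obtain \<alpha> \<beta> where w: "\<omega> = ?E \<alpha> \<beta>" and mf: "\<alpha> \<in> multiforms" "\<beta> \<in> multiforms" by blast
    show "\<omega> [] = 0" by (simp add: w)
    fix Y
    show "contract Y \<omega> \<in> add_closure ?S"
    proof (cases "Y \<in> V")
      case True
      have "contract Y \<omega> = - ?E (contract Y \<alpha>) \<beta> - ?E (parity \<alpha>) (contract Y \<beta>)"
        using mf True by (simp add: w contract_d contract_wedge d_add d_parity lie_wedge lie_parity wedge_linear)
      moreover have "?E (contract Y \<alpha>) \<beta> \<in> ?S" "?E (parity \<alpha>) (contract Y \<beta>) \<in> ?S"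
        using mf contract_multiforms parity_multiforms by blast+
      ultimately show ?thesis
        by (simp only: add_closure_diff add_closure.minus add_closure.base)
    qed (use mf in \<open>simp add: w contract_d_outside contract_wedge contract_outside add_closure.zero\<close>)
  qed (use assms in blast)
  then show ?thesis by (simp add: algebra_simps)
qed

lemma vf_bracket_scaleR_right:
  assumes X: "X \<in> V" and Y: "Y \<in> V"
  shows "vf_bracket X (c *\<^sub>R Y) = c *\<^sub>R vf_bracket X Y"
proof -
  have "vf_bracket X (c *\<^sub>R Y) f = c *\<^sub>R vf_bracket X Y f" for f
    unfolding vf_bracket_def scaleR_fun_apply[of c Y f] scaleR_fun_apply[of c Y "X f"] V_scaleR[OF X V_C[OF Y]]
    by (simp add: algebra_simps)
  then show ?thesis by (simp add: fun_eq_iff fun_apply)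
qed

lemma vf_bracket_lincomb_left:
  assumes "X \<in> V" "Y \<in> V" "Z \<in> V"
  shows "vf_bracket (c *\<^sub>R X + Y) Z = c *\<^sub>R vf_bracket X Z + vf_bracket Y Z"
  using assms by (simp add: vf_bracket_swap[of _ Z] vf_bracket_add_right vf_bracket_scaleR_right)

lemma lie_lincomb_vf:
  assumes X: "X \<in> V" and Y: "Y \<in> V" and "\<omega> \<in> multiforms"
  shows "lie (c *\<^sub>R X + Y) \<omega> = c *\<^sub>R lie X \<omega> + lie Y \<omega>"
proof -
  let ?E = "\<lambda>\<alpha>. lie (c *\<^sub>R X + Y) \<alpha> - c *\<^sub>R lie X \<alpha> - lie Y \<alpha>"
  let ?S = "?E ` multiforms"
  have "?E \<omega> = 0"
  proof (rule zero_coinduct[of _ ?S])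
    fix \<omega> assume "\<omega> \<in> ?S"
    then obtain \<alpha> where w: "\<omega> = ?E \<alpha>" and mf: "\<alpha> \<in> multiforms" by blast
    show "\<omega> [] = 0" by (simp add: w fun_eq_iff fun_apply)
    fix Z
    show "contract Z \<omega> \<in> add_closure ?S"
    proof (cases "Z \<in> V")
      case True
      then have "contract Z \<omega> = ?E (contract Z \<alpha>)"
        using mf X Y by (simp add: w contract_lie vf_bracket_lincomb_left contract_add contract_scaleR)
            (simp add: algebra_simps)
      then show ?thesis
        using mf by (simp only:) (intro add_closure.base imageI contract_multiforms)
    qed (simp add: w contract_lie_outside add_closure.zero)
  qed (use assms in blast)
  then show ?thesis by (simp add: algebra_simps)
qed

lemma contract_d_of_fun: "f \<in> C \<Longrightarrow> Z \<in> V \<Longrightarrow> contract Z (d (of_fun f)) = of_fun (Z f)"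
  by (simp add: contract_d lie_of_fun)

text \<open>The correction term with d f measures how far the Lie derivative is from being linear
  over functions in X. It cancels against the same term from the Leibniz rule of d when d of a form
  is shown to be a form.\<close>

lemma lie_vf_scale:
  assumes X: "X \<in> V" and f: "f \<in> C" and "\<omega> \<in> multiforms"
  shows "lie (vf_scale f X) \<omega> = of_fun f \<^bold>\<and> lie X \<omega> + d (of_fun f) \<^bold>\<and> contract X \<omega>"
proof -
  let ?E = "\<lambda>\<alpha>. lie (vf_scale f X) \<alpha> - of_fun f \<^bold>\<and> lie X \<alpha> - d (of_fun f) \<^bold>\<and> contract X \<alpha>"
  let ?S = "?E ` multiforms"
  have "?E \<omega> = 0"
  proof (rule zero_coinduct[of _ ?S])
    fix \<omega> assume "\<omega> \<in> ?S"
    then obtain \<alpha> where w: "\<omega> = ?E \<alpha>" and mf: "\<alpha> \<in> multiforms" by blast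
    show "\<omega> [] = 0" by (simp add: w vf_scale_def)
    fix Z
    show "contract Z \<omega> \<in> add_closure ?S"
    proof (cases "Z \<in> V")
      case True
      \<comment> \<open>Oddness of d f: functions are even and d anticommutes with
        \<open>parity\<close>.\<close>
      have "parity (d (of_fun f)) = - d (of_fun f)"
        using d_parity[of "of_fun f"] f by (metis minus_minus parity_of_fun of_fun_multiforms)
      moreover have "contract Z (contract X \<alpha>) = - contract X (contract Z \<alpha>)"
        using mf by (rule contract_swap)
      ultimately have "contract Z \<omega> = ?E (contract Z \<alpha>)"
        using mf X f True by (simp add: w contract_lie vf_bracket_scale_left contract_diff contract_scale
          contract_wedge contract_d_of_fun wedge_linear V_C[OF True] algebra_simps)
      then show ?thesis
        using mf by (simp only:) (intro add_closure.base imageI contract_multiforms)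
    qed (use mf in \<open>simp add: w contract_lie_outside contract_wedge contract_d_outside contract_outside
        contract_swap[of _ Z] add_closure.zero\<close>)
  qed (use assms in blast)
  then show ?thesis by (simp add: algebra_simps)
qed

lemma lie_lie:
  assumes X: "X \<in> V" and Y: "Y \<in> V" and "\<omega> \<in> multiforms"
  shows "lie X (lie Y \<omega>) - lie Y (lie X \<omega>) = lie (vf_bracket X Y) \<omega>"
proof -
  let ?E = "\<lambda>\<alpha>. lie X (lie Y \<alpha>) - lie Y (lie X \<alpha>) - lie (vf_bracket X Y) \<alpha>"
  let ?S = "?E ` multiforms"
  have "?E \<omega> = 0"
  proof (rule zero_coinduct[of _ ?S])
    fix \<omega> assume "\<omega> \<in> ?S"
    then obtain \<alpha> where w: "\<omega> = ?E \<alpha>" and mf: "\<alpha> \<in> multiforms" by blast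
    show "\<omega> [] = 0" by (simp add: w vf_bracket_def)
    fix Z
    show "contract Z \<omega> \<in> add_closure ?S"
    proof (cases "Z \<in> V")
      case True
      have "contract Z \<omega> = ?E (contract Z \<alpha>)"
        using mf X Y True by (simp add: w contract_lie lie_diff contract_add vf_bracket_jacobi[OF X Y True])
      then show ?thesis
        using mf by (simp only:) (intro add_closure.base imageI contract_multiforms)
    qed (simp add: w contract_lie_outside add_closure.zero)
  qed (use assms in blast)
  then show ?thesis by simp
qed

text \<open>By Cartan's formula everything reduces to the first argument. Linearity over functions
  is the cancellation of the d f terms of \<open>lie_vf_scale\<close> and \<open>d_wedge\<close>;
  the double contraction with Y vanishes since Y commutes with itself and contracting twice gives
  0.\<close>

lemma d_multiforms [simp]:
  assumes "\<omega> \<in> multiforms" shows "d \<omega> \<in> multiforms"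
proof (rule multiforms_coinduct_add[of _ "d ` multiforms \<union> multiforms"])
  fix \<omega> assume "\<omega> \<in> d ` multiforms \<union> multiforms"
  then consider \<alpha> where "\<alpha> \<in> multiforms" "\<omega> = d \<alpha>" | "\<omega> \<in> multiforms" by blast
  note cases = this
  show "\<omega> [] \<in> C"
    by (rule cases) (simp_all add: multiforms_C)
  show "contract Y \<omega> \<in> add_closure (d ` multiforms \<union> multiforms)" if Y: "Y \<in> V" for Y
  proof (rule cases)
    fix \<alpha> assume a: "\<alpha> \<in> multiforms" "\<omega> = d \<alpha>"
    have "d (contract Y \<alpha>) \<in> d ` multiforms \<union> multiforms" "lie Y \<alpha> \<in> d ` multiforms \<union> multiforms"
      using a Y by simp_all
    then show ?thesis
      unfolding a(2) contract_d[OF a(1) Y] by (intro add_closure_diff add_closure.base)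
  next
    assume "\<omega> \<in> multiforms"
    then show ?thesis by (intro add_closure.base) simp
  qed
  show "Y \<notin> V \<Longrightarrow> contract Y \<omega> = 0" for Y
    by (rule cases) (simp_all add: contract_outside contract_d_outside)
  fix Y assume Y: "Y \<in> V"
  show "contract (Y + Z) \<omega> = contract Y \<omega> + contract Z \<omega>" if Z: "Z \<in> V" for Z
    by (rule cases) (use Y Z lie_lincomb_vf[of Y Z _ 1] in \<open>simp_all add: contract_add contract_d d_add\<close>)
  show "contract (vf_scale f Y) \<omega> = of_fun f \<^bold>\<and> contract Y \<omega>" if f: "f \<in> C" for f
    by (rule cases) (use Y f in \<open>simp_all add: contract_scale contract_d lie_vf_scale d_wedge wedge_linear\<close>)
  show "contract Y (contract Y \<omega>) = 0"
    by (rule cases) (use Y in \<open>simp_all add: contract_self contract_d contract_lie\<close>)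
qed (use assms in blast)

text \<open>Proved together with the commutation of d and Lie derivatives. Contracting d d \<alpha>
  gives the commutator of d with a Lie derivative plus d d of the contraction. Contracting that
  commutator gives, by \<open>lie_lie\<close>, minus the same commutator applied to the
  contraction.\<close>

lemma d_d:
  assumes "\<omega> \<in> multiforms" shows "d (d \<omega>) = 0"
proof (rule zero_coinduct[of _ "(\<lambda>\<alpha>. d (d \<alpha>)) ` multiforms \<union> (\<lambda>(X, \<alpha>). lie X (d \<alpha>) - d (lie X \<alpha>)) ` (V \<times> multiforms)"])
  let ?S = "(\<lambda>\<alpha>. d (d \<alpha>)) ` multiforms \<union> (\<lambda>(X, \<alpha>). lie X (d \<alpha>) - d (lie X \<alpha>)) ` (V \<times> multiforms)"
  show "d (d \<omega>) \<in> ?S" using assms by blast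
  fix \<omega> assume "\<omega> \<in> ?S"
  then consider \<alpha> where "\<alpha> \<in> multiforms" "\<omega> = d (d \<alpha>)"
    | X \<alpha> where "X \<in> V" "\<alpha> \<in> multiforms" "\<omega> = lie X (d \<alpha>) - d (lie X \<alpha>)" by auto
  note cases = this
  show "\<omega> [] = 0"
    by (rule cases) (simp_all add: V_0)
  fix Y
  show "contract Y \<omega> \<in> add_closure ?S"
  proof (cases "Y \<in> V")
    case Y: True
    show ?thesis
    proof (rule cases)
      fix \<alpha> assume a: "\<alpha> \<in> multiforms" "\<omega> = d (d \<alpha>)"
      have "contract Y \<omega> = (lie Y (d \<alpha>) - d (lie Y \<alpha>)) + d (d (contract Y \<alpha>))"
        using a Y by (simp add: contract_d d_diff)
      moreover have "lie Y (d \<alpha>) - d (lie Y \<alpha>) \<in> ?S"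
        by (rule UnI2, rule image_eqI[where x = "(Y, \<alpha>)"]) (use a Y in auto)
      moreover have "d (d (contract Y \<alpha>)) \<in> ?S"
        using a by simp
      ultimately show ?thesis
        by (simp only: add_closure.add add_closure.base)
    next
      fix X \<alpha> assume a: "X \<in> V" "\<alpha> \<in> multiforms" "\<omega> = lie X (d \<alpha>) - d (lie X \<alpha>)"
      have "contract Y \<omega> = - (lie X (d (contract Y \<alpha>)) - d (lie X (contract Y \<alpha>)))"
        unfolding a(3) using a(1,2) Y lie_lie[of X Y \<alpha>]
        by (simp add: contract_d contract_lie lie_diff d_diff) (simp add: algebra_simps)
      moreover have "lie X (d (contract Y \<alpha>)) - d (lie X (contract Y \<alpha>)) \<in> ?S"
        by (rule UnI2, rule image_eqI[where x = "(X, contract Y \<alpha>)"]) (use a in auto)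
      ultimately show ?thesis
        by (simp only: add_closure.minus add_closure.base)
    qed
  next
    case False
    have "contract Y \<omega> = 0"
      by (rule cases) (use False in \<open>simp_all add: contract_d_outside contract_lie_outside\<close>)
    then show ?thesis
      by (simp add: add_closure.zero)
  qed
qed

end

section \<open>Degrees\<close>

text \<open>Exact degree and bounded degree are two instances of one predicate. Degrees are integers
  so that operators of negative degree can shift them freely; in negative degrees only 0 is
  left.\<close>

definition vanishes_off :: "(int \<Rightarrow> bool) \<Rightarrow> 'a form \<Rightarrow> bool"
  where "vanishes_off P \<omega> \<longleftrightarrow> (\<forall>xs. \<not> P (int (length xs)) \<longrightarrow> \<omega> xs = 0)"

abbreviation has_degree :: "int \<Rightarrow> 'a form \<Rightarrow> bool"
  where "has_degree p \<equiv> vanishes_off (\<lambda>n. n = p)"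

abbreviation bounded_degree :: "int \<Rightarrow> 'a form \<Rightarrow> bool"
  where "bounded_degree N \<equiv> vanishes_off (\<lambda>n. n \<le> N)"

lemma vanishes_offD: "vanishes_off P \<omega> \<Longrightarrow> \<not> P (int (length xs)) \<Longrightarrow> \<omega> xs = 0"
  by (simp add: vanishes_off_def)

lemma vanishes_off_0 [simp]: "vanishes_off P 0"
  by (simp add: vanishes_off_def zero_fun_def)

lemma vanishes_off_linear:
  assumes "vanishes_off P \<alpha>"
  shows "vanishes_off P \<beta> \<Longrightarrow> vanishes_off P (\<alpha> + \<beta>)" "vanishes_off P \<beta> \<Longrightarrow> vanishes_off P (\<alpha> - \<beta>)"
    "vanishes_off P (- \<alpha>)" "vanishes_off P (c *\<^sub>R \<alpha>)" "vanishes_off P (parity \<alpha>)"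
  using assms by (simp_all add: vanishes_off_def fun_eq_iff fun_apply parity_def)

lemma vanishes_off_contract: "vanishes_off P \<alpha> \<Longrightarrow> vanishes_off (\<lambda>n. P (n + 1)) (contract Y \<alpha>)"
  by (simp add: vanishes_off_def contract_def add.commute)

lemma has_degree_contract: "has_degree p \<alpha> \<Longrightarrow> has_degree (p - 1) (contract Y \<alpha>)"
  by (drule vanishes_off_contract[of _ _ Y]) (simp add: vanishes_off_def)

lemma bounded_degree_contract: "bounded_degree p \<alpha> \<Longrightarrow> bounded_degree (p - 1) (contract Y \<alpha>)"
  by (drule vanishes_off_contract[of _ _ Y]) (simp add: vanishes_off_def)

lemma has_degree_of_fun: "has_degree 0 (of_fun f)"
  by (simp add: vanishes_off_def of_fun_def)

lemma has_degree_negD: "has_degree p \<omega> \<Longrightarrow> p < 0 \<Longrightarrow> \<omega> = 0"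
  by (rule ext, subst zero_fun_apply) (simp add: vanishes_off_def)

lemma has_degree_0D:
  assumes "has_degree 0 \<omega>" shows "\<omega> = of_fun (\<omega> [])"
proof
  fix xs show "\<omega> xs = of_fun (\<omega> []) xs"
    using vanishes_offD[OF assms, of xs] by (cases "xs = []") (simp_all only: of_fun_def, simp_all)
qed

lemma has_degree_wedge:
  assumes "has_degree p \<alpha>" "has_degree q \<beta>" shows "has_degree (p + q) (\<alpha> \<^bold>\<and> \<beta>)"
proof -
  have "(\<alpha> \<^bold>\<and> \<beta>) xs = 0" if "int (length xs) \<noteq> p + q" for xs
    using assms that
  proof (induction xs arbitrary: \<alpha> \<beta> p q)
    case Nil
    then have "0 \<noteq> p \<or> 0 \<noteq> q" by auto
    then show ?case
      using Nil.prems(1,2) vanishes_offD[of _ \<alpha> "[]"] vanishes_offD[of _ \<beta> "[]"] by force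
  next
    case (Cons Y xs)
    have "(contract Y \<alpha> \<^bold>\<and> \<beta>) xs = 0"
      by (rule Cons.IH[OF has_degree_contract[OF Cons.prems(1)] Cons.prems(2)]) (use Cons.prems(3) in simp)
    moreover have "(parity \<alpha> \<^bold>\<and> contract Y \<beta>) xs = 0"
      by (rule Cons.IH[OF vanishes_off_linear(5)[OF Cons.prems(1)] has_degree_contract[OF Cons.prems(2)]])
         (use Cons.prems(3) in simp)
    ultimately show ?case
      by (simp add: wedge_Cons)
  qed
  then show ?thesis by (simp add: vanishes_off_def)
qed

lemma bounded_degree_wedge:
  assumes "bounded_degree p \<alpha>" "bounded_degree q \<beta>" shows "bounded_degree (p + q) (\<alpha> \<^bold>\<and> \<beta>)"
proof -
  have "(\<alpha> \<^bold>\<and> \<beta>) xs = 0" if "\<not> int (length xs) \<le> p + q" for xs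
    using assms that
  proof (induction xs arbitrary: \<alpha> \<beta> p q)
    case Nil
    then have "\<not> 0 \<le> p \<or> \<not> 0 \<le> q" by auto
    then show ?case
      using Nil.prems(1,2) vanishes_offD[of _ \<alpha> "[]"] vanishes_offD[of _ \<beta> "[]"] by force
  next
    case (Cons Y xs)
    have "(contract Y \<alpha> \<^bold>\<and> \<beta>) xs = 0"
      by (rule Cons.IH[OF bounded_degree_contract[OF Cons.prems(1)] Cons.prems(2)]) (use Cons.prems(3) in simp)
    moreover have "(parity \<alpha> \<^bold>\<and> contract Y \<beta>) xs = 0"
      by (rule Cons.IH[OF vanishes_off_linear(5)[OF Cons.prems(1)] bounded_degree_contract[OF Cons.prems(2)]])
         (use Cons.prems(3) in simp)
    ultimately show ?case
      by (simp add: wedge_Cons)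
  qed
  then show ?thesis by (simp add: vanishes_off_def)
qed

definition sg :: "int \<Rightarrow> real" where "sg k = (if even k then 1 else -1)"

lemma powi_minus_one: "(-1 :: real) powi k = sg k"
  by (auto simp: sg_def power_int_minus_left)

text \<open>The k-th power of the involution \<open>parity\<close>: the Koszul sign for moving an
  operator of degree k past a possibly inhomogeneous form.\<close>

definition par :: "int \<Rightarrow> 'a form \<Rightarrow> 'a form" where "par k \<omega> = (if even k then \<omega> else parity \<omega>)"

lemma parity_has_degree:
  assumes "has_degree p \<omega>" shows "parity \<omega> = sg p *\<^sub>R \<omega>"
proof (intro ext)
  fix xs q
  have "even p = even (length xs)" if "\<omega> xs q \<noteq> 0"
  proof -
    have "int (length xs) = p"
      using vanishes_offD[OF assms, of xs] that by (metis zero_fun_apply)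
    then show ?thesis by (metis even_of_nat)
  qed
  then show "parity \<omega> xs q = (sg p *\<^sub>R \<omega>) xs q"
    by (cases "\<omega> xs q = 0") (auto simp: parity_def sg_def fun_apply)
qed

text \<open>The third factor lets the rule reorder neighbours inside products that are bracketed to
  the right; instantiated with fixed coefficients, it serves as an oriented rewrite rule.\<close>

lemma wedge_swap:
  assumes "has_degree p \<alpha>" "has_degree q \<beta>"
  shows "\<alpha> \<^bold>\<and> (\<beta> \<^bold>\<and> \<gamma>) = sg (p * q) *\<^sub>R (\<beta> \<^bold>\<and> (\<alpha> \<^bold>\<and> \<gamma>))"
proof -
  have "\<alpha> \<^bold>\<and> \<beta> = sg (p * q) *\<^sub>R (\<beta> \<^bold>\<and> \<alpha>)"
  proof (cases "even p")
    case True
    then show ?thesis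
      using wedge_commute_even[of \<alpha> \<beta>] parity_has_degree[OF assms(1)] by (simp add: sg_def)
  next
    case False
    then show ?thesis
      using wedge_commute_odd[of \<alpha> \<beta>] parity_has_degree[OF assms(1)] parity_has_degree[OF assms(2)]
      by (simp add: sg_def wedge_scaleR_left)
  qed
  then show ?thesis
    by (metis wedge_assoc wedge_scaleR_left)
qed

section \<open>Forms of fixed degree and inhomogeneous forms\<close>

context smooth_mfd
begin

abbreviation \<Omega> where "\<Omega> \<equiv> forms M"

text \<open>Integer degrees make the coefficient degrees k + 1 and k + 2 meaningful for all k,
  including the negative ones, where the coefficient is forced to be 0.\<close>

definition dforms :: "int \<Rightarrow> 'a form set"
  where "dforms p = {\<omega> \<in> multiforms. has_degree p \<omega>}"

lemma kforms_eq_dforms: "kforms M k = dforms (int k)"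
proof (intro equalityI subsetI)
  fix \<omega> assume w: "\<omega> \<in> kforms M k"
  have out: "\<omega> xs = 0" if "\<not> (length xs = k \<and> set xs \<subseteq> V)" for xs
    using w that unfolding kforms_def by blast
  have "\<omega> \<in> multiforms"
  proof (rule multiformsI)
    show "\<omega> xs \<in> C" if "set xs \<subseteq> V" for xs
    proof (cases "length xs = k")
      case True
      with w that show ?thesis unfolding kforms_def by blast
    qed (simp add: out)
    show "\<omega> xs = 0" if "\<not> set xs \<subseteq> V" for xs
      using that by (intro out) blast
    show "\<omega> (xs[i := X + Y]) = \<omega> (xs[i := X]) + \<omega> (xs[i := Y])"
      if "set xs \<subseteq> V" "i < length xs" "X \<in> V" "Y \<in> V" for xs i X Y
    proof (cases "length xs = k")
      case True
      with w that show ?thesis unfolding kforms_def by blast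
    qed (simp add: out)
    show "\<omega> (xs[i := vf_scale f X]) = f * \<omega> (xs[i := X])"
      if "set xs \<subseteq> V" "i < length xs" "X \<in> V" "f \<in> C" for xs i X f
    proof (cases "length xs = k")
      case True
      with w that show ?thesis unfolding kforms_def by blast
    qed (simp add: out)
    show "\<omega> xs = 0" if "set xs \<subseteq> V" "i < j" "j < length xs" "xs ! i = xs ! j" for xs i j
    proof (cases "length xs = k")
      case True
      with w that show ?thesis unfolding kforms_def by blast
    qed (simp add: out)
  qed
  then show "\<omega> \<in> dforms (int k)"
    using out by (simp add: dforms_def vanishes_off_def)
next
  fix \<omega> assume "\<omega> \<in> dforms (int k)"
  then have mf: "\<omega> \<in> multiforms" and out: "length xs \<noteq> k \<Longrightarrow> \<omega> xs = 0" for xs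
    by (auto simp: dforms_def vanishes_off_def)
  show "\<omega> \<in> kforms M k"
    unfolding kforms_def mem_Collect_eq
  proof (intro conjI allI impI ballI)
    show "\<omega> xs = 0" if "\<not> (length xs = k \<and> set xs \<subseteq> V)" for xs
      using that out multiforms_outside[OF mf] by blast
  qed (use multiforms_C[OF mf] multiforms_add[OF mf] multiforms_scale[OF mf] multiforms_alternating[OF mf] in blast)+
qed

lemma forms_eq: "\<Omega> = {\<omega> \<in> multiforms. \<exists>N. bounded_degree N \<omega>}"
proof (intro equalityI subsetI)
  fix \<omega> assume w: "\<omega> \<in> \<Omega>"
  \<comment> \<open>Every defining condition of an alternating form compares lists of one length, so
    it can be checked on the homogeneous component of that length.\<close>
  define c where "c k = (\<lambda>xs. if length xs = k then \<omega> xs else 0)" for k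
  have "c k \<in> kforms M k" for k
    using w unfolding forms_def c_def by blast
  then have c: "c k \<in> multiforms" for k
    by (simp add: kforms_eq_dforms dforms_def)
  have eq: "\<omega> xs = c (length xs) xs" for xs
    by (simp add: c_def)
  have "\<omega> \<in> multiforms"
  proof (rule multiformsI)
    show "\<omega> xs \<in> C" for xs
      by (simp add: eq multiforms_C[OF c])
    show "\<omega> xs = 0" if "\<not> set xs \<subseteq> V" for xs
      using multiforms_outside[OF c that] by (simp add: eq)
    show "\<omega> (xs[i := X + Y]) = \<omega> (xs[i := X]) + \<omega> (xs[i := Y])"
      if "set xs \<subseteq> V" "i < length xs" "X \<in> V" "Y \<in> V" for xs i X Y
      using multiforms_add[OF c that] by (simp add: eq)
    show "\<omega> (xs[i := vf_scale f X]) = f * \<omega> (xs[i := X])"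
      if "set xs \<subseteq> V" "i < length xs" "X \<in> V" "f \<in> C" for xs i X f
      using multiforms_scale[OF c that] by (simp add: eq)
    show "\<omega> xs = 0" if "set xs \<subseteq> V" "i < j" "j < length xs" "xs ! i = xs ! j" for xs i j
      using multiforms_alternating[OF c that] by (simp add: eq)
  qed
  moreover obtain N where "\<forall>xs. length xs > N \<longrightarrow> \<omega> xs = 0"
    using w by (auto simp: forms_def)
  then have "bounded_degree (int N) \<omega>"
    by (simp add: vanishes_off_def)
  ultimately show "\<omega> \<in> {\<omega> \<in> multiforms. \<exists>N. bounded_degree N \<omega>}" by blast
next
  fix \<omega> assume "\<omega> \<in> {\<omega> \<in> multiforms. \<exists>N. bounded_degree N \<omega>}"
  then obtain N where mf: "\<omega> \<in> multiforms" and N: "bounded_degree N \<omega>" by blast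
  have "(\<lambda>xs. if length xs = k then \<omega> xs else 0) \<in> multiforms" for k
  proof (rule multiformsI)
      show "(if length xs = k then \<omega> xs else 0) \<in> C" for xs
        by (simp add: multiforms_C[OF mf])
      show "(if length xs = k then \<omega> xs else 0) = 0" if "\<not> set xs \<subseteq> V" for xs
        by (simp add: multiforms_outside[OF mf that])
      show "(if length (xs[i := X + Y]) = k then \<omega> (xs[i := X + Y]) else 0) =
          (if length (xs[i := X]) = k then \<omega> (xs[i := X]) else 0) +
          (if length (xs[i := Y]) = k then \<omega> (xs[i := Y]) else 0)"
        if "set xs \<subseteq> V" "i < length xs" "X \<in> V" "Y \<in> V" for xs i X Y
        using multiforms_add[OF mf that] by simp
      show "(if length (xs[i := vf_scale f X]) = k then \<omega> (xs[i := vf_scale f X]) else 0) =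
          f * (if length (xs[i := X]) = k then \<omega> (xs[i := X]) else 0)"
        if "set xs \<subseteq> V" "i < length xs" "X \<in> V" "f \<in> C" for xs i X f
        using multiforms_scale[OF mf that] by simp
      show "(if length xs = k then \<omega> xs else 0) = 0"
        if "set xs \<subseteq> V" "i < j" "j < length xs" "xs ! i = xs ! j" for xs i j
        using multiforms_alternating[OF mf that] by simp
  qed
  then have "(\<lambda>xs. if length xs = k then \<omega> xs else 0) \<in> kforms M k" for k
    by (auto simp: kforms_eq_dforms dforms_def vanishes_off_def)
  moreover have "\<forall>xs. length xs > nat N \<longrightarrow> \<omega> xs = 0"
    using N by (auto simp: vanishes_off_def)
  ultimately show "\<omega> \<in> \<Omega>"
    by (auto simp: forms_def)
qed

lemma forms_multiforms [simp]: "\<omega> \<in> \<Omega> \<Longrightarrow> \<omega> \<in> multiforms"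
  by (simp add: forms_eq)

lemma formsI: "\<omega> \<in> multiforms \<Longrightarrow> bounded_degree N \<omega> \<Longrightarrow> \<omega> \<in> \<Omega>"
  unfolding forms_eq by blast

lemma formsE:
  assumes "\<omega> \<in> \<Omega>" obtains N where "\<omega> \<in> multiforms" "bounded_degree N \<omega>"
  using assms unfolding forms_eq by blast

lemma bounded_degree_mono: "bounded_degree N \<omega> \<Longrightarrow> N \<le> N' \<Longrightarrow> bounded_degree N' \<omega>"
  by (auto simp: vanishes_off_def)

lemma dforms_forms: "\<omega> \<in> dforms p \<Longrightarrow> \<omega> \<in> \<Omega>"
  by (rule formsI[of _ p]) (simp_all add: dforms_def vanishes_off_def)

lemma zero_forms [simp]: "0 \<in> \<Omega>"
  by (rule formsI[of _ 0]) auto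

lemma add_forms [simp]: "\<alpha> \<in> \<Omega> \<Longrightarrow> \<beta> \<in> \<Omega> \<Longrightarrow> \<alpha> + \<beta> \<in> \<Omega>"
proof (elim formsE)
  fix p q assume "\<alpha> \<in> multiforms" "\<beta> \<in> multiforms" "bounded_degree p \<alpha>" "bounded_degree q \<beta>"
  then show ?thesis
    using bounded_degree_mono[of p \<alpha> "max p q"] bounded_degree_mono[of q \<beta> "max p q"]
    by (intro formsI[of _ "max p q"] vanishes_off_linear add_multiforms) auto
qed

lemma scaleR_forms [simp]: "\<alpha> \<in> \<Omega> \<Longrightarrow> c *\<^sub>R \<alpha> \<in> \<Omega>"
  by (elim formsE) (rule formsI, simp, rule vanishes_off_linear)

lemma minus_forms [simp]: "\<alpha> \<in> \<Omega> \<Longrightarrow> - \<alpha> \<in> \<Omega>"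
  by (elim formsE) (rule formsI, simp, rule vanishes_off_linear)

lemma diff_forms [simp]: "\<alpha> \<in> \<Omega> \<Longrightarrow> \<beta> \<in> \<Omega> \<Longrightarrow> \<alpha> - \<beta> \<in> \<Omega>"
  using add_forms[of \<alpha> "- \<beta>"] by simp

lemma sum_forms: "(\<And>i. i \<in> I \<Longrightarrow> f i \<in> \<Omega>) \<Longrightarrow> sum f I \<in> \<Omega>"
  by (induction I rule: infinite_finite_induct) auto

lemma parity_forms [simp]: "\<alpha> \<in> \<Omega> \<Longrightarrow> parity \<alpha> \<in> \<Omega>"
  by (elim formsE) (rule formsI, simp, rule vanishes_off_linear)

lemma wedge_forms [simp]: "\<alpha> \<in> \<Omega> \<Longrightarrow> \<beta> \<in> \<Omega> \<Longrightarrow> \<alpha> \<^bold>\<and> \<beta> \<in> \<Omega>"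
  by (elim formsE) (rule formsI, simp, rule bounded_degree_wedge)

lemma of_fun_forms [simp]: "f \<in> C \<Longrightarrow> of_fun f \<in> \<Omega>"
  by (rule formsI[of _ 0], simp) (simp add: vanishes_off_def of_fun_def)

lemma contract_forms [simp]: "\<alpha> \<in> \<Omega> \<Longrightarrow> contract Y \<alpha> \<in> \<Omega>"
  by (elim formsE) (rule formsI, simp, rule bounded_degree_contract)

lemma vanishes_off_lie:
  assumes "X \<in> V" "vanishes_off P \<omega>" shows "vanishes_off P (lie X \<omega>)"
  using assms by (simp add: vanishes_off_def lie_deriv_def V_0)

lemma vanishes_off_d:
  assumes "vanishes_off P \<omega>" shows "vanishes_off (\<lambda>n. P (n - 1)) (d \<omega>)"
proof -
  have "d \<omega> xs = 0" if "\<not> P (int (length xs) - 1)" for xs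
  proof (cases "set xs \<subseteq> V")
    case True
    have *: "\<omega> ys = 0" if "int (length ys) = int (length xs) - 1" for ys
      using assms that \<open>\<not> P _\<close> by (simp add: vanishes_off_def)
    have 1: "\<omega> (omit i xs) = 0" if "i < length xs" for i
      using that by (intro *) (simp add: length_omit of_nat_diff)
    have 2: "\<omega> (vf_bracket (xs ! i) (xs ! j) # omit i (omit j xs)) = 0" if "j < length xs" "i < j" for i j
      using that by (intro *) (simp add: length_omit of_nat_diff)
    have "(xs ! i) 0 = 0" if "i < length xs" for i
      using True that by (intro V_0) auto
    with 1 2 show ?thesis
      by (simp add: ext_d_def)
  qed (simp add: ext_d_def)
  then show ?thesis by (simp add: vanishes_off_def)
qed

lemma lie_forms [simp]: "\<omega> \<in> \<Omega> \<Longrightarrow> X \<in> V \<Longrightarrow> lie X \<omega> \<in> \<Omega>"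
  by (elim formsE) (rule formsI, simp, rule vanishes_off_lie)

lemma has_degree_d: "has_degree p \<omega> \<Longrightarrow> has_degree (p + 1) (d \<omega>)"
  by (drule vanishes_off_d) (simp add: vanishes_off_def)

lemma d_forms [simp]: "\<omega> \<in> \<Omega> \<Longrightarrow> d \<omega> \<in> \<Omega>"
proof (elim formsE)
  fix N assume "\<omega> \<in> multiforms" "bounded_degree N \<omega>"
  then show ?thesis
    by (intro formsI[of _ "N + 1"], simp) (drule vanishes_off_d, simp add: vanishes_off_def)
qed

lemma dforms_negD: "\<omega> \<in> dforms p \<Longrightarrow> p < 0 \<Longrightarrow> \<omega> = 0"
  unfolding dforms_def by (blast intro: has_degree_negD)

lemma
  assumes "\<alpha> \<in> dforms p"
  shows add_dforms: "\<beta> \<in> dforms p \<Longrightarrow> \<alpha> + \<beta> \<in> dforms p"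
    and diff_dforms: "\<beta> \<in> dforms p \<Longrightarrow> \<alpha> - \<beta> \<in> dforms p"
    and minus_dforms: "- \<alpha> \<in> dforms p"
    and scaleR_dforms: "c *\<^sub>R \<alpha> \<in> dforms p"
    and wedge_dforms: "\<beta> \<in> dforms q \<Longrightarrow> \<alpha> \<^bold>\<and> \<beta> \<in> dforms (p + q)"
  using assms by (simp_all add: dforms_def vanishes_off_linear has_degree_wedge)

lemma zero_dforms [simp]: "0 \<in> dforms p"
  by (simp add: dforms_def)

lemma dforms_0_iff: "\<omega> \<in> dforms 0 \<longleftrightarrow> (\<exists>f\<in>C. \<omega> = of_fun f)"
proof
  assume w: "\<omega> \<in> dforms 0"
  then have "\<omega> = of_fun (\<omega> [])"
    by (intro has_degree_0D) (simp add: dforms_def)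
  moreover have "\<omega> [] \<in> C"
    using w by (intro multiforms_C) (simp add: dforms_def)
  ultimately show "\<exists>f\<in>C. \<omega> = of_fun f" by blast
qed (auto simp: dforms_def has_degree_of_fun)

end

section \<open>Superfunctions and their derivations\<close>

lemma sfun_apply [simp]:
  fixes u v :: "'a sfun"
  shows "(u + v) \<epsilon> j = u \<epsilon> j + v \<epsilon> j" "(u - v) \<epsilon> j = u \<epsilon> j - v \<epsilon> j" "(- u) \<epsilon> j = - u \<epsilon> j"
    "(c *\<^sub>R u) \<epsilon> j = c *\<^sub>R u \<epsilon> j" "(0 :: 'a sfun) \<epsilon> j = 0"
  by (simp_all add: plus_fun_def fun_diff_def fun_Compl_def scaleR_fun_def zero_fun_def)

lemma sop_apply:
  fixes D E :: "'a sop"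
  shows "(D + E) u = D u + E u" "(D - E) u = D u - E u" "(- D) u = - D u"
    "(c *\<^sub>R D) u = c *\<^sub>R D u" "(0 :: 'a sop) u = 0"
  by (simp_all add: plus_fun_def fun_diff_def fun_Compl_def scaleR_fun_def zero_fun_def)

lemma sg_mult: "sg (k + l) = sg k * sg l"
  by (simp add: sg_def)

lemma sg_square [simp]: "sg k * sg k = 1"
  by (simp add: sg_def)

context smooth_mfd
begin

abbreviation SF where "SF \<equiv> superfunctions M"

text \<open>Graded derivations of the algebra of forms. The Leibniz rule and the rule for
  \<open>parity\<close> are stated for inhomogeneous forms, so that the coefficients of a
  superfunction can be treated without splitting them into components.\<close>

definition fder :: "int \<Rightarrow> ('a form \<Rightarrow> 'a form) set"
  where "fder k = {T.
    (\<forall>\<alpha>\<in>\<Omega>. T \<alpha> \<in> \<Omega>) \<and>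
    (\<forall>\<alpha>\<in>\<Omega>. \<forall>\<beta>\<in>\<Omega>. \<forall>c. T (c *\<^sub>R \<alpha> + \<beta>) = c *\<^sub>R T \<alpha> + T \<beta>) \<and>
    (\<forall>\<alpha>\<in>\<Omega>. \<forall>\<beta>\<in>\<Omega>. T (\<alpha> \<^bold>\<and> \<beta>) = T \<alpha> \<^bold>\<and> \<beta> + par k \<alpha> \<^bold>\<and> T \<beta>) \<and>
    (\<forall>\<alpha>\<in>\<Omega>. T (parity \<alpha>) = sg k *\<^sub>R parity (T \<alpha>)) \<and>
    (\<forall>p. \<forall>\<alpha>\<in>dforms p. T \<alpha> \<in> dforms (p + k))}"

lemma
  assumes T: "T \<in> fder k"
  shows fder_forms: "\<alpha> \<in> \<Omega> \<Longrightarrow> T \<alpha> \<in> \<Omega>"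
    and fder_lincomb: "\<alpha> \<in> \<Omega> \<Longrightarrow> \<beta> \<in> \<Omega> \<Longrightarrow> T (c *\<^sub>R \<alpha> + \<beta>) = c *\<^sub>R T \<alpha> + T \<beta>"
    and fder_wedge: "\<alpha> \<in> \<Omega> \<Longrightarrow> \<beta> \<in> \<Omega> \<Longrightarrow> T (\<alpha> \<^bold>\<and> \<beta>) = T \<alpha> \<^bold>\<and> \<beta> + par k \<alpha> \<^bold>\<and> T \<beta>"
    and fder_parity: "\<alpha> \<in> \<Omega> \<Longrightarrow> T (parity \<alpha>) = sg k *\<^sub>R parity (T \<alpha>)"
    and fder_dforms: "\<alpha> \<in> dforms p \<Longrightarrow> T \<alpha> \<in> dforms (p + k)"
  using T unfolding fder_def by blast+

lemma
  assumes T: "T \<in> fder k"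
  shows fder_0: "T 0 = 0"
    and fder_add: "\<alpha> \<in> \<Omega> \<Longrightarrow> \<beta> \<in> \<Omega> \<Longrightarrow> T (\<alpha> + \<beta>) = T \<alpha> + T \<beta>"
    and fder_scaleR: "\<alpha> \<in> \<Omega> \<Longrightarrow> T (c *\<^sub>R \<alpha>) = c *\<^sub>R T \<alpha>"
    and fder_minus: "\<alpha> \<in> \<Omega> \<Longrightarrow> T (- \<alpha>) = - T \<alpha>"
    and fder_diff: "\<alpha> \<in> \<Omega> \<Longrightarrow> \<beta> \<in> \<Omega> \<Longrightarrow> T (\<alpha> - \<beta>) = T \<alpha> - T \<beta>"
proof -
  show 0: "T 0 = 0"
    using fder_lincomb[OF T zero_forms zero_forms, of "-1"] by simp
  show "\<alpha> \<in> \<Omega> \<Longrightarrow> \<beta> \<in> \<Omega> \<Longrightarrow> T (\<alpha> + \<beta>) = T \<alpha> + T \<beta>"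
    using fder_lincomb[OF T, of \<alpha> \<beta> 1] by simp
  show "\<alpha> \<in> \<Omega> \<Longrightarrow> T (c *\<^sub>R \<alpha>) = c *\<^sub>R T \<alpha>"
    using fder_lincomb[OF T _ zero_forms, of \<alpha> c] 0 by simp
  show "\<alpha> \<in> \<Omega> \<Longrightarrow> T (- \<alpha>) = - T \<alpha>"
    using fder_lincomb[OF T _ zero_forms, of \<alpha> "-1"] 0 by simp
  show "\<alpha> \<in> \<Omega> \<Longrightarrow> \<beta> \<in> \<Omega> \<Longrightarrow> T (\<alpha> - \<beta>) = T \<alpha> - T \<beta>"
    using fder_lincomb[OF T, of \<beta> \<alpha> "-1"] by simp
qed

lemma fder_sum:
  assumes T: "T \<in> fder k" and "\<And>i. i \<in> I \<Longrightarrow> f i \<in> \<Omega>"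
  shows "T (sum f I) = (\<Sum>i\<in>I. T (f i))"
  using assms(2)
proof (induction I rule: infinite_finite_induct)
  case (insert i I)
  then have "T (f i + sum f I) = T (f i) + T (sum f I)"
    by (intro fder_add[OF T] sum_forms) auto
  with insert show ?case by simp
qed (simp_all add: fder_0[OF T])

lemma fderI:
  assumes "\<And>\<alpha>. \<alpha> \<in> \<Omega> \<Longrightarrow> T \<alpha> \<in> \<Omega>"
    "\<And>\<alpha> \<beta> c. \<alpha> \<in> \<Omega> \<Longrightarrow> \<beta> \<in> \<Omega> \<Longrightarrow> T (c *\<^sub>R \<alpha> + \<beta>) = c *\<^sub>R T \<alpha> + T \<beta>"
    "\<And>\<alpha> \<beta>. \<alpha> \<in> \<Omega> \<Longrightarrow> \<beta> \<in> \<Omega> \<Longrightarrow> T (\<alpha> \<^bold>\<and> \<beta>) = T \<alpha> \<^bold>\<and> \<beta> + par k \<alpha> \<^bold>\<and> T \<beta>"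
    "\<And>\<alpha>. \<alpha> \<in> \<Omega> \<Longrightarrow> T (parity \<alpha>) = sg k *\<^sub>R parity (T \<alpha>)"
    "\<And>\<alpha> p. \<alpha> \<in> dforms p \<Longrightarrow> T \<alpha> \<in> dforms (p + k)"
  shows "T \<in> fder k"
  using assms unfolding fder_def by blast

lemma lie_fder: "X \<in> V \<Longrightarrow> lie X \<in> fder 0"
  by (rule fderI) (simp_all add: lie_lincomb lie_wedge lie_parity par_def sg_def dforms_def vanishes_off_lie)

lemma contract_fder: "contract Y \<in> fder (-1)"
  by (rule fderI) (simp_all add: contract_wedge par_def sg_def dforms_def has_degree_contract)

lemma d_fder: "d \<in> fder 1"
  by (rule fderI) (simp_all add: d_lincomb d_wedge d_parity par_def sg_def dforms_def has_degree_d)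

lemma zero_fder: "(\<lambda>_. 0) \<in> fder k"
  by (rule fderI) simp_all

lemma lincomb_fder:
  assumes T: "T \<in> fder k" and T': "T' \<in> fder k"
  shows "(\<lambda>\<alpha>. c *\<^sub>R T \<alpha> + T' \<alpha>) \<in> fder k"
proof (rule fderI)
  show "c *\<^sub>R T \<alpha> + T' \<alpha> \<in> dforms (p + k)" if "\<alpha> \<in> dforms p" for \<alpha> p
    by (intro add_dforms scaleR_dforms fder_dforms[OF T that] fder_dforms[OF T' that])
qed (simp_all add: fder_forms[OF T] fder_forms[OF T'] fder_add[OF T] fder_add[OF T'] fder_scaleR[OF T] fder_scaleR[OF T']
       fder_wedge[OF T] fder_wedge[OF T'] fder_parity[OF T] fder_parity[OF T'] wedge_linear algebra_simps)

lemma commutator_fder: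
  assumes T: "T \<in> fder k" and T': "T' \<in> fder l"
  shows "(\<lambda>\<alpha>. T (T' \<alpha>) - sg (k * l) *\<^sub>R T' (T \<alpha>)) \<in> fder (k + l)"
proof (rule fderI)
  note [simp] = fder_forms[OF T] fder_forms[OF T']
  fix \<alpha> \<beta> :: "'a form"
  assume [simp]: "\<alpha> \<in> \<Omega>"
  show "T (T' \<alpha>) - sg (k * l) *\<^sub>R T' (T \<alpha>) \<in> \<Omega>" by simp
  show "T (T' (parity \<alpha>)) - sg (k * l) *\<^sub>R T' (T (parity \<alpha>)) = sg (k + l) *\<^sub>R parity (T (T' \<alpha>) - sg (k * l) *\<^sub>R T' (T \<alpha>))"
    by (simp add: fder_parity[OF T] fder_parity[OF T'] fder_scaleR[OF T] fder_scaleR[OF T'] sg_mult algebra_simps)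
  assume [simp]: "\<beta> \<in> \<Omega>"
  show "T (T' (c *\<^sub>R \<alpha> + \<beta>)) - sg (k * l) *\<^sub>R T' (T (c *\<^sub>R \<alpha> + \<beta>)) =
      c *\<^sub>R (T (T' \<alpha>) - sg (k * l) *\<^sub>R T' (T \<alpha>)) + (T (T' \<beta>) - sg (k * l) *\<^sub>R T' (T \<beta>))" for c
    by (simp add: fder_add[OF T] fder_add[OF T'] fder_scaleR[OF T] fder_scaleR[OF T'] algebra_simps)
  show "T (T' (\<alpha> \<^bold>\<and> \<beta>)) - sg (k * l) *\<^sub>R T' (T (\<alpha> \<^bold>\<and> \<beta>)) =
      (T (T' \<alpha>) - sg (k * l) *\<^sub>R T' (T \<alpha>)) \<^bold>\<and> \<beta> + par (k + l) \<alpha> \<^bold>\<and> (T (T' \<beta>) - sg (k * l) *\<^sub>R T' (T \<beta>))"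
    by (cases "even k"; cases "even l")
       (simp_all add: fder_wedge[OF T] fder_wedge[OF T'] fder_add[OF T] fder_add[OF T'] par_def sg_def
          fder_parity[OF T] fder_parity[OF T'] wedge_linear algebra_simps)
next
  fix \<alpha> p assume "\<alpha> \<in> dforms p"
  then have "T (T' \<alpha>) \<in> dforms (p + l + k)" "T' (T \<alpha>) \<in> dforms (p + k + l)"
    by (simp_all only: fder_dforms[OF T] fder_dforms[OF T'])
  then show "T (T' \<alpha>) - sg (k * l) *\<^sub>R T' (T \<alpha>) \<in> dforms (p + (k + l))"
    by (intro diff_dforms scaleR_dforms) (simp_all add: ac_simps)
qed

lemma SF_forms: "u \<in> SF \<Longrightarrow> u \<epsilon> j \<in> \<Omega>"
  unfolding superfunctions_def by blast

lemma SF_bound: "u \<in> SF \<Longrightarrow> \<exists>N. \<forall>\<epsilon> j. j > N \<longrightarrow> u \<epsilon> j = 0"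
  unfolding superfunctions_def by blast

lemma SFI: "(\<And>\<epsilon> j. u \<epsilon> j \<in> \<Omega>) \<Longrightarrow> (\<And>\<epsilon> j. j > N \<Longrightarrow> u \<epsilon> j = 0) \<Longrightarrow> u \<in> SF"
  unfolding superfunctions_def by blast

lemma SF_lincomb:
  assumes u: "u \<in> SF" and v: "v \<in> SF" shows "c *\<^sub>R u + v \<in> SF"
proof -
  from SF_bound[OF u] SF_bound[OF v] obtain N N' where
    "\<And>\<epsilon> j. j > N \<Longrightarrow> u \<epsilon> j = 0" "\<And>\<epsilon> j. j > N' \<Longrightarrow> v \<epsilon> j = 0" by blast
  then show ?thesis
    by (intro SFI[of _ "max N N'"]) (simp_all add: SF_forms[OF u] SF_forms[OF v])
qed

lemma SF_0 [simp]: "0 \<in> SF"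
  by (rule SFI[of _ 0]) simp_all

text \<open>\<open>Op T a b c\<close> is \<open>T + a \<partial>\<^sub>q + (b + q c) \<partial>\<^sub>t\<close>, written in components.\<close>

definition Op :: "('a form \<Rightarrow> 'a form) \<Rightarrow> 'a form \<Rightarrow> 'a form \<Rightarrow> 'a form \<Rightarrow> 'a sop"
  where "Op T a b c = on_superfunctions M (\<lambda>u \<epsilon> j.
    if \<epsilon> then T (u True j) + real (Suc j) *\<^sub>R (b \<^bold>\<and> u True (Suc j) + parity c \<^bold>\<and> parity (u False (Suc j)))
    else T (u False j) + a \<^bold>\<and> parity (u True j) + real (Suc j) *\<^sub>R (b \<^bold>\<and> u False (Suc j)))"

lemma Op_outside: "u \<notin> SF \<Longrightarrow> Op T a b c u = 0"
  by (simp add: Op_def on_superfunctions_def)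

lemma Op_False: "u \<in> SF \<Longrightarrow>
    Op T a b c u False j = T (u False j) + a \<^bold>\<and> parity (u True j) + real (Suc j) *\<^sub>R (b \<^bold>\<and> u False (Suc j))"
  by (simp add: Op_def on_superfunctions_def)

lemma Op_True: "u \<in> SF \<Longrightarrow>
    Op T a b c u True j = T (u True j) + real (Suc j) *\<^sub>R (b \<^bold>\<and> u True (Suc j) + parity c \<^bold>\<and> parity (u False (Suc j)))"
  by (simp add: Op_def on_superfunctions_def)

lemma Op_eqI:
  assumes "\<And>u. u \<notin> SF \<Longrightarrow> D u = 0"
    and "\<And>u j. u \<in> SF \<Longrightarrow> D u False j = Op T a b c u False j"
    and "\<And>u j. u \<in> SF \<Longrightarrow> D u True j = Op T a b c u True j"
  shows "D = Op T a b c"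
proof (rule ext, rule ext, rule ext)
  fix u \<epsilon> j show "D u \<epsilon> j = Op T a b c u \<epsilon> j"
    using assms by (cases "u \<in> SF"; cases \<epsilon>) (simp_all add: Op_outside)
qed

lemma Op_SF:
  assumes T: "T \<in> fder k" and abc: "a \<in> \<Omega>" "b \<in> \<Omega>" "c \<in> \<Omega>"
  shows "Op T a b c u \<in> SF"
proof (cases "u \<in> SF")
  case True
  from SF_bound[OF this] obtain N where N: "\<And>\<epsilon> j. j > N \<Longrightarrow> u \<epsilon> j = 0" by blast
  show ?thesis
  proof (rule SFI[of _ N])
    fix \<epsilon> j
    show "Op T a b c u \<epsilon> j \<in> \<Omega>"
      using abc by (cases \<epsilon>) (simp_all add: Op_True[OF True] Op_False[OF True] SF_forms[OF True] fder_forms[OF T])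
    show "Op T a b c u \<epsilon> j = 0" if "j > N"
      using that by (cases \<epsilon>) (simp_all add: Op_True[OF True] Op_False[OF True] N fder_0[OF T])
  qed
qed (simp add: Op_outside)

text \<open>The identities of the graded commutator, including Jacobi, rest on composition and
  linearity alone; this is the class of operators for which they are proved.\<close>

definition linops :: "'a sop set"
  where "linops = {D. (\<forall>u. u \<notin> SF \<longrightarrow> D u = 0) \<and> (\<forall>u\<in>SF. D u \<in> SF) \<and>
    (\<forall>u\<in>SF. \<forall>v\<in>SF. \<forall>c. D (c *\<^sub>R u + v) = c *\<^sub>R D u + D v)}"

lemma
  assumes D: "D \<in> linops"
  shows linops_outside: "u \<notin> SF \<Longrightarrow> D u = 0"
    and linops_SF: "D u \<in> SF"
    and linops_lincomb: "u \<in> SF \<Longrightarrow> v \<in> SF \<Longrightarrow> D (c *\<^sub>R u + v) = c *\<^sub>R D u + D v"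
    and linops_0: "D 0 = 0"
proof -
  show out: "u \<notin> SF \<Longrightarrow> D u = 0" for u
    using D unfolding linops_def by blast
  show "D u \<in> SF"
  proof (cases "u \<in> SF")
    case True
    with D show ?thesis unfolding linops_def by blast
  qed (simp add: out)
  show lin: "u \<in> SF \<Longrightarrow> v \<in> SF \<Longrightarrow> D (c *\<^sub>R u + v) = c *\<^sub>R D u + D v" for u v c
    using D unfolding linops_def by blast
  show "D 0 = 0"
    using lin[OF SF_0 SF_0, of "-1"] by simp
qed

lemma Op_linops:
  assumes T: "T \<in> fder k" and abc: "a \<in> \<Omega>" "b \<in> \<Omega>" "c \<in> \<Omega>"
  shows "Op T a b c \<in> linops"
proof -
  have "Op T a b c (r *\<^sub>R u + v) = r *\<^sub>R Op T a b c u + Op T a b c v" if u: "u \<in> SF" and v: "v \<in> SF" for r u v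
  proof (rule ext, rule ext)
    fix \<epsilon> j
    show "Op T a b c (r *\<^sub>R u + v) \<epsilon> j = (r *\<^sub>R Op T a b c u + Op T a b c v) \<epsilon> j"
      by (cases \<epsilon>) (simp_all add: Op_True[OF SF_lincomb[OF u v]] Op_False[OF SF_lincomb[OF u v]]
        Op_True[OF u] Op_False[OF u] Op_True[OF v] Op_False[OF v] fder_add[OF T] fder_scaleR[OF T] SF_forms[OF u] SF_forms[OF v]
        wedge_linear del: of_nat_Suc, simp_all add: algebra_simps)
  qed
  then show ?thesis
    unfolding linops_def using Op_SF[OF assms] Op_outside by blast
qed

lemma dforms_degree: "\<omega> \<in> dforms p \<Longrightarrow> has_degree p \<omega>"
  by (simp add: dforms_def)

text \<open>The coefficients of the commutator are the values of the bracket on the generators \<open>q\<close> and \<open>t\<close>;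
  all second order terms cancel by graded commutativity.\<close>

lemma Op_commutator:
  assumes T: "T \<in> fder k" and T': "T' \<in> fder l"
    and a: "a \<in> dforms (k + 1)" and b: "b \<in> dforms (k + 2)" and c: "c \<in> dforms (k + 1)"
    and a': "a' \<in> dforms (l + 1)" and b': "b' \<in> dforms (l + 2)" and c': "c' \<in> dforms (l + 1)"
  shows "graded_commutator k l (Op T a b c) (Op T' a' b' c') =
    Op (\<lambda>\<omega>. T (T' \<omega>) - sg (k * l) *\<^sub>R T' (T \<omega>))
       (T a' - sg (k * l) *\<^sub>R T' a)
       (T b' + a \<^bold>\<and> c' - sg (k * l) *\<^sub>R (T' b + a' \<^bold>\<and> c))
       (sg k *\<^sub>R T c' - sg (k * l + l) *\<^sub>R T' c)" (is "_ = Op ?T ?a ?b ?c")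
proof -
  note [simp] = a[THEN dforms_forms] b[THEN dforms_forms] c[THEN dforms_forms]
    a'[THEN dforms_forms] b'[THEN dforms_forms] c'[THEN dforms_forms] fder_forms[OF T] fder_forms[OF T']
  note deg = a[THEN dforms_degree] b[THEN dforms_degree] c[THEN dforms_degree]
  note deg' = a'[THEN dforms_degree] b'[THEN dforms_degree] c'[THEN dforms_degree]
  note parities = deg[THEN parity_has_degree] deg'[THEN parity_has_degree]
    fder_dforms[OF T c', THEN dforms_degree, THEN parity_has_degree]
    fder_dforms[OF T' c, THEN dforms_degree, THEN parity_has_degree]
  note swaps = wedge_swap[OF deg'(1) deg(1)] wedge_swap[OF deg'(1) deg(2)] wedge_swap[OF deg'(1) deg(3)]
    wedge_swap[OF deg'(2) deg(1)] wedge_swap[OF deg'(2) deg(2)] wedge_swap[OF deg'(2) deg(3)]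
    wedge_swap[OF deg'(3) deg(1)] wedge_swap[OF deg'(3) deg(2)] wedge_swap[OF deg'(3) deg(3)]
  note T_simps = fder_wedge[OF T] fder_wedge[OF T'] fder_add[OF T] fder_add[OF T']
    fder_scaleR[OF T] fder_scaleR[OF T'] fder_parity[OF T] fder_parity[OF T'] fder_minus[OF T] fder_minus[OF T'] fder_diff[OF T] fder_diff[OF T']
  show ?thesis
  proof (rule Op_eqI)
    fix u assume "u \<notin> SF"
    then show "graded_commutator k l (Op T a b c) (Op T' a' b' c') u = 0"
      by (simp add: graded_commutator_def Op_outside linops_0[OF Op_linops[OF T]] linops_0[OF Op_linops[OF T']])
  next
    fix u j assume u: "u \<in> SF"
    note [simp] = SF_forms[OF u]
    have D: "Op T a b c u \<in> SF" "Op T' a' b' c' u \<in> SF"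
      by (simp_all add: Op_SF[OF T] Op_SF[OF T'])
    note eval = Op_True[OF u] Op_False[OF u] Op_True[OF D(1)] Op_False[OF D(1)] Op_True[OF D(2)] Op_False[OF D(2)]
    \<comment> \<open>The factors from differentiating powers of t are kept opaque. The second order
      terms carry the same product of s and s' in both orders of composition, which is what lets
      them cancel.\<close>
    define s s' where ss: "s = real (Suc j)" "s' = real (Suc (Suc j))"
    show "graded_commutator k l (Op T a b c) (Op T' a' b' c') u False j = Op ?T ?a ?b ?c u False j"
      unfolding graded_commutator_def sfun_apply eval powi_minus_one ss[symmetric]
      by (cases "even k"; cases "even l")
         (simp_all add: T_simps par_def sg_def parity_wedge parities wedge_linear wedge_assoc swaps scaleR_add_right scaleR_diff_right,
          (simp_all add: algebra_simps)?)
    show "graded_commutator k l (Op T a b c) (Op T' a' b' c') u True j = Op ?T ?a ?b ?c u True j"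
      unfolding graded_commutator_def sfun_apply eval powi_minus_one ss[symmetric]
      by (cases "even k"; cases "even l")
         (simp_all add: T_simps par_def sg_def parity_wedge parities wedge_linear wedge_assoc swaps scaleR_add_right scaleR_diff_right,
          (simp_all add: algebra_simps)?)
  qed
qed

end

section \<open>The product of superfunctions and the graded Leibniz rule\<close>

lemma smult_False: "(u \<odot> v) False j = (\<Sum>i\<le>j. u False i \<^bold>\<and> v False (j - i))"
  by (simp add: smult_def)

lemma smult_True:
  "(u \<odot> v) True j = (\<Sum>i\<le>j. u False i \<^bold>\<and> v True (j - i) + u True i \<^bold>\<and> parity (v False (j - i)))"
  by (simp add: smult_def)

lemma sum_atMost_single: "(\<And>i. i \<noteq> 0 \<Longrightarrow> g i = 0) \<Longrightarrow> (\<Sum>i\<le>(j::nat). g i) = g 0"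
  by (subst sum.mono_neutral_right[of _ "{0}"]) auto

lemma of_form_smult: "(of_form a \<odot> v) \<epsilon> j = a \<^bold>\<and> v \<epsilon> j"
  by (cases \<epsilon>) (simp_all add: smult_True smult_False of_form_def sum_atMost_single)

text \<open>The product rule for the t-derivative of a Cauchy product: the factor j + 1 is split as
  i + (j + 1 - i), and each half is reindexed.\<close>

lemma sum_leibniz:
  fixes g :: "nat \<Rightarrow> nat \<Rightarrow> 'v::real_vector"
  shows "real (Suc j) *\<^sub>R (\<Sum>i\<le>Suc j. g i (Suc j - i)) =
    (\<Sum>i\<le>j. real (Suc i) *\<^sub>R g (Suc i) (j - i) + real (Suc (j - i)) *\<^sub>R g i (Suc (j - i)))"
proof -
  have "real (Suc j) *\<^sub>R (\<Sum>i\<le>Suc j. g i (Suc j - i)) =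
      (\<Sum>i\<le>Suc j. real i *\<^sub>R g i (Suc j - i) + real (Suc j - i) *\<^sub>R g i (Suc j - i))"
    unfolding scaleR_sum_right
    by (intro sum.cong refl) (simp add: of_nat_diff flip: scaleR_add_left)
  also have "\<dots> = (\<Sum>i\<le>Suc j. real i *\<^sub>R g i (Suc j - i)) + (\<Sum>i\<le>Suc j. real (Suc j - i) *\<^sub>R g i (Suc j - i))"
    by (rule sum.distrib)
  also have "(\<Sum>i\<le>Suc j. real i *\<^sub>R g i (Suc j - i)) = (\<Sum>i\<le>j. real (Suc i) *\<^sub>R g (Suc i) (j - i))"
    by (subst sum.atMost_Suc_shift) simp
  also have "(\<Sum>i\<le>Suc j. real (Suc j - i) *\<^sub>R g i (Suc j - i)) = (\<Sum>i\<le>j. real (Suc (j - i)) *\<^sub>R g i (Suc (j - i)))"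
    by (simp add: Suc_diff_le add_diff_eq)
  finally show ?thesis by (simp only: sum.distrib)
qed

context smooth_mfd
begin

lemma q_of_form: "c \<in> \<Omega> \<Longrightarrow> (q_var M \<odot> of_form c) = (\<lambda>\<epsilon> j. if \<epsilon> \<and> j = 0 then parity c else 0)"
  by (rule ext, rule ext)
     (auto simp: smult_def sum_atMost_single q_var_def of_form_def of_fun_one_wedge)

text \<open>The signs in \<open>Op\<close> come from moving q to the right: q c =
  \<open>parity c\<close> q, and q then passes the coefficient of the argument as well. Likewise the
  q-derivative acts from the left and first passes the form in front of q.\<close>

lemma Op_eq:
  assumes "a \<in> \<Omega>" "b \<in> \<Omega>" "c \<in> \<Omega>"
  shows "on_superfunctions M (\<lambda>u \<epsilon> j. T (u \<epsilon> j)) + of_form a \<cdot> D_q M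
    + (of_form b + q_var M \<odot> of_form c) \<cdot> D_t M = Op T a b c" (is "?D = _")
proof (rule Op_eqI)
  let ?G = "of_form b + q_var M \<odot> of_form c"
  have G_eq: "?G = (\<lambda>\<epsilon> j. if j = 0 then if \<epsilon> then parity c else b else 0)"
    by (rule ext, rule ext, simp only: sfun_apply q_of_form[OF assms(3)]) (simp add: of_form_def)
  have G: "(?G \<odot> v) False j = b \<^bold>\<and> v False j"
    "(?G \<odot> v) True j = b \<^bold>\<and> v True j + parity c \<^bold>\<and> parity (v False j)" for v j
    unfolding G_eq by (simp_all add: smult_True smult_False sum_atMost_single)
  have zero: "of_form a \<odot> 0 = 0" "?G \<odot> 0 = 0"
  proof -
    show "of_form a \<odot> 0 = 0"
      by (rule ext, rule ext) (simp add: of_form_smult)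
    show "?G \<odot> 0 = 0"
    proof (rule ext, rule ext)
      show "(?G \<odot> 0) \<epsilon> j = 0 \<epsilon> j" for \<epsilon> j
        by (cases \<epsilon>) (simp_all only: G sfun_apply wedge_0_right parity_linear add_0)
    qed
  qed
  fix u
  show "u \<notin> SF \<Longrightarrow> ?D u = 0"
    by (simp only: sop_apply lmult_def D_q_def D_t_def on_superfunctions_def if_False zero add_0)
  fix j assume u: "u \<in> SF"
  show "?D u False j = Op T a b c u False j" "?D u True j = Op T a b c u True j"
    using u by (simp_all add: sop_apply lmult_def D_q_def D_t_def on_superfunctions_def of_form_smult G
        Op_False Op_True wedge_scaleR_right scaleR_add_right del: of_nat_Suc)
qed

lemma smult_SF:
  assumes u: "u \<in> SF" and v: "v \<in> SF"
  shows "u \<odot> v \<in> SF"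
proof -
  from SF_bound[OF u] SF_bound[OF v] obtain N N' where
    N: "\<And>\<epsilon> j. j > N \<Longrightarrow> u \<epsilon> j = 0" "\<And>\<epsilon> j. j > N' \<Longrightarrow> v \<epsilon> j = 0" by blast
  show ?thesis
  proof (rule SFI[of _ "N + N'"])
    fix \<epsilon> j
    show "(u \<odot> v) \<epsilon> j \<in> \<Omega>"
      by (cases \<epsilon>) (auto simp: smult_True smult_False SF_forms[OF u] SF_forms[OF v] intro!: sum_forms)
    assume j: "j > N + N'"
    have "u \<epsilon> i = 0 \<or> v \<epsilon>' (j - i) = 0" for i \<epsilon> \<epsilon>'
      using N(1)[of i] N(2)[of "j - i"] j by (cases "i > N") auto
    then have "u \<epsilon> i \<^bold>\<and> v \<epsilon>' (j - i) = 0" "u \<epsilon> i \<^bold>\<and> parity (v \<epsilon>' (j - i)) = 0" for i \<epsilon> \<epsilon>'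
      by (metis wedge_0_left wedge_0_right parity_linear(1))+
    then show "(u \<odot> v) \<epsilon> j = 0"
      by (cases \<epsilon>) (simp_all add: smult_True smult_False)
  qed
qed

lemma homogeneous_iff:
  "u \<in> homogeneous M n \<longleftrightarrow> u \<in> SF \<and> (\<forall>\<epsilon> j. u \<epsilon> j \<in> dforms (n - of_bool \<epsilon> - 2 * int j))"
proof -
  have "int (length xs) + of_bool \<epsilon> + 2 * int j \<noteq> n \<longleftrightarrow> int (length xs) \<noteq> n - of_bool \<epsilon> - 2 * int j" for xs :: "'a vfield list" and \<epsilon> j
    by auto
  then show ?thesis
    unfolding homogeneous_def dforms_def vanishes_off_def using SF_forms forms_multiforms by blast
qed

lemma parity_dforms: "\<alpha> \<in> dforms p \<Longrightarrow> parity \<alpha> \<in> dforms p"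
  by (simp add: dforms_def vanishes_off_linear)

lemma Op_homogeneous:
  assumes T: "T \<in> fder k"
    and a: "a \<in> dforms (k + 1)" and b: "b \<in> dforms (k + 2)" and c: "c \<in> dforms (k + 1)"
    and u: "u \<in> homogeneous M n"
  shows "Op T a b c u \<in> homogeneous M (n + k)"
  unfolding homogeneous_iff
proof (intro conjI allI)
  from u have SF: "u \<in> SF" and deg: "\<And>\<epsilon> j. u \<epsilon> j \<in> dforms (n - of_bool \<epsilon> - 2 * int j)"
    by (simp_all add: homogeneous_iff)
  show "Op T a b c u \<in> SF"
    by (intro Op_SF[OF T] a[THEN dforms_forms] b[THEN dforms_forms] c[THEN dforms_forms])
  fix \<epsilon> j
  show "Op T a b c u \<epsilon> j \<in> dforms (n + k - of_bool \<epsilon> - 2 * int j)"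
  proof (cases \<epsilon>)
    case True
    have "T (u True j) \<in> dforms (n + k - 1 - 2 * int j)"
      using fder_dforms[OF T deg[of True j]] by (simp add: algebra_simps)
    moreover have "b \<^bold>\<and> u True (Suc j) \<in> dforms (n + k - 1 - 2 * int j)"
      using wedge_dforms[OF b deg[of True "Suc j"]] by (simp add: algebra_simps)
    moreover have "parity c \<^bold>\<and> parity (u False (Suc j)) \<in> dforms (n + k - 1 - 2 * int j)"
      using wedge_dforms[OF parity_dforms[OF c] parity_dforms[OF deg[of False "Suc j"]]] by (simp add: algebra_simps)
    ultimately show ?thesis
      using True by (simp add: Op_True[OF SF] add_dforms scaleR_dforms del: of_nat_Suc)
  next
    case False
    have "T (u False j) \<in> dforms (n + k - 2 * int j)"
      using fder_dforms[OF T deg[of False j]] by (simp add: algebra_simps)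
    moreover have "b \<^bold>\<and> u False (Suc j) \<in> dforms (n + k - 2 * int j)"
      using wedge_dforms[OF b deg[of False "Suc j"]] by (simp add: algebra_simps)
    moreover have "a \<^bold>\<and> parity (u True j) \<in> dforms (n + k - 2 * int j)"
      using wedge_dforms[OF a parity_dforms[OF deg[of True j]]] by (simp add: algebra_simps)
    ultimately show ?thesis
      using False by (simp add: Op_False[OF SF] add_dforms scaleR_dforms del: of_nat_Suc)
  qed
qed

text \<open>Both sides are compared coefficientwise. Once \<open>sum_leibniz\<close> has distributed
  the t-derivative, the identity holds summand by summand: T is a derivation, and moving a, b, c
  past the coefficients of u gives the sign (-1)^(k n).\<close>

lemma Op_smult:
  assumes T: "T \<in> fder k"
    and a: "a \<in> dforms (k + 1)" and b: "b \<in> dforms (k + 2)" and c: "c \<in> dforms (k + 1)"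
    and u: "u \<in> homogeneous M n" and v: "v \<in> SF"
  shows "Op T a b c (u \<odot> v) = Op T a b c u \<odot> v + sg (k * n) *\<^sub>R (u \<odot> Op T a b c v)"
proof (rule ext, rule ext)
  from u have uSF: "u \<in> SF" and deg: "\<And>\<epsilon> j. has_degree (n - of_bool \<epsilon> - 2 * int j) (u \<epsilon> j)"
    by (simp_all add: homogeneous_iff dforms_degree)
  note [simp] = a[THEN dforms_forms] b[THEN dforms_forms] c[THEN dforms_forms] fder_forms[OF T]
    SF_forms[OF uSF] SF_forms[OF v]
  note degs = a[THEN dforms_degree] b[THEN dforms_degree] c[THEN dforms_degree]
  note parities = degs[THEN parity_has_degree] deg[THEN parity_has_degree]
  note swaps = wedge_swap[OF deg degs(1)] wedge_swap[OF deg degs(2)] wedge_swap[OF deg degs(3)]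
  note eval = Op_False[OF uSF] Op_True[OF uSF] Op_False[OF v] Op_True[OF v]
  fix \<epsilon> j
  show "Op T a b c (u \<odot> v) \<epsilon> j = (Op T a b c u \<odot> v + sg (k * n) *\<^sub>R (u \<odot> Op T a b c v)) \<epsilon> j"
  proof (cases \<epsilon>)
    case False
    \<comment> \<open>The summand is written with two independent indices, as
      \<open>sum_leibniz\<close> asks, so that the powers of t in u and in v are differentiated
      separately.\<close>
    let ?g = "\<lambda>i m. b \<^bold>\<and> (u False i \<^bold>\<and> v False m)"
    have "Op T a b c (u \<odot> v) False j = (\<Sum>i\<le>j. T (u False i \<^bold>\<and> v False (j - i)))
        + (\<Sum>i\<le>j. a \<^bold>\<and> parity (u False i \<^bold>\<and> v True (j - i) + u True i \<^bold>\<and> parity (v False (j - i))))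
        + real (Suc j) *\<^sub>R (\<Sum>i\<le>Suc j. ?g i (Suc j - i))"
      unfolding Op_False[OF smult_SF[OF uSF v]] smult_False smult_True
      by (simp add: fder_sum[OF T] wedge_sum_right parity_sum del: of_nat_Suc sum.atMost_Suc)
    also have "\<dots> = (Op T a b c u \<odot> v + sg (k * n) *\<^sub>R (u \<odot> Op T a b c v)) False j"
      unfolding sum_leibniz[of j ?g]
      unfolding sum.distrib[symmetric] smult_False sfun_apply scaleR_sum_right eval
    proof (intro sum.cong refl)
      fix i
      define r s where rs: "r = real (Suc i)" "s = real (Suc (j - i))"
      show "T (u False i \<^bold>\<and> v False (j - i))
          + a \<^bold>\<and> parity (u False i \<^bold>\<and> v True (j - i) + u True i \<^bold>\<and> parity (v False (j - i)))
          + (real (Suc i) *\<^sub>R ?g (Suc i) (j - i) + real (Suc (j - i)) *\<^sub>R ?g i (Suc (j - i)))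
        = (T (u False i) + a \<^bold>\<and> parity (u True i) + real (Suc i) *\<^sub>R (b \<^bold>\<and> u False (Suc i))) \<^bold>\<and> v False (j - i)
          + sg (k * n) *\<^sub>R (u False i \<^bold>\<and> (T (v False (j - i)) + a \<^bold>\<and> parity (v True (j - i))
              + real (Suc (j - i)) *\<^sub>R (b \<^bold>\<and> v False (Suc (j - i)))))"
        unfolding rs[symmetric]
        by (cases "even k"; cases "even n")
           (simp_all add: fder_wedge[OF T] par_def sg_def parity_wedge parities wedge_linear wedge_assoc swaps scaleR_add_right scaleR_diff_right)
    qed
    finally show ?thesis using False by simp
  next
    case True
    let ?g = "\<lambda>i m. b \<^bold>\<and> (u False i \<^bold>\<and> v True m + u True i \<^bold>\<and> parity (v False m))
        + parity c \<^bold>\<and> parity (u False i \<^bold>\<and> v False m)"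
    have "Op T a b c (u \<odot> v) True j =
        (\<Sum>i\<le>j. T (u False i \<^bold>\<and> v True (j - i) + u True i \<^bold>\<and> parity (v False (j - i))))
        + real (Suc j) *\<^sub>R (\<Sum>i\<le>Suc j. ?g i (Suc j - i))"
      unfolding Op_True[OF smult_SF[OF uSF v]] smult_False smult_True
      unfolding sum.distrib[of "\<lambda>i. b \<^bold>\<and> _ i" "\<lambda>i. parity c \<^bold>\<and> _ i"]
      by (simp add: fder_sum[OF T] wedge_sum_right parity_sum del: of_nat_Suc sum.atMost_Suc)
    also have "\<dots> = (Op T a b c u \<odot> v + sg (k * n) *\<^sub>R (u \<odot> Op T a b c v)) True j"
      unfolding sum_leibniz[of j ?g]
      unfolding sum.distrib[symmetric] smult_True sfun_apply scaleR_sum_right eval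
    proof (intro sum.cong refl)
      fix i
      define r s where rs: "r = real (Suc i)" "s = real (Suc (j - i))"
      show "T (u False i \<^bold>\<and> v True (j - i) + u True i \<^bold>\<and> parity (v False (j - i)))
          + (real (Suc i) *\<^sub>R ?g (Suc i) (j - i) + real (Suc (j - i)) *\<^sub>R ?g i (Suc (j - i)))
        = (T (u False i) + a \<^bold>\<and> parity (u True i) + real (Suc i) *\<^sub>R (b \<^bold>\<and> u False (Suc i))) \<^bold>\<and> v True (j - i)
          + (T (u True i) + real (Suc i) *\<^sub>R (b \<^bold>\<and> u True (Suc i) + parity c \<^bold>\<and> parity (u False (Suc i))))
              \<^bold>\<and> parity (v False (j - i))
          + sg (k * n) *\<^sub>R
            (u False i \<^bold>\<and> (T (v True (j - i)) + real (Suc (j - i)) *\<^sub>R (b \<^bold>\<and> v True (Suc (j - i))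
                + parity c \<^bold>\<and> parity (v False (Suc (j - i)))))
             + u True i \<^bold>\<and> parity (T (v False (j - i)) + a \<^bold>\<and> parity (v True (j - i))
                + real (Suc (j - i)) *\<^sub>R (b \<^bold>\<and> v False (Suc (j - i)))))"
        unfolding rs[symmetric]
        by (cases "even k"; cases "even n")
           (simp_all add: fder_wedge[OF T] fder_add[OF T] fder_parity[OF T] par_def sg_def parity_wedge parities
             wedge_linear wedge_assoc swaps scaleR_add_right scaleR_diff_right)
    qed
    finally show ?thesis using True by simp
  qed
qed

lemma Op_graded_derivation:
  assumes T: "T \<in> fder k"
    and a: "a \<in> dforms (k + 1)" and b: "b \<in> dforms (k + 2)" and c: "c \<in> dforms (k + 1)"
  shows "Op T a b c \<in> graded_derivations M k"
proof -
  have "Op T a b c \<in> linops"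
    by (intro Op_linops[OF T] a[THEN dforms_forms] b[THEN dforms_forms] c[THEN dforms_forms])
  then show ?thesis
    unfolding graded_derivations_def mem_Collect_eq powi_minus_one
    using Op_homogeneous[OF assms] Op_smult[OF assms] linops_outside linops_SF linops_lincomb by blast
qed

end

section \<open>The derived Leibniz algebra\<close>

lemma gr_derived: "gr (derived L) k = (if k \<le> 0 then gr L (k - 1) else {0})"
  and diff_derived: "diff (derived L) k x = (if k < 0 then diff L (k - 1) x else 0)"
  and brk_derived: "brk (derived L) k l x y = sg k *\<^sub>R brk L k (l - 1) (diff L (k - 1) x) y"
  by (simp_all add: derived_def powi_minus_one)

lemma linear_betweenD:
  assumes "linear_between V W f"
  shows "x \<in> V \<Longrightarrow> f x \<in> W" "x \<in> V \<Longrightarrow> y \<in> V \<Longrightarrow> f (c *\<^sub>R x + y) = c *\<^sub>R f x + f y"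
  using assms by (auto simp: linear_between_def)

lemma linear_between_0: "linear_between V W f \<Longrightarrow> 0 \<in> V \<Longrightarrow> f 0 = 0"
  using linear_betweenD(2)[of V W f 0 0 "-1"] by simp

lemma linear_between_scaleR: "linear_between V W f \<Longrightarrow> 0 \<in> V \<Longrightarrow> x \<in> V \<Longrightarrow> f (c *\<^sub>R x) = c *\<^sub>R f x"
  using linear_betweenD(2)[of V W f x 0 c] linear_between_0[of V W f] by simp

text \<open>Up to sign, the derived bracket of x and y is the bracket of d x with y, and d of it is
  the bracket of d x with d y. So the Leibniz identity for x, y, z is the Jacobi identity for d x, d
  y, z.\<close>

lemma dg_leibniz_derived:
  fixes L :: "'v::real_vector dg_algebra"
  assumes L: "dg_lie_algebra L"
  shows "dg_leibniz_algebra (derived L)"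
proof -
  from L have complex: "graded_complex_with_bracket L" and leib: "graded_leibniz L"
    and deriv: "\<And>k l. diff_is_derivation L k l"
    by (simp_all add: dg_lie_algebra_def)
  from complex have sub: "\<And>k. subspace (gr L k)"
    and lin: "\<And>k. linear_between (gr L k) (gr L (k + 1)) (diff L k)"
    and sq: "\<And>k x. x \<in> gr L k \<Longrightarrow> diff L (k + 1) (diff L k x) = 0"
    and brk1: "\<And>k l x. x \<in> gr L k \<Longrightarrow> linear_between (gr L l) (gr L (k + l)) (brk L k l x)"
    and brk2: "\<And>k l y. y \<in> gr L l \<Longrightarrow> linear_between (gr L k) (gr L (k + l)) (\<lambda>x. brk L k l x y)"
    by (simp_all add: graded_complex_with_bracket_def)
  have jac: "brk L k (l + m) x (brk L l m y z) = brk L (k + l) m (brk L k l x y) z + sg (k * l) *\<^sub>R brk L l (k + m) y (brk L k m x z)"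
    if "x \<in> gr L k" "y \<in> gr L l" "z \<in> gr L m" for k l m x y z
    using leib that unfolding graded_leibniz_def powi_minus_one by blast
  have der: "diff L (k + l) (brk L k l x y) = brk L (k + 1) l (diff L k x) y + sg k *\<^sub>R brk L k (l + 1) x (diff L l y)"
    if "x \<in> gr L k" "y \<in> gr L l" for k l x y
    using deriv[of k l] that unfolding diff_is_derivation_def powi_minus_one by blast
  let ?D = "derived L"
  have z: "0 \<in> gr L k" for k
    using sub by (rule subspace_0)
  have zero1: "brk L k l 0 y = 0" if "y \<in> gr L l" for k l y
    using linear_between_0[OF brk2[OF that]] z by blast
  have zero2: "brk L k l x 0 = 0" if "x \<in> gr L k" for k l x
    using linear_between_0[OF brk1[OF that]] z by blast
  have diff0: "diff L k 0 = 0" for k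
    using linear_between_0[OF lin] z by blast
  have dmem: "diff L (k - 1) x \<in> gr L k" if "x \<in> gr L (k - 1)" for k x
    using linear_betweenD(1)[OF lin that] by simp
  have dsq: "diff L k (diff L (k - 1) x) = 0" if "x \<in> gr L (k - 1)" for k x
    using sq[OF that] by simp
  \<comment> \<open>In positive degrees the derived space is {0}, which is still contained in the
    shifted space, so most computations cover all degrees at once.\<close>
  have mem: "x \<in> gr L (k - 1)" if "x \<in> gr ?D k" for k x
    using that z by (auto simp: gr_derived split: if_splits)
  have pos: "x = 0" if "x \<in> gr ?D k" "0 < k" for k x
    using that by (simp add: gr_derived)
  have bmem: "brk ?D k l x y \<in> gr ?D (k + l)" if x: "x \<in> gr ?D k" and y: "y \<in> gr ?D l" for k l x y
  proof (cases "k \<le> 0 \<and> l \<le> 0")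
    case True
    have "brk L k (l - 1) (diff L (k - 1) x) y \<in> gr L (k + (l - 1))"
      using linear_betweenD(1)[OF brk1[OF dmem[OF mem[OF x]]] mem[OF y]] .
    with True show ?thesis
      by (simp add: gr_derived brk_derived subspace_scale[OF sub] add_diff_eq)
  next
    case False
    then have "brk ?D k l x y = 0"
      using pos[OF x] pos[OF y] zero1[OF mem[OF y], of k] zero2[OF dmem[OF mem[OF x]]]
      by (auto simp: brk_derived diff0)
    then show ?thesis
      by (simp add: gr_derived z)
  qed
  have blin1: "brk ?D k l (c *\<^sub>R x + x') y = c *\<^sub>R brk ?D k l x y + brk ?D k l x' y"
    if "x \<in> gr ?D k" "x' \<in> gr ?D k" "y \<in> gr ?D l" for k l x x' y c
    using linear_betweenD(2)[OF lin mem[OF that(1)] mem[OF that(2)], of c]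
      linear_betweenD(2)[OF brk2[OF mem[OF that(3)]] dmem[OF mem[OF that(1)]] dmem[OF mem[OF that(2)]], of c]
    by (simp add: brk_derived algebra_simps)
  have blin2: "brk ?D k l x (c *\<^sub>R y + y') = c *\<^sub>R brk ?D k l x y + brk ?D k l x y'"
    if "x \<in> gr ?D k" "y \<in> gr ?D l" "y' \<in> gr ?D l" for k l x y y' c
    using linear_betweenD(2)[OF brk1[OF dmem[OF mem[OF that(1)]]] mem[OF that(2)] mem[OF that(3)], of c]
    by (simp add: brk_derived algebra_simps)
  have complex: "graded_complex_with_bracket ?D"
    unfolding graded_complex_with_bracket_def
  proof (intro conjI allI ballI)
    fix k
    show "subspace (gr ?D k)"
      by (simp add: gr_derived sub)
    show "linear_between (gr ?D k) (gr ?D (k + 1)) (diff ?D k)"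
    proof (cases "k < 0")
      case True
      then show ?thesis
        using lin[of "k - 1"] by (simp add: linear_between_def gr_derived diff_derived)
    qed (simp add: linear_between_def gr_derived diff_derived z)
    show "diff ?D (k + 1) (diff ?D k x) = 0" if "x \<in> gr ?D k" for x
      using dsq[OF mem[OF that]] by (simp add: diff_derived diff0)
    fix l
    show "linear_between (gr ?D l) (gr ?D (k + l)) (brk ?D k l x)" if "x \<in> gr ?D k" for x
      using that bmem blin2 by (auto simp: linear_between_def)
    show "linear_between (gr ?D k) (gr ?D (k + l)) (\<lambda>x. brk ?D k l x y)" if "y \<in> gr ?D l" for y
      using that bmem blin1 by (auto simp: linear_between_def)
  qed
  \<comment> \<open>The derivation rule applied to d x and y: the term with d d x drops out, and the
    sign (-1)^k in the derived bracket cancels the one in front of the remaining term.\<close>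
  have dbrk: "diff L (k + l - 1) (brk ?D k l x y) = brk L k l (diff L (k - 1) x) (diff L (l - 1) y)"
    if x: "x \<in> gr ?D k" and y: "y \<in> gr ?D l" for k l x y
  proof -
    have "brk L k (l - 1) (diff L (k - 1) x) y \<in> gr L (k + l - 1)"
      using linear_betweenD(1)[OF brk1[OF dmem[OF mem[OF x]]] mem[OF y]] by (simp add: add_diff_eq)
    then have "diff L (k + l - 1) (brk ?D k l x y) = sg k *\<^sub>R diff L (k + l - 1) (brk L k (l - 1) (diff L (k - 1) x) y)"
      unfolding brk_derived using linear_between_scaleR[OF lin] z by blast
    then show ?thesis
      using der[OF dmem[OF mem[OF x]] mem[OF y]] zero1[OF mem[OF y]]
      by (simp add: dsq[OF mem[OF x]] add_diff_eq)
  qed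
  have leibniz: "graded_leibniz ?D"
    unfolding graded_leibniz_def powi_minus_one
  proof (intro allI ballI)
    fix k l m x y z
    assume x: "x \<in> gr ?D k" and y: "y \<in> gr ?D l" and z: "z \<in> gr ?D m"
    let ?x = "diff L (k - 1) x" and ?y = "diff L (l - 1) y"
    note mx = dmem[OF mem[OF x]] and my = dmem[OF mem[OF y]]
    have s1: "brk L k (l + m - 1) ?x (c *\<^sub>R brk L l (m - 1) ?y z) = c *\<^sub>R brk L k (l + m - 1) ?x (brk L l (m - 1) ?y z)" for c
      using linear_between_scaleR[OF brk1[OF mx] \<open>\<And>k. 0 \<in> gr L k\<close>, of "brk L l (m - 1) ?y z" "l + m - 1" c]
        linear_betweenD(1)[OF brk1[OF my] mem[OF z]] by (simp add: add_diff_eq)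
    have s2: "brk L l (k + m - 1) ?y (c *\<^sub>R brk L k (m - 1) ?x z) = c *\<^sub>R brk L l (k + m - 1) ?y (brk L k (m - 1) ?x z)" for c
      using linear_between_scaleR[OF brk1[OF my] \<open>\<And>k. 0 \<in> gr L k\<close>, of "brk L k (m - 1) ?x z" "k + m - 1" c]
        linear_betweenD(1)[OF brk1[OF mx] mem[OF z]] by (simp add: add_diff_eq)
    have "brk ?D k (l + m) x (brk ?D l m y z) = sg (k + l) *\<^sub>R brk L k (l + (m - 1)) ?x (brk L l (m - 1) ?y z)"
      by (simp add: brk_derived s1 sg_mult add_diff_eq)
    also have "\<dots> = sg (k + l) *\<^sub>R brk L (k + l) (m - 1) (brk L k l ?x ?y) z
        + sg (k + l) *\<^sub>R sg (k * l) *\<^sub>R brk L l (k + (m - 1)) ?y (brk L k (m - 1) ?x z)"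
      unfolding jac[OF mx my mem[OF z]] by (rule scaleR_add_right)
    also have "sg (k + l) *\<^sub>R brk L (k + l) (m - 1) (brk L k l ?x ?y) z = brk ?D (k + l) m (brk ?D k l x y) z"
      using dbrk[OF x y] by (simp add: brk_derived[of L "k + l"])
    also have "sg (k + l) *\<^sub>R sg (k * l) *\<^sub>R brk L l (k + (m - 1)) ?y (brk L k (m - 1) ?x z)
        = sg (k * l) *\<^sub>R brk ?D l (k + m) y (brk ?D k m x z)"
      by (simp add: brk_derived s2 sg_mult add_diff_eq)
    finally show "brk ?D k (l + m) x (brk ?D l m y z)
        = brk ?D (k + l) m (brk ?D k l x y) z + sg (k * l) *\<^sub>R brk ?D l (k + m) y (brk ?D k m x z)" .
  qed
  \<comment> \<open>For l < 0 both sides are the bracket of d x with d y. For l = 0 the right-hand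
    side is 0, and k \<ge> 0 ensures that the left-hand side is cut off too. Positive degrees
    contain only 0.\<close>
  have "diff_is_derivation ?D k l" if kl: "\<not> (k < 0 \<and> l = 0)" for k l
    unfolding diff_is_derivation_def powi_minus_one
  proof (intro ballI)
    fix x y assume x: "x \<in> gr ?D k" and y: "y \<in> gr ?D l"
    have 1: "brk ?D (k + 1) l (diff ?D k x) y = 0"
      using zero1[OF mem[OF y]] by (simp add: brk_derived diff_derived dsq[OF mem[OF x]] diff0)
    have 2: "sg k *\<^sub>R brk ?D k (l + 1) x (diff ?D l y) = (if l < 0 then brk L k l (diff L (k - 1) x) (diff L (l - 1) y) else 0)"
      using zero2[OF dmem[OF mem[OF x]]] by (simp add: brk_derived diff_derived)
    have 3: "diff ?D (k + l) (brk ?D k l x y) = (if l < 0 then brk L k l (diff L (k - 1) x) (diff L (l - 1) y) else 0)"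
    proof (cases "k + l < 0 \<and> l < 0")
      case True
      then show ?thesis using dbrk[OF x y] by (simp add: diff_derived)
    next
      case False
      have "k > 0 \<Longrightarrow> brk L k l (diff L (k - 1) x) (diff L (l - 1) y) = 0"
        using pos[OF x] zero1[OF dmem[OF mem[OF y]]] by (simp add: diff0)
      moreover have "l > 0 \<Longrightarrow> brk ?D k l x y = 0"
        using pos[OF y] zero2[OF dmem[OF mem[OF x]]] by (simp add: brk_derived)
      ultimately show ?thesis
        using False kl by (auto simp: diff_derived diff0)
    qed
    show "diff ?D (k + l) (brk ?D k l x y) = brk ?D (k + 1) l (diff ?D k x) y + sg k *\<^sub>R brk ?D k (l + 1) x (diff ?D l y)"
      by (simp only: 1 2 3 add_0)
  qed
  with complex leibniz show ?thesis
    by (simp add: dg_leibniz_algebra_def)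
qed

text \<open>Differential and bracket of the derived algebra are built from those of the original
  one, which \<Phi> respects; linearity of \<Phi> takes care of the sign, and \<Phi> 0 = 0 of the
  truncated degrees.\<close>

lemma dg_isomorphism_derived:
  fixes L :: "'v::real_vector dg_algebra" and L' :: "'w::real_vector dg_algebra"
  assumes L: "dg_lie_algebra L" and L': "dg_lie_algebra L'" and iso: "dg_isomorphism L L' \<Phi>"
  shows "dg_isomorphism (derived L) (derived L') (derived_map \<Phi>)"
proof -
  from L have sub: "\<And>k. subspace (gr L k)"
    and lin: "\<And>k. linear_between (gr L k) (gr L (k + 1)) (diff L k)"
    and brk1: "\<And>k l x. x \<in> gr L k \<Longrightarrow> linear_between (gr L l) (gr L (k + l)) (brk L k l x)"
    by (simp_all add: dg_lie_algebra_def graded_complex_with_bracket_def)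
  from iso have Plin: "\<And>k. linear_between (gr L k) (gr L' k) (\<Phi> k)"
    and Pbij: "\<And>k. bij_betw (\<Phi> k) (gr L k) (gr L' k)"
    and Pdiff: "\<And>k x. x \<in> gr L k \<Longrightarrow> \<Phi> (k + 1) (diff L k x) = diff L' k (\<Phi> k x)"
    and Pbrk: "\<And>k l x y. x \<in> gr L k \<Longrightarrow> y \<in> gr L l \<Longrightarrow> \<Phi> (k + l) (brk L k l x y) = brk L' k l (\<Phi> k x) (\<Phi> l y)"
    by (simp_all add: dg_isomorphism_def)
  have z: "0 \<in> gr L k" for k
    using sub by (rule subspace_0)
  have P0: "\<Phi> k 0 = 0" for k
    using linear_between_0[OF Plin z] .
  have mem: "x \<in> gr L (k - 1)" if "x \<in> gr (derived L) k" for k x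
    using that z by (auto simp: gr_derived split: if_splits)
  show ?thesis
    unfolding dg_isomorphism_def derived_map_def
  proof (intro conjI allI ballI)
    fix k
    show "linear_between (gr (derived L) k) (gr (derived L') k) (\<Phi> (k - 1))"
      using Plin[of "k - 1"] by (auto simp: gr_derived linear_between_def P0)
    show "bij_betw (\<Phi> (k - 1)) (gr (derived L) k) (gr (derived L') k)"
      using Pbij[of "k - 1"] by (auto simp: gr_derived P0 bij_betw_def)
    show "\<Phi> (k + 1 - 1) (diff (derived L) k x) = diff (derived L') k (\<Phi> (k - 1) x)" if "x \<in> gr (derived L) k" for x
      using Pdiff[OF mem[OF that]] by (simp add: diff_derived P0)
    fix l
    show "\<Phi> (k + l - 1) (brk (derived L) k l x y) = brk (derived L') k l (\<Phi> (k - 1) x) (\<Phi> (l - 1) y)"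
      if x: "x \<in> gr (derived L) k" and y: "y \<in> gr (derived L) l" for x y
    proof -
      have dx: "diff L (k - 1) x \<in> gr L k"
        using linear_betweenD(1)[OF lin mem[OF x]] by simp
      have "brk L k (l - 1) (diff L (k - 1) x) y \<in> gr L (k + l - 1)"
        using linear_betweenD(1)[OF brk1[OF dx] mem[OF y]] by (simp add: add_diff_eq)
      then have "\<Phi> (k + l - 1) (brk (derived L) k l x y) = sg k *\<^sub>R \<Phi> (k + l - 1) (brk L k (l - 1) (diff L (k - 1) x) y)"
        unfolding brk_derived using linear_between_scaleR[OF Plin z] by blast
      then show ?thesis
        using Pbrk[OF dx mem[OF y]] Pdiff[OF mem[OF x]] by (simp add: brk_derived add_diff_eq)
    qed
  qed
qed

section \<open>Graded commutators of operators and the duality relation\<close>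

lemma wedge_swap2:
  assumes "has_degree p \<alpha>" "has_degree q \<beta>"
  shows "\<alpha> \<^bold>\<and> \<beta> = sg (p * q) *\<^sub>R (\<beta> \<^bold>\<and> \<alpha>)"
proof -
  \<comment> \<open>At the level of arbitrary functions of argument lists, the constant 1 is a unit
    of the wedge product; taking it as third factor in \<open>wedge_swap\<close> gives the
    claim.\<close>
  have "of_fun 1 \<^bold>\<and> \<omega> = \<omega>" for \<omega> :: "'a form"
    by (simp add: of_fun_wedge)
  then have "\<omega> \<^bold>\<and> of_fun 1 = \<omega>" for \<omega> :: "'a form"
    by (metis wedge_commute_even parity_of_fun)
  then show ?thesis
    using wedge_swap[OF assms, of "of_fun 1"] by simp
qed

lemma sg_square_mult: "sg k * (sg k * x) = x"
  by (simp flip: mult.assoc)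

context smooth_mfd
begin

lemma linops_diff:
  assumes D: "D \<in> linops" and "u \<in> SF" "v \<in> SF"
  shows "D (u - c *\<^sub>R v) = D u - c *\<^sub>R D v"
  using linops_lincomb[OF D assms(3,2), of "- c"] by simp

lemma graded_commutator_sg: "graded_commutator k l D E = (\<lambda>u. D (E u) - sg (k * l) *\<^sub>R E (D u))"
  by (simp add: graded_commutator_def powi_minus_one)

lemma graded_commutator_lincomb_right:
  assumes D: "D \<in> linops" and E: "E \<in> linops" and E': "E' \<in> linops"
  shows "graded_commutator k l D (c *\<^sub>R E + E') = c *\<^sub>R graded_commutator k l D E + graded_commutator k l D E'"
proof
  fix u
  show "graded_commutator k l D (c *\<^sub>R E + E') u = (c *\<^sub>R graded_commutator k l D E + graded_commutator k l D E') u"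
    unfolding sop_apply graded_commutator_sg linops_lincomb[OF D linops_SF[OF E] linops_SF[OF E']]
    by (simp add: algebra_simps)
qed

lemma graded_commutator_antisym:
  "graded_commutator k l D E = - sg (k * l) *\<^sub>R graded_commutator l k E D"
proof
  fix u
  show "graded_commutator k l D E u = (- sg (k * l) *\<^sub>R graded_commutator l k E D) u"
    unfolding sop_apply graded_commutator_sg by (simp add: algebra_simps)
qed

lemma graded_commutator_lincomb_left:
  assumes D: "D \<in> linops" and D': "D' \<in> linops" and E: "E \<in> linops"
  shows "graded_commutator k l (c *\<^sub>R D + D') E = c *\<^sub>R graded_commutator k l D E + graded_commutator k l D' E"
  unfolding graded_commutator_antisym[of k l] graded_commutator_lincomb_right[OF E D D']
  by (simp add: algebra_simps)

lemma graded_commutator_jacobi: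
  assumes D: "D \<in> linops" and E: "E \<in> linops" and G: "G \<in> linops"
  shows "graded_commutator k (l + m) D (graded_commutator l m E G) =
    graded_commutator (k + l) m (graded_commutator k l D E) G
      + sg (k * l) *\<^sub>R graded_commutator l (k + m) E (graded_commutator k m D G)"
proof
  fix u
  have sgs: "sg (k * (l + m)) = sg (k * l) * sg (k * m)" "sg ((k + l) * m) = sg (k * m) * sg (l * m)"
    "sg (l * (k + m)) = sg (k * l) * sg (l * m)"
    by (simp_all add: distrib_left distrib_right sg_mult mult.commute)
  note SF = linops_SF[OF D] linops_SF[OF E] linops_SF[OF G]
  show "graded_commutator k (l + m) D (graded_commutator l m E G) u =
    (graded_commutator (k + l) m (graded_commutator k l D E) G
      + sg (k * l) *\<^sub>R graded_commutator l (k + m) E (graded_commutator k m D G)) u"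
    unfolding sop_apply graded_commutator_sg sgs linops_diff[OF D SF(2) SF(3)] linops_diff[OF D SF(3) SF(2)]
      linops_diff[OF E SF(1) SF(3)] linops_diff[OF E SF(3) SF(1)] linops_diff[OF G SF(1) SF(2)] linops_diff[OF G SF(2) SF(1)]
    by (simp add: algebra_simps sg_square_mult)
qed

lemma Op_cong:
  assumes "\<And>\<omega>. \<omega> \<in> \<Omega> \<Longrightarrow> T \<omega> = T' \<omega>"
  shows "Op T a b c = Op T' a b c"
  using assms by (intro Op_eqI) (simp_all add: Op_outside Op_True Op_False SF_forms)

text \<open>The coefficients are the values on generators: forms give T, q gives a, and t gives b
  and c. T is recovered on forms only. This is why a map prescribed on expressions can be well
  defined on operators.\<close>

lemma Op_inj:
  assumes eq: "Op T a b c = Op T' a' b' c'"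
    and T: "T \<in> fder k" and T': "T' \<in> fder k"
    and abc: "a \<in> \<Omega>" "b \<in> \<Omega>" "c \<in> \<Omega>" "a' \<in> \<Omega>" "b' \<in> \<Omega>" "c' \<in> \<Omega>"
  shows "\<omega> \<in> \<Omega> \<Longrightarrow> T \<omega> = T' \<omega>" and "a = a'" and "b = b'" and "c = c'"
proof -
  have one: "\<alpha> \<^bold>\<and> of_fun one_M = \<alpha>" if "\<alpha> \<in> \<Omega>" for \<alpha>
    using of_fun_one_wedge[of \<alpha>] wedge_commute_even[OF parity_of_fun, of one_M \<alpha>] that by simp
  show "T \<omega> = T' \<omega>" if "\<omega> \<in> \<Omega>"
  proof -
    have SF: "of_form \<omega> \<in> SF"
      using that by (intro SFI[of _ 0]) (simp_all add: of_form_def)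
    show ?thesis
      using fun_cong[OF fun_cong[OF fun_cong[OF eq, of "of_form \<omega>"], of False], of 0]
      unfolding Op_False[OF SF] by (simp add: of_form_def)
  qed
  define q where "q = (\<lambda>\<epsilon> j. if \<epsilon> \<and> j = (0::nat) then of_fun one_M else 0)"
  have q: "q \<in> SF"
    by (intro SFI[of _ 0]) (simp_all add: q_def)
  show "a = a'"
    using fun_cong[OF fun_cong[OF fun_cong[OF eq, of q], of False], of 0]
    unfolding Op_False[OF q] by (simp add: q_def fder_0[OF T] fder_0[OF T'] one abc)
  define t where "t = (\<lambda>\<epsilon> j. if \<not> \<epsilon> \<and> j = (1::nat) then of_fun one_M else 0)"
  have t: "t \<in> SF"
    by (intro SFI[of _ 1]) (simp_all add: t_def)
  show "b = b'"
    using fun_cong[OF fun_cong[OF fun_cong[OF eq, of t], of False], of 0]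
    unfolding Op_False[OF t] by (simp add: t_def fder_0[OF T] fder_0[OF T'] one abc)
  have "parity c = parity c'"
    using fun_cong[OF fun_cong[OF fun_cong[OF eq, of t], of True], of 0]
    unfolding Op_True[OF t] by (simp add: t_def fder_0[OF T] fder_0[OF T'] one abc)
  then show "c = c'"
    using parity_parity by metis
qed

lemma Op_zero [simp]: "Op (\<lambda>_. 0) 0 0 0 = 0"
  by (rule Op_eqI[symmetric]) (simp_all add: sop_apply Op_False Op_True)

lemma Op_lincomb:
  assumes T: "T \<in> fder k" and T': "T' \<in> fder k"
  shows "r *\<^sub>R Op T a b c + Op T' a' b' c' =
    Op (\<lambda>\<omega>. r *\<^sub>R T \<omega> + T' \<omega>) (r *\<^sub>R a + a') (r *\<^sub>R b + b') (r *\<^sub>R c + c')"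
  by (rule Op_eqI)
     (simp_all add: sop_apply Op_outside Op_False Op_True wedge_linear scaleR_add_right mult.commute
        del: of_nat_Suc)

text \<open>The graded version of T-duality: it exchanges the coefficients of \<open>\<partial>\<^sub>q\<close> and of \<open>q \<partial>\<^sub>t\<close>, up to a sign
  depending on the degree, and also exchanges the two vector fields \<open>Q\<close>, which have degree \<open>1\<close>.\<close>

definition dual_ops :: "int \<Rightarrow> 'a sop \<Rightarrow> 'a sop \<Rightarrow> bool"
  where "dual_ops k D E \<longleftrightarrow> (\<exists>T a b c. T \<in> fder k \<and> a \<in> dforms (k + 1) \<and> b \<in> dforms (k + 2) \<and> c \<in> dforms (k + 1) \<and>
    D = Op T a b c \<and> E = Op T (- sg k *\<^sub>R c) b (- sg k *\<^sub>R a))"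

lemma dual_opsI:
  "T \<in> fder k \<Longrightarrow> a \<in> dforms (k + 1) \<Longrightarrow> b \<in> dforms (k + 2) \<Longrightarrow> c \<in> dforms (k + 1) \<Longrightarrow>
    dual_ops k (Op T a b c) (Op T (- sg k *\<^sub>R c) b (- sg k *\<^sub>R a))"
  unfolding dual_ops_def by blast

text \<open>The sign of the rule squares to 1, so applying the rule twice restores the coefficients.
  The inverse of T-duality comes from here.\<close>

lemma dual_ops_sym: "dual_ops k D E \<Longrightarrow> dual_ops k E D"
  unfolding dual_ops_def
proof (elim exE conjE)
  fix T a b c assume *: "T \<in> fder k" "a \<in> dforms (k + 1)" "b \<in> dforms (k + 2)" "c \<in> dforms (k + 1)"
    "D = Op T a b c" "E = Op T (- sg k *\<^sub>R c) b (- sg k *\<^sub>R a)"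
  then show "\<exists>T a b c. T \<in> fder k \<and> a \<in> dforms (k + 1) \<and> b \<in> dforms (k + 2) \<and> c \<in> dforms (k + 1) \<and>
      E = Op T a b c \<and> D = Op T (- sg k *\<^sub>R c) b (- sg k *\<^sub>R a)"
    by (intro exI[of _ T] exI[of _ "- sg k *\<^sub>R c"] exI[of _ b] exI[of _ "- sg k *\<^sub>R a"] conjI scaleR_dforms) simp_all
qed

text \<open>Well-definedness of T-duality: by \<open>Op_inj\<close> the coefficients are unique, and
  T is unique on forms, which is all that \<open>Op\<close> uses.\<close>

lemma dual_ops_functional:
  assumes "dual_ops k D E" "dual_ops k D E'" shows "E = E'"
proof -
  from assms(1) obtain T a b c where 1: "T \<in> fder k" "a \<in> dforms (k + 1)" "b \<in> dforms (k + 2)" "c \<in> dforms (k + 1)"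
    "D = Op T a b c" "E = Op T (- sg k *\<^sub>R c) b (- sg k *\<^sub>R a)" unfolding dual_ops_def by blast
  from assms(2) obtain T' a' b' c' where 2: "T' \<in> fder k" "a' \<in> dforms (k + 1)" "b' \<in> dforms (k + 2)" "c' \<in> dforms (k + 1)"
    "D = Op T' a' b' c'" "E' = Op T' (- sg k *\<^sub>R c') b' (- sg k *\<^sub>R a')" unfolding dual_ops_def by blast
  have eq: "Op T a b c = Op T' a' b' c'" using 1(5) 2(5) by simp
  note inj = Op_inj[OF eq 1(1) 2(1) 1(2-4)[THEN dforms_forms] 2(2-4)[THEN dforms_forms]]
  show ?thesis
    unfolding 1(6) 2(6) inj(2-4) by (rule Op_cong[OF inj(1)])
qed

lemma dual_ops_0 [simp]: "dual_ops k 0 0"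
  using dual_opsI[OF zero_fder zero_dforms zero_dforms zero_dforms, of k] by simp

lemma dual_ops_lincomb:
  assumes "dual_ops k D E" "dual_ops k D' E'"
  shows "dual_ops k (r *\<^sub>R D + D') (r *\<^sub>R E + E')"
proof -
  from assms(1) obtain T a b c where 1: "T \<in> fder k" "a \<in> dforms (k + 1)" "b \<in> dforms (k + 2)" "c \<in> dforms (k + 1)"
    "D = Op T a b c" "E = Op T (- sg k *\<^sub>R c) b (- sg k *\<^sub>R a)" unfolding dual_ops_def by blast
  from assms(2) obtain T' a' b' c' where 2: "T' \<in> fder k" "a' \<in> dforms (k + 1)" "b' \<in> dforms (k + 2)" "c' \<in> dforms (k + 1)"
    "D' = Op T' a' b' c'" "E' = Op T' (- sg k *\<^sub>R c') b' (- sg k *\<^sub>R a')" unfolding dual_ops_def by blast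
  have "dual_ops k (Op (\<lambda>\<omega>. r *\<^sub>R T \<omega> + T' \<omega>) (r *\<^sub>R a + a') (r *\<^sub>R b + b') (r *\<^sub>R c + c'))
      (Op (\<lambda>\<omega>. r *\<^sub>R T \<omega> + T' \<omega>) (- sg k *\<^sub>R (r *\<^sub>R c + c')) (r *\<^sub>R b + b') (- sg k *\<^sub>R (r *\<^sub>R a + a')))"
    by (intro dual_opsI lincomb_fder add_dforms scaleR_dforms 1 2)
  then show ?thesis
    unfolding 1(5,6) 2(5,6) Op_lincomb[OF 1(1) 2(1)]
    by (simp add: scaleR_add_right scaleR_left_commute algebra_simps)
qed

lemma dual_ops_linops: "dual_ops k D E \<Longrightarrow> D \<in> linops"
  unfolding dual_ops_def using Op_linops dforms_forms by blast

lemma commutator_dforms: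
  assumes T: "T \<in> fder k" and T': "T' \<in> fder l"
    and a: "a \<in> dforms (k + 1)" and b: "b \<in> dforms (k + 2)" and c: "c \<in> dforms (k + 1)"
    and a': "a' \<in> dforms (l + 1)" and b': "b' \<in> dforms (l + 2)" and c': "c' \<in> dforms (l + 1)"
  shows "T a' - r *\<^sub>R T' a \<in> dforms (k + l + 1)"
    and "T b' + a \<^bold>\<and> c' - r *\<^sub>R (T' b + a' \<^bold>\<and> c) \<in> dforms (k + l + 2)"
    and "s *\<^sub>R T c' - r *\<^sub>R T' c \<in> dforms (k + l + 1)"
proof -
  have "T a' \<in> dforms (k + l + 1)" "T' a \<in> dforms (k + l + 1)" "T c' \<in> dforms (k + l + 1)" "T' c \<in> dforms (k + l + 1)"
    "T b' \<in> dforms (k + l + 2)" "T' b \<in> dforms (k + l + 2)"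
    "a \<^bold>\<and> c' \<in> dforms (k + l + 2)" "a' \<^bold>\<and> c \<in> dforms (k + l + 2)"
    using fder_dforms[OF T a'] fder_dforms[OF T' a] fder_dforms[OF T c'] fder_dforms[OF T' c]
      fder_dforms[OF T b'] fder_dforms[OF T' b] wedge_dforms[OF a c'] wedge_dforms[OF a' c]
    by (simp_all add: algebra_simps)
  note * = this
  show "T a' - r *\<^sub>R T' a \<in> dforms (k + l + 1)"
    by (intro diff_dforms scaleR_dforms *)
  show "T b' + a \<^bold>\<and> c' - r *\<^sub>R (T' b + a' \<^bold>\<and> c) \<in> dforms (k + l + 2)"
    by (intro diff_dforms add_dforms scaleR_dforms *)
  show "s *\<^sub>R T c' - r *\<^sub>R T' c \<in> dforms (k + l + 1)"
    by (intro diff_dforms scaleR_dforms *)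
qed

text \<open>\<open>Op_commutator\<close> computes both brackets, and the three coefficients are
  compared. For the coefficients of the q-derivative and of q times the t-derivative this is sign
  bookkeeping; in the middle one the two wedge terms exchange places.\<close>

lemma dual_ops_commutator:
  assumes "dual_ops k D E" "dual_ops l D' E'"
  shows "dual_ops (k + l) (graded_commutator k l D D') (graded_commutator k l E E')"
proof -
  from assms(1) obtain T a b c where 1: "T \<in> fder k" "a \<in> dforms (k + 1)" "b \<in> dforms (k + 2)" "c \<in> dforms (k + 1)"
    and D: "D = Op T a b c" "E = Op T (- sg k *\<^sub>R c) b (- sg k *\<^sub>R a)" unfolding dual_ops_def by blast
  from assms(2) obtain T' a' b' c' where 2: "T' \<in> fder l" "a' \<in> dforms (l + 1)" "b' \<in> dforms (l + 2)" "c' \<in> dforms (l + 1)"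
    and D': "D' = Op T' a' b' c'" "E' = Op T' (- sg l *\<^sub>R c') b' (- sg l *\<^sub>R a')" unfolding dual_ops_def by blast
  note forms [simp] = 1(2-4)[THEN dforms_forms] 2(2-4)[THEN dforms_forms]
  \<comment> \<open>Graded commutativity of coefficients of degrees k + 1 and l + 1; its sign is
    what fixes the sign in the definition of duality.\<close>
  have wedge: "c \<^bold>\<and> a' = sg ((k + 1) * (l + 1)) *\<^sub>R (a' \<^bold>\<and> c)" "c' \<^bold>\<and> a = sg ((k + 1) * (l + 1)) *\<^sub>R (a \<^bold>\<and> c')"
    using wedge_swap2[OF 1(4)[THEN dforms_degree] 2(2)[THEN dforms_degree]]
      wedge_swap2[OF 2(4)[THEN dforms_degree] 1(2)[THEN dforms_degree]] by (simp_all add: mult.commute)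
  let ?T = "\<lambda>\<omega>. T (T' \<omega>) - sg (k * l) *\<^sub>R T' (T \<omega>)"
  let ?a = "T a' - sg (k * l) *\<^sub>R T' a"
  let ?b = "T b' + a \<^bold>\<and> c' - sg (k * l) *\<^sub>R (T' b + a' \<^bold>\<and> c)"
  let ?c = "sg k *\<^sub>R T c' - sg (k * l + l) *\<^sub>R T' c"
  have "dual_ops (k + l) (Op ?T ?a ?b ?c) (Op ?T (- sg (k + l) *\<^sub>R ?c) ?b (- sg (k + l) *\<^sub>R ?a))"
    by (rule dual_opsI[OF commutator_fder[OF 1(1) 2(1)]]; rule commutator_dforms[OF 1(1) 2(1) 1(2-4) 2(2-4)])
  moreover have "graded_commutator k l D D' = Op ?T ?a ?b ?c"
    unfolding D D' by (rule Op_commutator[OF 1(1) 2(1) 1(2-4) 2(2-4)])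
  moreover have "graded_commutator k l E E' = Op ?T (- sg (k + l) *\<^sub>R ?c) ?b (- sg (k + l) *\<^sub>R ?a)"
  proof -
    have "graded_commutator k l E E' =
      Op ?T (T (- sg l *\<^sub>R c') - sg (k * l) *\<^sub>R T' (- sg k *\<^sub>R c))
       (T b' + (- sg k *\<^sub>R c) \<^bold>\<and> (- sg l *\<^sub>R a') - sg (k * l) *\<^sub>R (T' b + (- sg l *\<^sub>R c') \<^bold>\<and> (- sg k *\<^sub>R a)))
       (sg k *\<^sub>R T (- sg l *\<^sub>R a') - sg (k * l + l) *\<^sub>R T' (- sg k *\<^sub>R a))"
      unfolding D D' by (intro Op_commutator scaleR_dforms 1 2)
    also have "T (- sg l *\<^sub>R c') - sg (k * l) *\<^sub>R T' (- sg k *\<^sub>R c) = - sg (k + l) *\<^sub>R ?c"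
      by (cases "even k"; cases "even l") (simp_all add: fder_scaleR[OF 1(1)] fder_scaleR[OF 2(1)] fder_minus[OF 1(1)] fder_minus[OF 2(1)] sg_def)
    also have "sg k *\<^sub>R T (- sg l *\<^sub>R a') - sg (k * l + l) *\<^sub>R T' (- sg k *\<^sub>R a) = - sg (k + l) *\<^sub>R ?a"
      by (cases "even k"; cases "even l") (simp_all add: fder_scaleR[OF 1(1)] fder_scaleR[OF 2(1)] fder_minus[OF 1(1)] fder_minus[OF 2(1)] sg_def)
    also have "T b' + (- sg k *\<^sub>R c) \<^bold>\<and> (- sg l *\<^sub>R a') - sg (k * l) *\<^sub>R (T' b + (- sg l *\<^sub>R c') \<^bold>\<and> (- sg k *\<^sub>R a)) = ?b"
      by (cases "even k"; cases "even l") (simp_all add: wedge_linear wedge sg_def)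
    finally show ?thesis .
  qed
  ultimately show ?thesis by simp
qed

section \<open>T-duality\<close>

definition base_ders :: "int \<Rightarrow> ('a form \<Rightarrow> 'a form) set"
  where "base_ders k = (if k = 0 then lie ` V else if k = -1 then contract ` V else {\<lambda>_. 0})"

text \<open>For k \<le> 0 these are the symmetries before commutation with Q is imposed, described
  in the same way in all degrees.\<close>

definition sym_ops :: "int \<Rightarrow> 'a sop set"
  where "sym_ops k = {Op T a b c | T a b c.
    T \<in> base_ders k \<and> a \<in> dforms (k + 1) \<and> b \<in> dforms (k + 2) \<and> c \<in> dforms (k + 1)}"

lemma base_ders_fder: "T \<in> base_ders k \<Longrightarrow> T \<in> fder k"
  by (auto simp: base_ders_def lie_fder contract_fder zero_fder split: if_splits)

text \<open>The Cartan relations hold on forms only, so the operator T' coming from a commutator is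
  required to agree with a listed one just there.\<close>

lemma sym_opsI:
  assumes "T \<in> base_ders k" "\<And>\<omega>. \<omega> \<in> \<Omega> \<Longrightarrow> T' \<omega> = T \<omega>"
    and "a \<in> dforms (k + 1)" "b \<in> dforms (k + 2)" "c \<in> dforms (k + 1)"
  shows "Op T' a b c \<in> sym_ops k"
proof -
  have "Op T' a b c = Op T a b c" using assms(2) by (rule Op_cong)
  then show ?thesis unfolding sym_ops_def using assms by blast
qed

lemma sym_opsE:
  assumes "D \<in> sym_ops k"
  obtains T a b c where "T \<in> base_ders k" "T \<in> fder k" "a \<in> dforms (k + 1)" "b \<in> dforms (k + 2)" "c \<in> dforms (k + 1)"
    "D = Op T a b c"
  using assms base_ders_fder unfolding sym_ops_def by blast

lemma sym_ops_dual: "D \<in> sym_ops k \<Longrightarrow> \<exists>E\<in>sym_ops k. dual_ops k D E"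
proof (elim sym_opsE)
  fix T a b c assume *: "T \<in> base_ders k" "T \<in> fder k" "a \<in> dforms (k + 1)" "b \<in> dforms (k + 2)" "c \<in> dforms (k + 1)"
    and D: "D = Op T a b c"
  show ?thesis
    unfolding D
  proof (rule bexI)
    show "dual_ops k (Op T a b c) (Op T (- sg k *\<^sub>R c) b (- sg k *\<^sub>R a))"
      by (rule dual_opsI[OF *(2-5)])
    show "Op T (- sg k *\<^sub>R c) b (- sg k *\<^sub>R a) \<in> sym_ops k"
      by (rule sym_opsI[OF *(1) refl]) (intro scaleR_dforms *)+
  qed
qed

lemma sym_ops_graded_derivations: "D \<in> sym_ops k \<Longrightarrow> D \<in> graded_derivations M k"
  by (elim sym_opsE) (simp only: Op_graded_derivation)

lemma sym_ops_linops: "D \<in> sym_ops k \<Longrightarrow> D \<in> linops"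
  using sym_ops_dual dual_ops_linops by blast

lemma sym_ops_lincomb:
  assumes "D \<in> sym_ops k" "E \<in> sym_ops k" shows "r *\<^sub>R D + E \<in> sym_ops k"
  using assms
proof (elim sym_opsE)
  fix T a b c T' a' b' c'
  assume 1: "T \<in> base_ders k" "T \<in> fder k" "a \<in> dforms (k + 1)" "b \<in> dforms (k + 2)" "c \<in> dforms (k + 1)"
    and 2: "T' \<in> base_ders k" "T' \<in> fder k" "a' \<in> dforms (k + 1)" "b' \<in> dforms (k + 2)" "c' \<in> dforms (k + 1)"
    and DE: "D = Op T a b c" "E = Op T' a' b' c'"
  have "\<exists>S\<in>base_ders k. \<forall>\<omega>\<in>\<Omega>. r *\<^sub>R T \<omega> + T' \<omega> = S \<omega>"
  proof (cases "k = 0 \<or> k = -1")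
    case True
    then show ?thesis
    proof
      assume k: "k = 0"
      then obtain X Y where "X \<in> V" "Y \<in> V" "T = lie X" "T' = lie Y"
        using 1(1) 2(1) by (auto simp: base_ders_def)
      then show ?thesis
        by (intro bexI[of _ "lie (r *\<^sub>R X + Y)"]) (auto simp: base_ders_def k lie_lincomb_vf)
    next
      assume k: "k = -1"
      then obtain X Y where "X \<in> V" "Y \<in> V" "T = contract X" "T' = contract Y"
        using 1(1) 2(1) by (auto simp: base_ders_def)
      then show ?thesis
        by (intro bexI[of _ "contract (r *\<^sub>R X + Y)"]) (auto simp: base_ders_def k contract_add contract_scaleR)
    qed
  next
    case False
    with 1(1) 2(1) show ?thesis
      by (intro bexI[of _ "\<lambda>_. 0"]) (auto simp: base_ders_def)
  qed
  then obtain S where S: "S \<in> base_ders k" "\<And>\<omega>. \<omega> \<in> \<Omega> \<Longrightarrow> r *\<^sub>R T \<omega> + T' \<omega> = S \<omega>"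
    by blast
  show ?thesis
    unfolding DE Op_lincomb[OF 1(2) 2(2)]
    by (rule sym_opsI[OF S]) (intro add_dforms scaleR_dforms 1 2 | assumption)+
qed

lemma base_ders_other: "T \<in> base_ders k \<Longrightarrow> k \<notin> {0, -1} \<Longrightarrow> T = (\<lambda>_. 0)"
  by (simp add: base_ders_def)

text \<open>The Cartan relations: Lie derivatives commute to the Lie derivative along the bracket, a
  Lie derivative and a contraction to the contraction with the bracket, and contractions
  anticommute.\<close>

lemma base_ders_commutator:
  assumes T: "T \<in> base_ders k" and T': "T' \<in> base_ders l" and kl: "k \<le> 0" "l \<le> 0"
  shows "\<exists>S\<in>base_ders (k + l). \<forall>\<omega>\<in>\<Omega>. T (T' \<omega>) - sg (k * l) *\<^sub>R T' (T \<omega>) = S \<omega>"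
proof -
  consider "k = 0" "l = 0" | "k = 0" "l = -1" | "k = -1" "l = 0" | "k = -1" "l = -1" | "k \<notin> {0, -1}" | "l \<notin> {0, -1}"
    by auto
  then show ?thesis
  proof cases
    case 1
    then obtain X Y where "X \<in> V" "Y \<in> V" "T = lie X" "T' = lie Y"
      using T T' by (auto simp: base_ders_def)
    with 1 show ?thesis
      by (intro bexI[of _ "lie (vf_bracket X Y)"]) (auto simp: base_ders_def sg_def lie_lie)
  next
    case 2
    then obtain X Y where "X \<in> V" "Y \<in> V" "T = lie X" "T' = contract Y"
      using T T' by (auto simp: base_ders_def)
    with 2 show ?thesis
      by (intro bexI[of _ "contract (vf_bracket X Y)"]) (auto simp: base_ders_def sg_def contract_lie)
  next
    case 3
    then obtain X Y where "X \<in> V" "Y \<in> V" "T = contract Y" "T' = lie X"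
      using T T' by (auto simp: base_ders_def)
    with 3 show ?thesis
      by (intro bexI[of _ "contract (- vf_bracket X Y)"]) (auto simp: base_ders_def sg_def contract_lie contract_minus)
  next
    case 4
    then obtain X Y where "X \<in> V" "Y \<in> V" "T = contract X" "T' = contract Y"
      using T T' by (auto simp: base_ders_def)
    then have "\<forall>\<omega>\<in>\<Omega>. T (T' \<omega>) - sg (k * l) *\<^sub>R T' (T \<omega>) = 0"
      using 4 contract_swap[OF forms_multiforms, of _ X Y] by (simp add: sg_def)
    with 4 show ?thesis
      by (intro bexI[of _ "\<lambda>_. 0"]) (auto simp: base_ders_def)
  next
    \<comment> \<open>Here k \<le> -2, and since l \<le> 0 the total degree is at most -2 as well,
      where only the zero map is listed.\<close>
    case 5
    with kl base_ders_other[OF T] show ?thesis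
      by (intro bexI[of _ "\<lambda>_. 0"]) (auto simp: base_ders_def fder_0[OF base_ders_fder[OF T']])
  next
    case 6
    with kl base_ders_other[OF T'] show ?thesis
      by (intro bexI[of _ "\<lambda>_. 0"]) (auto simp: base_ders_def fder_0[OF base_ders_fder[OF T]])
  qed
qed

lemma sym_ops_commutator:
  assumes "D \<in> sym_ops k" "E \<in> sym_ops l" and kl: "k \<le> 0" "l \<le> 0"
  shows "graded_commutator k l D E \<in> sym_ops (k + l)"
  using assms(1,2)
proof (elim sym_opsE)
  fix T a b c T' a' b' c'
  assume 1: "T \<in> base_ders k" "T \<in> fder k" "a \<in> dforms (k + 1)" "b \<in> dforms (k + 2)" "c \<in> dforms (k + 1)"
    and 2: "T' \<in> base_ders l" "T' \<in> fder l" "a' \<in> dforms (l + 1)" "b' \<in> dforms (l + 2)" "c' \<in> dforms (l + 1)"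
    and DE: "D = Op T a b c" "E = Op T' a' b' c'"
  obtain S where S: "S \<in> base_ders (k + l)" "\<And>\<omega>. \<omega> \<in> \<Omega> \<Longrightarrow> T (T' \<omega>) - sg (k * l) *\<^sub>R T' (T \<omega>) = S \<omega>"
    using base_ders_commutator[OF 1(1) 2(1) kl] by blast
  show ?thesis
    unfolding DE Op_commutator[OF 1(2) 2(2) 1(3-5) 2(3-5)]
    by (rule sym_opsI[OF S]) (rule commutator_dforms[OF 1(2) 2(2) 1(3-5) 2(3-5)] | assumption)+
qed

lemma sym_ops_low: "k < -2 \<Longrightarrow> sym_ops k = {0}"
proof -
  assume k: "k < -2"
  have "D = 0" if "D \<in> sym_ops k" for D
    using that
  proof (elim sym_opsE)
    fix T a b c assume *: "T \<in> base_ders k" "a \<in> dforms (k + 1)" "b \<in> dforms (k + 2)" "c \<in> dforms (k + 1)" "D = Op T a b c"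
    have "a = 0" "b = 0" "c = 0" "T = (\<lambda>_. 0)"
      using dforms_negD[OF *(2)] dforms_negD[OF *(3)] dforms_negD[OF *(4)] base_ders_other[OF *(1)] k by auto
    with * show "D = 0" by simp
  qed
  moreover have "0 \<in> sym_ops k"
    using sym_opsI[of "\<lambda>_. 0" k "\<lambda>_. 0" 0 0 0] k by (simp add: base_ders_def)
  ultimately show ?thesis by blast
qed

section \<open>The prescribed expressions for symmetries in terms of \<open>Op\<close>\<close>

lemma Op_lie: "a \<in> \<Omega> \<Longrightarrow> b \<in> \<Omega> \<Longrightarrow> c \<in> \<Omega> \<Longrightarrow>
    D_lie M X + of_form a \<cdot> D_q M + (of_form b + q_var M \<odot> of_form c) \<cdot> D_t M = Op (lie X) a b c"
  unfolding D_lie_def by (rule Op_eq)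

lemma Op_iota: "a \<in> \<Omega> \<Longrightarrow> b \<in> \<Omega> \<Longrightarrow> c \<in> \<Omega> \<Longrightarrow>
    D_iota M Y + of_form a \<cdot> D_q M + (of_form b + q_var M \<odot> of_form c) \<cdot> D_t M = Op (contract Y) a b c"
  unfolding D_iota_def by (rule Op_eq)

lemma Op_h: "b \<in> \<Omega> \<Longrightarrow> of_form b \<cdot> D_t M = Op (\<lambda>_. 0) 0 b 0"
proof (rule Op_eqI)
  assume b: "b \<in> \<Omega>"
  show "u \<notin> SF \<Longrightarrow> (of_form b \<cdot> D_t M) u = 0" for u
    by (rule ext, rule ext) (simp add: lmult_def D_t_def on_superfunctions_def of_form_smult)
  fix u j assume "u \<in> SF"
  then show "(of_form b \<cdot> D_t M) u False j = Op (\<lambda>_. 0) 0 b 0 u False j"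
    "(of_form b \<cdot> D_t M) u True j = Op (\<lambda>_. 0) 0 b 0 u True j"
    by (simp_all add: lmult_def D_t_def on_superfunctions_def of_form_smult Op_False Op_True wedge_scaleR_right del: of_nat_Suc)
qed

lemma Op_lie_dual:
  assumes "A \<in> \<Omega>" "Ab \<in> \<Omega>" "B \<in> \<Omega>"
  shows "D_lie M X - of_form Ab \<cdot> D_q M + (of_form B - q_var M \<odot> of_form A) \<cdot> D_t M = Op (lie X) (- Ab) B (- A)"
proof -
  have "of_form (- Ab) \<cdot> D_q M = - (of_form Ab \<cdot> D_q M)"
    by (rule ext, rule ext, rule ext) (simp add: lmult_def of_form_smult sop_apply)
  moreover have "q_var M \<odot> of_form (- A) = - (q_var M \<odot> of_form A)"
    using assms by (intro ext[of "_ :: 'a sfun"], intro ext[of "_ :: nat \<Rightarrow> 'a form"]) (simp add: q_of_form)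
  ultimately show ?thesis
    using Op_lie[of "- Ab" B "- A" X] assms by simp
qed

end

section \<open>The symmetry algebra of Q and its T-dual\<close>

locale tdual_data = smooth_mfd +
  fixes F Fb H :: "'a form"
  assumes F: "F \<in> dforms 2" and dF: "d F = 0"
    and Fb: "Fb \<in> dforms 2" and dFb: "d Fb = 0"
    and H: "H \<in> dforms 3" and dH: "d H + F \<^bold>\<and> Fb = 0"
begin

abbreviation Q where "Q \<equiv> Q_P M F Fb H"
abbreviation G where "G \<equiv> symmetry_space M F Fb H"

text \<open>The data are symmetric because 2-forms commute. Each result below is thus available on
  the dual side by interpreting the locale a second time.\<close>

lemma tdual_data_swap: "tdual_data M Fb F H"
proof
  have "Fb \<^bold>\<and> F = F \<^bold>\<and> Fb"
    using wedge_swap2[OF Fb[THEN dforms_degree] F[THEN dforms_degree]] by (simp add: sg_def)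
  then show "d H + Fb \<^bold>\<and> F = 0" using dH by simp
qed (fact F dF Fb dFb H)+

lemma Q_Op: "Q = Op d F H Fb"
  unfolding Q_P_def D_d_def by (rule Op_eq) (rule F[THEN dforms_forms] H[THEN dforms_forms] Fb[THEN dforms_forms])+

lemma Q_linops: "Q \<in> linops"
  unfolding Q_Op by (rule Op_linops[OF d_fder]) (rule F[THEN dforms_forms] H[THEN dforms_forms] Fb[THEN dforms_forms])+

text \<open>The commutator of Q with itself is twice its square. Its coefficients are multiples of d
  F, d Fb and d H + F \<and> Fb, so closedness of F and Fb and the equation for H say that Q squares
  to 0.\<close>

lemma Q_Q: "Q (Q u) = 0"
proof -
  have deg: "F \<in> dforms (1 + 1)" "H \<in> dforms (1 + 2)" "Fb \<in> dforms (1 + 1)"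
    using F H Fb by simp_all
  have "graded_commutator 1 1 Q Q = Op (\<lambda>\<omega>. d (d \<omega>) - sg (1 * 1) *\<^sub>R d (d \<omega>)) 0 0 0"
    unfolding Q_Op Op_commutator[OF d_fder d_fder deg deg] using dH by (simp add: dF dFb sg_def)
  also have "\<dots> = Op (\<lambda>_. 0) 0 0 0"
    by (rule Op_cong) (simp add: d_d)
  finally have "graded_commutator 1 1 Q Q u = 0"
    by (simp add: sop_apply)
  then have "(2::real) *\<^sub>R Q (Q u) = 0"
    by (simp add: graded_commutator_sg sg_def scaleR_2)
  then show ?thesis by (simp only: scaleR_eq_0_iff) simp
qed

text \<open>The degrees of the coefficients account for the case distinction: a and c have degree k
  + 1 and b has degree k + 2, so for k = -2 only a function b survives, and below that nothing.
  Commutation with Q remains as the extra condition for k = 0.\<close>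

lemma symmetry_space_eq:
  "G k = (if k < 0 then sym_ops k else if k = 0 then {D \<in> sym_ops 0. graded_commutator 1 0 Q D = 0} else {0})"
proof -
  have k1: "kforms M 1 = dforms 1" and k2: "kforms M 2 = dforms 2"
    using kforms_eq_dforms[of 1] kforms_eq_dforms[of 2] by simp_all
  consider "k < -2" | "k = -2" | "k = -1" | "k = 0" | "k > 0" by linarith
  then show ?thesis
  proof cases
    case 1
    then show ?thesis by (simp add: symmetry_space_def sym_ops_low)
  next
    case 2
    have "D \<in> sym_ops (-2) \<longleftrightarrow> (\<exists>h. D = of_form (of_fun h) \<cdot> D_t M \<and> h \<in> C)" for D
    proof
      assume "D \<in> sym_ops (-2)"
      then show "\<exists>h. D = of_form (of_fun h) \<cdot> D_t M \<and> h \<in> C"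
      proof (elim sym_opsE)
        fix T a b c assume *: "T \<in> base_ders (-2)" "a \<in> dforms (-2 + 1)" "b \<in> dforms (-2 + 2)" "c \<in> dforms (-2 + 1)" "D = Op T a b c"
        have "a = 0" "c = 0" "T = (\<lambda>_. 0)"
          using dforms_negD[OF *(2)] dforms_negD[OF *(4)] base_ders_other[OF *(1)] by auto
        moreover obtain h where "h \<in> C" "b = of_fun h" using *(3) dforms_0_iff by auto
        ultimately have "D = of_form (of_fun h) \<cdot> D_t M" using *(5) Op_h[of b] by simp
        then show ?thesis using \<open>h \<in> C\<close> by blast
      qed
    next
      assume "\<exists>h. D = of_form (of_fun h) \<cdot> D_t M \<and> h \<in> C"
      then obtain h where h: "h \<in> C" and D: "D = of_form (of_fun h) \<cdot> D_t M" by blast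
      then have "of_fun h \<in> dforms 0" using dforms_0_iff by blast
      then show "D \<in> sym_ops (-2)"
        unfolding D Op_h[OF of_fun_forms[OF h]]
        by (intro sym_opsI[OF _ refl]) (simp_all add: base_ders_def)
    qed
    with 2 show ?thesis by (auto simp: symmetry_space_def)
  next
    case 3
    have "D \<in> sym_ops (-1) \<longleftrightarrow> (\<exists>Y f fb B. D = D_iota M Y + of_form (of_fun f) \<cdot> D_q M
          + (of_form B + q_var M \<odot> of_form (of_fun fb)) \<cdot> D_t M \<and>
          Y \<in> V \<and> f \<in> C \<and> fb \<in> C \<and> B \<in> dforms 1)" for D
    proof
      assume "D \<in> sym_ops (-1)"
      then show "\<exists>Y f fb B. D = D_iota M Y + of_form (of_fun f) \<cdot> D_q M
          + (of_form B + q_var M \<odot> of_form (of_fun fb)) \<cdot> D_t M \<and> Y \<in> V \<and> f \<in> C \<and> fb \<in> C \<and> B \<in> dforms 1"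
      proof (elim sym_opsE)
        fix T a b c assume *: "T \<in> base_ders (-1)" "a \<in> dforms (-1 + 1)" "b \<in> dforms (-1 + 2)" "c \<in> dforms (-1 + 1)" "D = Op T a b c"
        obtain Y where Y: "Y \<in> V" "T = contract Y" using *(1) by (auto simp: base_ders_def)
        obtain f fb where f: "f \<in> C" "a = of_fun f" "fb \<in> C" "c = of_fun fb" using *(2,4) dforms_0_iff by auto
        have b: "b \<in> dforms 1" using *(3) by simp
        have "D = D_iota M Y + of_form (of_fun f) \<cdot> D_q M + (of_form b + q_var M \<odot> of_form (of_fun fb)) \<cdot> D_t M"
          using *(5) Y f dforms_forms[OF b] by (simp add: Op_iota)
        with Y f b show ?thesis by blast
      qed
    next
      assume "\<exists>Y f fb B. D = D_iota M Y + of_form (of_fun f) \<cdot> D_q M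
          + (of_form B + q_var M \<odot> of_form (of_fun fb)) \<cdot> D_t M \<and> Y \<in> V \<and> f \<in> C \<and> fb \<in> C \<and> B \<in> dforms 1"
      then obtain Y f fb B where *: "Y \<in> V" "f \<in> C" "fb \<in> C" "B \<in> dforms 1"
        and D: "D = D_iota M Y + of_form (of_fun f) \<cdot> D_q M + (of_form B + q_var M \<odot> of_form (of_fun fb)) \<cdot> D_t M"
        by blast
      then have "of_fun f \<in> dforms 0" "of_fun fb \<in> dforms 0" using dforms_0_iff by blast+
      with * show "D \<in> sym_ops (-1)"
        unfolding D Op_iota[OF of_fun_forms[OF *(2)] dforms_forms[OF *(4)] of_fun_forms[OF *(3)]]
        by (intro sym_opsI[OF _ refl]) (simp_all add: base_ders_def)
    qed
    then show ?thesis unfolding 3 symmetry_space_def k1 by (simp add: set_eq_iff)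
  next
    case 4
    have "D \<in> sym_ops 0 \<longleftrightarrow> (\<exists>X A Ab B. X \<in> V \<and> A \<in> dforms 1 \<and> Ab \<in> dforms 1 \<and> B \<in> dforms 2 \<and>
        D = D_lie M X + of_form A \<cdot> D_q M + (of_form B + q_var M \<odot> of_form Ab) \<cdot> D_t M)" for D
    proof
      assume "D \<in> sym_ops 0"
      then show "\<exists>X A Ab B. X \<in> V \<and> A \<in> dforms 1 \<and> Ab \<in> dforms 1 \<and> B \<in> dforms 2 \<and>
        D = D_lie M X + of_form A \<cdot> D_q M + (of_form B + q_var M \<odot> of_form Ab) \<cdot> D_t M"
      proof (elim sym_opsE)
        fix T a b c assume *: "T \<in> base_ders 0" "a \<in> dforms (0 + 1)" "b \<in> dforms (0 + 2)" "c \<in> dforms (0 + 1)" "D = Op T a b c"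
        obtain X where X: "X \<in> V" "T = lie X" using *(1) by (auto simp: base_ders_def)
        have abc: "a \<in> dforms 1" "b \<in> dforms 2" "c \<in> dforms 1" using *(2-4) by simp_all
        have "D = D_lie M X + of_form a \<cdot> D_q M + (of_form b + q_var M \<odot> of_form c) \<cdot> D_t M"
          using *(5) X abc[THEN dforms_forms] by (simp add: Op_lie)
        with X abc show ?thesis by blast
      qed
    next
      assume "\<exists>X A Ab B. X \<in> V \<and> A \<in> dforms 1 \<and> Ab \<in> dforms 1 \<and> B \<in> dforms 2 \<and>
        D = D_lie M X + of_form A \<cdot> D_q M + (of_form B + q_var M \<odot> of_form Ab) \<cdot> D_t M"
      then obtain X A Ab B where *: "X \<in> V" "A \<in> dforms 1" "Ab \<in> dforms 1" "B \<in> dforms 2"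
        and D: "D = D_lie M X + of_form A \<cdot> D_q M + (of_form B + q_var M \<odot> of_form Ab) \<cdot> D_t M" by blast
      then show "D \<in> sym_ops 0"
        unfolding D Op_lie[OF *(2,4,3)[THEN dforms_forms]]
        by (intro sym_opsI[OF _ refl]) (simp_all add: base_ders_def)
    qed
    then show ?thesis unfolding 4 symmetry_space_def k1 k2 by simp
  next
    case 5
    then show ?thesis by (simp add: symmetry_space_def)
  qed
qed

lemma zero_sym_ops: "0 \<in> sym_ops k" if "k \<le> 0"
proof -
  have "\<exists>E. E \<in> sym_ops k"
    using sym_opsI[OF _ refl zero_dforms zero_dforms zero_dforms, of _ k]
    by (metis base_ders_def empty_iff ex_in_conv image_is_empty insert_not_empty zero_V)
  then obtain E where "E \<in> sym_ops k" by blast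
  then show ?thesis
    using sym_ops_lincomb[of E k E "-1"] by simp
qed

lemma commutator_zero: "D \<in> linops \<Longrightarrow> graded_commutator k l D 0 = 0" "D \<in> linops \<Longrightarrow> graded_commutator k l 0 D = 0"
  by (simp_all add: graded_commutator_sg sop_apply linops_0 zero_fun_def[symmetric])

lemma G_sym_ops: "D \<in> G k \<Longrightarrow> D = 0 \<or> (k \<le> 0 \<and> D \<in> sym_ops k)"
  by (auto simp: symmetry_space_eq split: if_splits)

lemma zero_linops: "0 \<in> linops"
  by (simp add: linops_def sop_apply)

lemma G_linops: "D \<in> G k \<Longrightarrow> D \<in> linops"
  using G_sym_ops sym_ops_linops zero_linops by blast

lemma G_zero: "0 \<in> G k"
  by (simp add: symmetry_space_eq zero_sym_ops commutator_zero Q_linops)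

lemma G_lincomb:
  assumes "D \<in> G k" "E \<in> G k" shows "r *\<^sub>R D + E \<in> G k"
proof -
  consider "k < 0" | "k = 0" | "k > 0" by linarith
  then show ?thesis
  proof cases
    case 2
    with assms have "D \<in> sym_ops 0" "E \<in> sym_ops 0" "graded_commutator 1 0 Q D = 0" "graded_commutator 1 0 Q E = 0"
      by (simp_all add: symmetry_space_eq)
    then show ?thesis
      using 2 sym_ops_lincomb graded_commutator_lincomb_right[OF Q_linops sym_ops_linops sym_ops_linops]
      by (simp add: symmetry_space_eq)
  qed (use assms sym_ops_lincomb in \<open>simp_all add: symmetry_space_eq\<close>)
qed

lemma G_Q_commute: "D \<in> G k \<Longrightarrow> k \<ge> 0 \<Longrightarrow> graded_commutator 1 k Q D = 0"
  by (cases "k = 0") (simp_all add: symmetry_space_eq commutator_zero Q_linops)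

text \<open>The two terms with D between two copies of Q have opposite signs, and the others contain
  Q applied twice.\<close>

lemma Q_square_commutator:
  assumes D: "D \<in> linops"
  shows "graded_commutator 1 (k + 1) Q (graded_commutator 1 k Q D) = 0"
proof
  fix u
  have "sg (1 * (k + 1)) = - sg (1 * k)" by (simp add: sg_def)
  then show "graded_commutator 1 (k + 1) Q (graded_commutator 1 k Q D) u = 0 u"
    unfolding sop_apply graded_commutator_sg
      linops_diff[OF Q_linops linops_SF[OF Q_linops] linops_SF[OF D]] Q_Q linops_0[OF D]
    by simp
qed

lemma Q_sym_ops:
  assumes "D \<in> sym_ops k" and k: "k < 0"
  shows "graded_commutator 1 k Q D \<in> sym_ops (1 + k)"
  using assms(1)
proof (elim sym_opsE)
  fix T a b c
  assume 1: "T \<in> base_ders k" "T \<in> fder k" "a \<in> dforms (k + 1)" "b \<in> dforms (k + 2)" "c \<in> dforms (k + 1)"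
    and D: "D = Op T a b c"
  have deg: "F \<in> dforms (1 + 1)" "H \<in> dforms (1 + 2)" "Fb \<in> dforms (1 + 1)"
    using F H Fb by simp_all
  have "\<exists>S\<in>base_ders (1 + k). \<forall>\<omega>\<in>\<Omega>. d (T \<omega>) - sg (1 * k) *\<^sub>R T (d \<omega>) = S \<omega>"
  proof (cases "k = -1")
    case True
    then obtain Y where "Y \<in> V" "T = contract Y"
      using 1(1) by (auto simp: base_ders_def)
    with True show ?thesis
      by (intro bexI[of _ "lie Y"]) (auto simp: base_ders_def sg_def contract_d)
  next
    case False
    then have T: "T = (\<lambda>_. 0)" using base_ders_other[OF 1(1)] k by auto
    show ?thesis
    proof (cases "k = -2")
      case True
      \<comment> \<open>From degree -2 the bracket with Q lands in degree -1, where the operator on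
        forms has to be a contraction; the zero operator is the one with the zero vector
        field.\<close>
      then show ?thesis by (intro bexI[of _ "contract 0"]) (auto simp: T base_ders_def)
    next
      case neq: False
      with False k show ?thesis by (intro bexI[of _ "\<lambda>_. 0"]) (auto simp: T base_ders_def)
    qed
  qed
  then obtain S where S: "S \<in> base_ders (1 + k)" "\<And>\<omega>. \<omega> \<in> \<Omega> \<Longrightarrow> d (T \<omega>) - sg (1 * k) *\<^sub>R T (d \<omega>) = S \<omega>"
    by blast
  show ?thesis
    unfolding D Q_Op Op_commutator[OF d_fder 1(2) deg 1(3-5)]
    by (rule sym_opsI[OF S]) (rule commutator_dforms[OF d_fder 1(2) deg 1(3-5)] | assumption)+
qed

lemma Q_G:
  assumes D: "D \<in> G k" shows "graded_commutator 1 k Q D \<in> G (k + 1)"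
proof (cases "k < 0")
  case True
  with D have "D \<in> sym_ops k" by (simp add: symmetry_space_eq)
  from Q_sym_ops[OF this True] have S: "graded_commutator 1 k Q D \<in> sym_ops (k + 1)"
    by (simp add: add.commute)
  show ?thesis
  \<comment> \<open>For k = -1 the image lies in degree 0, where it must also commute with Q; this
    follows from Q squaring to 0.\<close>
  proof (cases "k = -1")
    case True
    then show ?thesis
      using S Q_square_commutator[OF G_linops[OF D], of "-1"] by (simp add: symmetry_space_eq)
  qed (use S True in \<open>simp add: symmetry_space_eq\<close>)
qed (simp add: G_Q_commute[OF D] G_zero)

lemma G_commutator:
  assumes D: "D \<in> G k" and E: "E \<in> G l"
  shows "graded_commutator k l D E \<in> G (k + l)"
proof (cases "k \<le> 0 \<and> l \<le> 0 \<and> D \<in> sym_ops k \<and> E \<in> sym_ops l")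
  case True
  then have S: "graded_commutator k l D E \<in> sym_ops (k + l)"
    by (intro sym_ops_commutator) auto
  show ?thesis
  proof (cases "k + l < 0")
    case False
    then have kl: "k = 0" "l = 0" using True by auto
    \<comment> \<open>By the Jacobi identity, operators that commute with Q have a commutator that
      commutes with Q.\<close>
    have "graded_commutator 1 0 Q (graded_commutator 0 0 D E) = 0"
      using graded_commutator_jacobi[OF Q_linops G_linops[OF D] G_linops[OF E], of 1 0 0]
        G_Q_commute[OF D] G_Q_commute[OF E] kl
      by (simp add: commutator_zero G_linops[OF D] G_linops[OF E])
    with S kl show ?thesis by (simp add: symmetry_space_eq)
  qed (use S in \<open>simp add: symmetry_space_eq\<close>)
next
  case False
  then have "D = 0 \<or> E = 0" using G_sym_ops[OF D] G_sym_ops[OF E] by blast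
  then show ?thesis
    using commutator_zero G_linops[OF D] G_linops[OF E] G_zero by auto
qed

abbreviation L where "L \<equiv> symmetries M F Fb H"

lemma L_simps: "gr L = G" "brk L = graded_commutator"
  by (simp_all add: symmetries_def)

text \<open>The cutoff of the differential is invisible on symmetries, since those of degree 0
  commute with Q. So the differential is the bracket with Q in all degrees, and its derivation rule
  becomes an instance of Jacobi.\<close>

lemma diff_L: "D \<in> G k \<Longrightarrow> diff L k D = graded_commutator 1 k Q D"
  by (simp add: symmetries_def G_Q_commute)

lemma G_subspace: "subspace (G k)"
  unfolding subspace_def
proof (intro conjI ballI allI)
  show "0 \<in> G k" by (rule G_zero)
  show "D + E \<in> G k" if "D \<in> G k" "E \<in> G k" for D E
    using G_lincomb[OF that, of 1] by simp
  show "r *\<^sub>R D \<in> G k" if "D \<in> G k" for r D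
    using G_lincomb[OF that G_zero, of r] by simp
qed

lemma dg_lie_symmetries: "dg_lie_algebra L"
  unfolding dg_lie_algebra_def
proof (intro conjI allI ballI)
  show "graded_complex_with_bracket L"
    unfolding graded_complex_with_bracket_def L_simps
  proof (intro conjI allI ballI)
    fix k l
    show "subspace (G k)" by (rule G_subspace)
    show "linear_between (G k) (G (k + 1)) (diff L k)"
      unfolding linear_between_def
      using graded_commutator_lincomb_right[OF Q_linops G_linops G_linops]
      by (auto simp: diff_L Q_G G_lincomb)
    show "diff L (k + 1) (diff L k x) = 0" if "x \<in> G k" for x
      using that by (simp add: diff_L Q_G Q_square_commutator G_linops)
    show "linear_between (G l) (G (k + l)) (graded_commutator k l x)" if "x \<in> G k" for x
      unfolding linear_between_def
      using graded_commutator_lincomb_right[OF G_linops[OF that] G_linops G_linops] G_commutator[OF that] by blast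
    show "linear_between (G k) (G (k + l)) (\<lambda>x. graded_commutator k l x y)" if "y \<in> G l" for y
      unfolding linear_between_def
      using graded_commutator_lincomb_left[OF G_linops G_linops G_linops[OF that]] G_commutator[OF _ that] by blast
  qed
  show "brk L k l x y = - ((-1) powi (k * l)) *\<^sub>R brk L l k y x" for k l x y
    unfolding L_simps powi_minus_one by (rule graded_commutator_antisym)
  show "graded_leibniz L"
    unfolding graded_leibniz_def L_simps powi_minus_one
    using graded_commutator_jacobi[OF G_linops G_linops G_linops] by blast
  show "diff_is_derivation L k l" for k l
    unfolding diff_is_derivation_def L_simps powi_minus_one
  proof (intro ballI)
    fix x y assume x: "x \<in> G k" and y: "y \<in> G l"
    show "diff L (k + l) (graded_commutator k l x y) =
        graded_commutator (k + 1) l (diff L k x) y + sg k *\<^sub>R graded_commutator k (l + 1) x (diff L l y)"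
      using graded_commutator_jacobi[OF Q_linops G_linops[OF x] G_linops[OF y], of 1 k l]
      by (simp add: diff_L x y G_commutator add.commute)
  qed
qed

lemma G_graded_derivations: "G k \<subseteq> graded_derivations M k"
proof
  fix D assume "D \<in> G k"
  then consider "D \<in> sym_ops k" | "D = 0" using G_sym_ops by blast
  then show "D \<in> graded_derivations M k"
  proof cases
    case 2
    then show ?thesis
      using Op_graded_derivation[OF zero_fder zero_dforms zero_dforms zero_dforms, of k] by simp
  qed (rule sym_ops_graded_derivations)
qed

lemma dual_ops_Q: "dual_ops 1 Q (Q_P M Fb F H)"
proof -
  have deg: "F \<in> dforms (1 + 1)" "H \<in> dforms (1 + 2)" "Fb \<in> dforms (1 + 1)"
    using F H Fb by simp_all
  show ?thesis
    using dual_opsI[OF d_fder deg] unfolding Q_Op tdual_data.Q_Op[OF tdual_data_swap]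
    by (simp add: sg_def)
qed

lemma G_dual: "D \<in> G k \<Longrightarrow> \<exists>E. dual_ops k D E"
  using G_sym_ops sym_ops_dual dual_ops_0 by metis

text \<open>Only degree 0 carries a condition. There the bracket of the dual Q with E is dual to the
  bracket of Q with D, which is 0, and the only dual of 0 is 0.\<close>

lemma G_dual_mem:
  assumes D: "D \<in> G k" and dual: "dual_ops k D E" shows "E \<in> symmetry_space M Fb F H k"
proof -
  interpret dual: tdual_data M Fb F H by (rule tdual_data_swap)
  have S: "E \<in> sym_ops k" if "D \<in> sym_ops k"
    using sym_ops_dual[OF that] dual_ops_functional[OF dual] by blast
  consider "k < 0" | "k = 0" | "k > 0" by linarith
  then show ?thesis
  proof cases
    case 1
    with D S show ?thesis by (simp add: symmetry_space_eq dual.symmetry_space_eq)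
  next
    case 2
    have "dual_ops (1 + 0) (graded_commutator 1 0 Q D) (graded_commutator 1 0 dual.Q E)"
      using dual_ops_commutator[OF dual_ops_Q] dual 2 by blast
    moreover have "graded_commutator 1 0 Q D = 0"
      using G_Q_commute[OF D] 2 by simp
    ultimately have "graded_commutator 1 0 dual.Q E = 0"
      using dual_ops_functional[OF _ dual_ops_0] by metis
    with D S 2 show ?thesis by (simp add: symmetry_space_eq dual.symmetry_space_eq)
  next
    case 3
    with D have "D = 0" by (simp add: symmetry_space_eq)
    with dual have "E = 0" using dual_ops_functional[OF _ dual_ops_0] by metis
    then show ?thesis by (simp add: dual.G_zero)
  qed
qed

text \<open>Each property of \<Phi> is a property of the relation: linearity comes from its
  stability under linear combinations, the inverse from its symmetry, and compatibility with
  brackets from \<open>dual_ops_commutator\<close>. The differential is the bracket with Q, which is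
  itself related to the dual Q.\<close>

lemma dg_isomorphism_dual:
  assumes \<Phi>: "\<And>k D. D \<in> G k \<Longrightarrow> dual_ops k D (\<Phi> k D)"
  shows "dg_isomorphism L (symmetries M Fb F H) \<Phi>"
proof -
  interpret dual: tdual_data M Fb F H by (rule tdual_data_swap)
  have mem: "\<Phi> k D \<in> dual.G k" if "D \<in> G k" for k D
    using G_dual_mem[OF that \<Phi>[OF that]] .
  have val: "\<Phi> k D = E" if "D \<in> G k" "dual_ops k D E" for k D E
    using dual_ops_functional[OF \<Phi>[OF that(1)] that(2)] .
  show ?thesis
    unfolding dg_isomorphism_def L_simps dual.L_simps
  proof (intro conjI allI ballI)
    fix k l
    show "linear_between (G k) (dual.G k) (\<Phi> k)"
      unfolding linear_between_def using mem val G_lincomb dual_ops_lincomb[OF \<Phi> \<Phi>] by blast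
    show "bij_betw (\<Phi> k) (G k) (dual.G k)"
      unfolding bij_betw_def
    proof (intro conjI inj_onI equalityI subsetI)
      show "D = E" if "D \<in> G k" "E \<in> G k" "\<Phi> k D = \<Phi> k E" for D E
        using dual_ops_functional[OF dual_ops_sym[OF \<Phi>[OF that(1)]]] dual_ops_sym[OF \<Phi>[OF that(2)]] that(3) by simp
      show "E \<in> dual.G k" if "E \<in> \<Phi> k ` G k" for E
        using that mem by blast
      show "E \<in> \<Phi> k ` G k" if E: "E \<in> dual.G k" for E
      proof -
        obtain D where D: "dual_ops k E D" using dual.G_dual[OF E] by blast
        then have "D \<in> G k" by (rule dual.G_dual_mem[OF E])
        with val[OF this dual_ops_sym[OF D]] show ?thesis by blast
      qed
    qed
    show "\<Phi> (k + 1) (diff L k D) = diff dual.L k (\<Phi> k D)" if D: "D \<in> G k" for D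
      using val[OF Q_G[OF D]] dual_ops_commutator[OF dual_ops_Q \<Phi>[OF D]]
      by (simp add: diff_L[OF D] dual.diff_L[OF mem[OF D]] add.commute)
    show "\<Phi> (k + l) (graded_commutator k l D E) = graded_commutator k l (\<Phi> k D) (\<Phi> l E)"
      if "D \<in> G k" "E \<in> G l" for D E
      using val[OF G_commutator[OF that] dual_ops_commutator[OF \<Phi>[OF that(1)] \<Phi>[OF that(2)]]] .
  qed
qed

lemma
  shows dual_ops_lie: "X \<in> V \<Longrightarrow> A \<in> kforms M 1 \<Longrightarrow> Ab \<in> kforms M 1 \<Longrightarrow> B \<in> kforms M 2 \<Longrightarrow>
      dual_ops 0 (D_lie M X + of_form A \<cdot> D_q M + (of_form B + q_var M \<odot> of_form Ab) \<cdot> D_t M)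
        (D_lie M X - of_form Ab \<cdot> D_q M + (of_form B - q_var M \<odot> of_form A) \<cdot> D_t M)"
    and dual_ops_iota: "Y \<in> V \<Longrightarrow> f \<in> C \<Longrightarrow> fb \<in> C \<Longrightarrow> A \<in> kforms M 1 \<Longrightarrow>
      dual_ops (-1) (D_iota M Y + of_form (of_fun f) \<cdot> D_q M + (of_form A + q_var M \<odot> of_form (of_fun fb)) \<cdot> D_t M)
        (D_iota M Y + of_form (of_fun fb) \<cdot> D_q M + (of_form A + q_var M \<odot> of_form (of_fun f)) \<cdot> D_t M)"
    and dual_ops_h: "h \<in> C \<Longrightarrow> dual_ops (-2) (of_form (of_fun h) \<cdot> D_t M) (of_form (of_fun h) \<cdot> D_t M)"
proof -
  have k1: "kforms M 1 = dforms 1" and k2: "kforms M 2 = dforms 2"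
    using kforms_eq_dforms[of 1] kforms_eq_dforms[of 2] by simp_all
  have k0: "of_fun f \<in> dforms 0" if "f \<in> C" for f
    using that dforms_0_iff by blast
  show "dual_ops 0 (D_lie M X + of_form A \<cdot> D_q M + (of_form B + q_var M \<odot> of_form Ab) \<cdot> D_t M)
        (D_lie M X - of_form Ab \<cdot> D_q M + (of_form B - q_var M \<odot> of_form A) \<cdot> D_t M)"
    if *: "X \<in> V" "A \<in> kforms M 1" "Ab \<in> kforms M 1" "B \<in> kforms M 2"
  proof -
    have deg: "A \<in> dforms 1" "Ab \<in> dforms 1" "B \<in> dforms 2" using * by (simp_all only: k1 k2)
    show ?thesis
      unfolding Op_lie[OF deg(1,3,2)[THEN dforms_forms]] Op_lie_dual[OF deg[THEN dforms_forms]]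
      using dual_opsI[OF lie_fder[OF *(1)], of A B Ab] deg by (simp add: sg_def)
  qed
  show "dual_ops (-1) (D_iota M Y + of_form (of_fun f) \<cdot> D_q M + (of_form A + q_var M \<odot> of_form (of_fun fb)) \<cdot> D_t M)
        (D_iota M Y + of_form (of_fun fb) \<cdot> D_q M + (of_form A + q_var M \<odot> of_form (of_fun f)) \<cdot> D_t M)"
    if *: "Y \<in> V" "f \<in> C" "fb \<in> C" "A \<in> kforms M 1"
  proof -
    have deg: "A \<in> dforms 1" using * by (simp only: k1)
    note Op = Op_iota[OF of_fun_forms dforms_forms[OF deg] of_fun_forms]
    show ?thesis
      unfolding Op[OF *(2,3)] Op[OF *(3,2)]
      using dual_opsI[OF contract_fder, of "of_fun f" A "of_fun fb"] deg k0[OF *(2)] k0[OF *(3)] by (simp add: sg_def)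
  qed
  show "dual_ops (-2) (of_form (of_fun h) \<cdot> D_t M) (of_form (of_fun h) \<cdot> D_t M)" if h: "h \<in> C"
    unfolding Op_h[OF of_fun_forms[OF h]]
    using dual_opsI[OF zero_fder, of 0 "-2" "of_fun h" 0] k0[OF h] by simp
qed

text \<open>The prescribed formulas are instances of the graded rule: its sign is -1 in degree 0 and
  +1 in degree -1, and in degree -2 both exchanged coefficients vanish.\<close>

lemma tduality_map_dual:
  assumes \<Phi>: "tduality_map M F Fb H \<Phi>" and D: "D \<in> G k"
  shows "dual_ops k D (\<Phi> k D)"
proof -
  consider "k = 0" | "k = -1" | "k = -2" | "k \<notin> {-2, -1, 0}" by auto
  then show ?thesis
  proof cases
    case 1
    with D obtain X A Ab B where *: "X \<in> V" "A \<in> kforms M 1" "Ab \<in> kforms M 1" "B \<in> kforms M 2"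
      and D': "D = D_lie M X + of_form A \<cdot> D_q M + (of_form B + q_var M \<odot> of_form Ab) \<cdot> D_t M"
      unfolding 1 symmetry_space_def by (simp del: One_nat_def) blast
    have "\<Phi> 0 D = D_lie M X - of_form Ab \<cdot> D_q M + (of_form B - q_var M \<odot> of_form A) \<cdot> D_t M"
      unfolding D' using D unfolding 1 D'
      by (intro \<Phi>[unfolded tduality_map_def Let_def, THEN conjunct1, rule_format, OF *]) (simp only: L_simps)
    with dual_ops_lie[OF *] show ?thesis by (simp add: 1 D')
  next
    case 2
    with D obtain Y f fb A where *: "Y \<in> V" "f \<in> C" "fb \<in> C" "A \<in> kforms M 1"
      and D': "D = D_iota M Y + of_form (of_fun f) \<cdot> D_q M + (of_form A + q_var M \<odot> of_form (of_fun fb)) \<cdot> D_t M"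
      unfolding 2 symmetry_space_def by (simp del: One_nat_def) blast
    have "\<Phi> (-1) D = D_iota M Y + of_form (of_fun fb) \<cdot> D_q M + (of_form A + q_var M \<odot> of_form (of_fun f)) \<cdot> D_t M"
      unfolding D' by (rule \<Phi>[unfolded tduality_map_def, THEN conjunct2, THEN conjunct1, rule_format, OF *])
    with dual_ops_iota[OF *] show ?thesis by (simp add: 2 D')
  next
    case 3
    with D obtain h where *: "h \<in> C" and D': "D = of_form (of_fun h) \<cdot> D_t M"
      unfolding 3 symmetry_space_def by (simp del: One_nat_def) blast
    have "\<Phi> (-2) D = D"
      unfolding D' by (rule \<Phi>[unfolded tduality_map_def, THEN conjunct2, THEN conjunct2, THEN conjunct1, rule_format, OF *])
    with dual_ops_h[OF *] show ?thesis by (simp add: 3 D')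
  next
    case 4
    with D have "D = 0" by (simp add: symmetry_space_def)
    moreover have "\<Phi> k 0 = 0"
      by (rule \<Phi>[unfolded tduality_map_def, THEN conjunct2, THEN conjunct2, THEN conjunct2, rule_format, OF 4])
    ultimately show ?thesis by simp
  qed
qed

text \<open>The formulas prescribe values in terms of coefficients. Choosing any dual of D satisfies
  all of them, because the dual is unique.\<close>

lemma ex_tduality_map: "\<exists>\<Phi>. tduality_map M F Fb H \<Phi>"
proof
  let ?\<Phi> = "\<lambda>k D. SOME E. dual_ops k D E"
  have val: "?\<Phi> k D = E" if "dual_ops k D E" for k D E
    using dual_ops_functional[OF someI[of "dual_ops k D", OF that] that] .
  show "tduality_map M F Fb H ?\<Phi>"
    unfolding tduality_map_def Let_def
    using val[OF dual_ops_lie] val[OF dual_ops_iota] val[OF dual_ops_h] val[OF dual_ops_0]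
    by (intro conjI ballI allI impI)
qed

end

theorem theorem4p4:
  fixes M :: "'a manifold" and F Fb H :: "'a form"
  assumes "smooth_manifold M"
    and "F \<in> kforms M 2" and "ext_d M F = 0"
    and "Fb \<in> kforms M 2" and "ext_d M Fb = 0"
    and "H \<in> kforms M 3" and "ext_d M H + F \<^bold>\<and> Fb = 0"
  shows "dg_lie_algebra (symmetries M F Fb H) \<and> dg_lie_algebra (symmetries M Fb F H) \<and>
    (\<forall>k. gr (symmetries M F Fb H) k \<subseteq> graded_derivations M k) \<and>
    (\<forall>k. gr (symmetries M Fb F H) k \<subseteq> graded_derivations M k) \<and>
    dg_leibniz_algebra (derived (symmetries M F Fb H)) \<and> dg_leibniz_algebra (derived (symmetries M Fb F H)) \<and>
    (\<exists>\<Phi>. tduality_map M F Fb H \<Phi>) \<and>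
    (\<forall>\<Phi>. tduality_map M F Fb H \<Phi> \<longrightarrow>
       dg_isomorphism (symmetries M F Fb H) (symmetries M Fb F H) \<Phi> \<and>
       dg_isomorphism (derived (symmetries M F Fb H)) (derived (symmetries M Fb F H)) (derived_map \<Phi>))"
proof -
  interpret smooth_mfd M
    by (rule smooth_mfd.intro) (fact assms)
  interpret tdual_data M F Fb H
    by (unfold_locales) (use assms kforms_eq_dforms[of 2] kforms_eq_dforms[of 3] in simp_all)
  interpret dual: tdual_data M Fb F H
    by (rule tdual_data_swap)
  have "dg_isomorphism L dual.L \<Phi>" if "tduality_map M F Fb H \<Phi>" for \<Phi>
    using that by (intro dg_isomorphism_dual tduality_map_dual)
  then show ?thesis
    using dg_lie_symmetries dual.dg_lie_symmetries G_graded_derivations dual.G_graded_derivations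
      dg_leibniz_derived dg_isomorphism_derived ex_tduality_map
    unfolding L_simps dual.L_simps by blast
qed

end
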